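(* Let $X$ be a complex manifold and let $\mathscr E$ be an $\mathcal O_X$-module equipped with a connection $\nabla$. Assume that each $x\in X$ is contained in a neighborhood $U$ such that the following conditions hold. (a) $\mathscr E|_U$ is isomorphic to the cokernel of a homomorphism of (possibly infinite rank) free $\mathcal O_U$-modules, i.e. there exist cardinalities $I,J$ and a homomorphism of $\mathcal O_U$-modules $\varphi:\mathcal O_U^I\to\mathcal O_U^J$ such that $\mathscr E|_U\simeq\mathrm{coker}(\varphi)$. (b) Writing $\mathscr F=\mathcal O_U^I$ and $\mathscr G=\mathcal O_U^J$, the quotient $\mathscr G(U)/\varphi(\mathscr F)(U)$ is a finitely generated $\mathcal O(U)$-module, where $\varphi(\mathscr F)$ is the image sheaf of $\varphi$. Then $\mathscr E$ is locally free (of finite rank).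
   Context: $\mathcal O_X$ is the sheaf of holomorphic functions on $X$, and $\Theta_X$ is the sheaf of holomorphic tangent vector fields. $\mathcal O_U^I$ denotes the free $\mathcal O_U$-module (direct sum) of rank $I$. The image sheaf $\varphi(\mathscr F)$ is the sheafification of $V\mapsto\varphi(\mathscr F(V))$. A connection $\nabla$ on an $\mathcal O_X$-module $\mathscr E$ associates to each open $U\subset X$ a bilinear map $\nabla:\Theta_X(U)\times\mathscr E(U)\to\mathscr E(U)$, $(\mathfrak x,s)\mapsto\nabla_{\mathfrak x}s$, such that (i) $\nabla_{\mathfrak x|_V}(s|_V)=(\nabla_{\mathfrak x}s)|_V$ for open $V\subset U$; (ii) for $f\in\mathcal O(U)$, $\nabla_{f\mathfrak x}s=f\nabla_{\mathfrak x}s$ and $\nabla_{\mathfrak x}(fs)=\mathfrak x(f)s+f\nabla_{\mathfrak x}s$. Locally free means locally isomorphic to $\mathcal O^n$ for some $n\in\mathbb N$. *)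

theory Defs
  imports "HOL-Analysis.Analysis" "HOL-Algebra.Module" "HOL-Algebra.AbelCoset"
begin

section \<open>Complex manifolds and holomorphic functions\<close>

text \<open>
  The space of \<open>n\<close>-tuples of complex numbers is the set of sequences vanishing from index \<open>n\<close> on,
  with the subspace topology of the product topology. In this way the dimension is a number
  (possibly 0), and it may differ from chart to chart.
\<close>

definition Cn :: "nat \<Rightarrow> (nat \<Rightarrow> complex) topology" where
  "Cn n = top_of_set {z. \<forall>i\<ge>n. z i = 0}"

text \<open>Holomorphic functions of \<open>n\<close> variables on an open set \<open>D\<close>: continuous, and holomorphic in
  each variable separately.\<close>

definition holomorphic_Cn :: "nat \<Rightarrow> (nat \<Rightarrow> complex) set \<Rightarrow> ((nat \<Rightarrow> complex) \<Rightarrow> complex) \<Rightarrow> bool" where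
  "holomorphic_Cn n D f \<longleftrightarrow> continuous_on D f \<and>
     (\<forall>z\<in>D. \<forall>i<n. (\<lambda>w. f (z(i := w))) field_differentiable at (z i))"

text \<open>A chart \<open>(n, W, \<phi>)\<close> is a homeomorphism \<open>\<phi>\<close> from the open set \<open>W\<close> onto an open subset of
  \<open>Cn n\<close>.\<close>

record 'a cmanifold =
  mtop :: "'a topology"
  charts :: "(nat \<times> 'a set \<times> ('a \<Rightarrow> nat \<Rightarrow> complex)) set"

abbreviation mpoints :: "'a cmanifold \<Rightarrow> 'a set" where
  "mpoints M \<equiv> topspace (mtop M)"

text \<open>No countability axiom is imposed.\<close>

locale complex_manifold =
  fixes M :: "'a cmanifold"
  assumes Hausdorff: "Hausdorff_space (mtop M)"
    and chart_open: "(n, W, \<phi>) \<in> charts M \<Longrightarrow> openin (mtop M) W"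
    and chart_image_open: "(n, W, \<phi>) \<in> charts M \<Longrightarrow> openin (Cn n) (\<phi> ` W)"
    and chart_homeomorphic: "(n, W, \<phi>) \<in> charts M \<Longrightarrow>
      homeomorphic_map (subtopology (mtop M) W) (subtopology (Cn n) (\<phi> ` W)) \<phi>"
    and charts_cover: "mpoints M = (\<Union>(n, W, \<phi>)\<in>charts M. W)"
    and charts_compatible:
      "(n, W, \<phi>) \<in> charts M \<Longrightarrow> (m, W', \<psi>) \<in> charts M \<Longrightarrow> i < m \<Longrightarrow>
       holomorphic_Cn n (\<phi> ` (W \<inter> W')) (\<lambda>z. \<psi> (inv_into W \<phi> z) i)"

definition opens :: "'a cmanifold \<Rightarrow> 'a set \<Rightarrow> 'a set set" where
  "opens M U = {V. openin (mtop M) V \<and> V \<subseteq> U}"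

text \<open>Functions on \<open>U\<close> are extensional (fixed to \<open>undefined\<close> outside \<open>U\<close>), so that restriction is
  \<^const>\<open>restrict\<close>.\<close>

definition hol_ring :: "'a cmanifold \<Rightarrow> 'a set \<Rightarrow> ('a \<Rightarrow> complex) ring" where
  "hol_ring M U =
    \<lparr>carrier = {f \<in> extensional U. \<forall>(n, W, \<phi>)\<in>charts M.
                  holomorphic_Cn n (\<phi> ` (U \<inter> W)) (f \<circ> inv_into W \<phi>)},
     mult = (\<lambda>f g. \<lambda>x\<in>U. f x * g x),
     one = (\<lambda>x\<in>U. 1),
     zero = (\<lambda>x\<in>U. 0),
     add = (\<lambda>f g. \<lambda>x\<in>U. f x + g x)\<rparr>"


section \<open>Sheaves of modules\<close>

text \<open>A presheaf of modules over the sheaf of holomorphic functions on an open set \<open>U\<close>.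
  Only the values on open subsets of \<open>U\<close> matter; in particular, the restriction of a sheaf to a
  smaller open set is given by the same data. \<open>restr E V W\<close> is the restriction from \<open>V\<close> to \<open>W\<close>.
  The ring multiplication that the HOL-Algebra record of modules inherits is never used.\<close>

record ('a, 'e) mod_data =
  sections :: "'a set \<Rightarrow> ('a \<Rightarrow> complex, 'e) module"
  restr :: "'a set \<Rightarrow> 'a set \<Rightarrow> 'e \<Rightarrow> 'e"

locale O_presheaf =
  fixes M :: "'a cmanifold" and U :: "'a set" and E :: "('a, 'e) mod_data"
  assumes module_sections: "V \<in> opens M U \<Longrightarrow> module (hol_ring M V) (sections E V)"
    and restr_closed: "\<lbrakk>V \<in> opens M U; W \<in> opens M V; s \<in> carrier (sections E V)\<rbrakk>
      \<Longrightarrow> restr E V W s \<in> carrier (sections E W)"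
    and restr_add:
      "\<lbrakk>V \<in> opens M U; W \<in> opens M V; s \<in> carrier (sections E V); t \<in> carrier (sections E V)\<rbrakk>
      \<Longrightarrow> restr E V W (s \<oplus>\<^bsub>sections E V\<^esub> t) = restr E V W s \<oplus>\<^bsub>sections E W\<^esub> restr E V W t"
    and restr_smult:
      "\<lbrakk>V \<in> opens M U; W \<in> opens M V; f \<in> carrier (hol_ring M V); s \<in> carrier (sections E V)\<rbrakk>
      \<Longrightarrow> restr E V W (f \<odot>\<^bsub>sections E V\<^esub> s) = restrict f W \<odot>\<^bsub>sections E W\<^esub> restr E V W s"
    and restr_id: "\<lbrakk>V \<in> opens M U; s \<in> carrier (sections E V)\<rbrakk> \<Longrightarrow> restr E V V s = s"
    and restr_restr:
      "\<lbrakk>V \<in> opens M U; W \<in> opens M V; W' \<in> opens M W; s \<in> carrier (sections E V)\<rbrakk>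
      \<Longrightarrow> restr E W W' (restr E V W s) = restr E V W' s"

locale O_module = O_presheaf +
  assumes separated:
      "\<lbrakk>V \<in> opens M U; \<V> \<subseteq> opens M V; \<Union>\<V> = V;
        s \<in> carrier (sections E V); t \<in> carrier (sections E V);
        \<And>W. W \<in> \<V> \<Longrightarrow> restr E V W s = restr E V W t\<rbrakk> \<Longrightarrow> s = t"
    and gluing:
      "\<lbrakk>V \<in> opens M U; \<V> \<subseteq> opens M V; \<Union>\<V> = V;
        \<And>W. W \<in> \<V> \<Longrightarrow> \<sigma> W \<in> carrier (sections E W);
        \<And>W W'. W \<in> \<V> \<Longrightarrow> W' \<in> \<V> \<Longrightarrow> restr E W (W \<inter> W') (\<sigma> W) = restr E W' (W \<inter> W') (\<sigma> W')\<rbrakk>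
       \<Longrightarrow> \<exists>s\<in>carrier (sections E V). \<forall>W\<in>\<V>. restr E V W s = \<sigma> W"

definition module_hom :: "'r ring \<Rightarrow> ('r, 'm) module \<Rightarrow> ('r, 'n) module \<Rightarrow> ('m \<Rightarrow> 'n) set" where
  "module_hom R A B = {h \<in> carrier A \<rightarrow> carrier B.
     (\<forall>x\<in>carrier A. \<forall>y\<in>carrier A. h (x \<oplus>\<^bsub>A\<^esub> y) = h x \<oplus>\<^bsub>B\<^esub> h y) \<and>
     (\<forall>r\<in>carrier R. \<forall>x\<in>carrier A. h (r \<odot>\<^bsub>A\<^esub> x) = r \<odot>\<^bsub>B\<^esub> h x)}"

definition sheaf_hom ::
  "'a cmanifold \<Rightarrow> 'a set \<Rightarrow> ('a, 'e) mod_data \<Rightarrow> ('a, 'f) mod_data \<Rightarrow> ('a set \<Rightarrow> 'e \<Rightarrow> 'f) \<Rightarrow> bool" where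
  "sheaf_hom M U E F h \<longleftrightarrow>
     (\<forall>V\<in>opens M U. h V \<in> module_hom (hol_ring M V) (sections E V) (sections F V) \<and>
        (\<forall>W\<in>opens M V. \<forall>s\<in>carrier (sections E V). restr F V W (h V s) = h W (restr E V W s)))"

definition sheaf_isomorphic ::
  "'a cmanifold \<Rightarrow> 'a set \<Rightarrow> ('a, 'e) mod_data \<Rightarrow> ('a, 'f) mod_data \<Rightarrow> bool" where
  "sheaf_isomorphic M U E F \<longleftrightarrow>
     (\<exists>h. sheaf_hom M U E F h \<and>
        (\<forall>V\<in>opens M U. bij_betw (h V) (carrier (sections E V)) (carrier (sections F V))))"


subsection \<open>Sheafification, quotients, images and cokernels\<close>

text \<open>Elements of the stalk at \<open>p\<close> are equivalence classes of pairs of a neighbourhood of \<open>p\<close> and a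
  section over it.\<close>

definition germ ::
  "'a cmanifold \<Rightarrow> 'a set \<Rightarrow> ('a, 'e) mod_data \<Rightarrow> 'a \<Rightarrow> 'a set \<Rightarrow> 'e \<Rightarrow> ('a set \<times> 'e) set" where
  "germ M U Q p W s =
     {(W', s'). W' \<in> opens M U \<and> p \<in> W' \<and> s' \<in> carrier (sections Q W') \<and>
        (\<exists>N\<in>opens M (W \<inter> W'). p \<in> N \<and> restr Q W N s = restr Q W' N s')}"

text \<open>The sheafification of a presheaf \<open>Q\<close> on \<open>U\<close>: sections are families of germs that are locally
  induced by sections of \<open>Q\<close>. The operations on germs use representatives; the unions below are
  unions of copies of a single germ.\<close>

definition sheafify ::
  "'a cmanifold \<Rightarrow> 'a set \<Rightarrow> ('a, 'e) mod_data \<Rightarrow> ('a, 'a \<Rightarrow> ('a set \<times> 'e) set) mod_data" where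
  "sheafify M U Q =
    \<lparr>sections = (\<lambda>V.
       \<lparr>carrier = {t \<in> extensional V. \<forall>p\<in>V. \<exists>W\<in>opens M V. p \<in> W \<and>
                     (\<exists>s\<in>carrier (sections Q W). \<forall>q\<in>W. t q = germ M U Q q W s)},
        mult = undefined, one = undefined,
        zero = (\<lambda>q\<in>V. germ M U Q q V \<zero>\<^bsub>sections Q V\<^esub>),
        add = (\<lambda>t u. \<lambda>q\<in>V. \<Union>{germ M U Q q W (a \<oplus>\<^bsub>sections Q W\<^esub> b) | W a b.
                 (W, a) \<in> t q \<and> (W, b) \<in> u q}),
        smult = (\<lambda>f t. \<lambda>q\<in>V. \<Union>{germ M U Q q W (restrict f W \<odot>\<^bsub>sections Q W\<^esub> a) | W a.
                 (W, a) \<in> t q \<and> W \<subseteq> V})\<rparr>),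
     restr = (\<lambda>V W t. restrict t W)\<rparr>"

text \<open>For a presheaf \<open>P\<close> of submodules of a sheaf \<open>G\<close>, the sheafification of \<open>P\<close> is realised inside
  \<open>G\<close>, as the sections of \<open>G\<close> that locally belong to \<open>P\<close>.\<close>

definition generated_subsheaf ::
  "'a cmanifold \<Rightarrow> ('a, 'e) mod_data \<Rightarrow> ('a set \<Rightarrow> 'e set) \<Rightarrow> ('a, 'e) mod_data" where
  "generated_subsheaf M G P = G\<lparr>sections := (\<lambda>V. (sections G V)\<lparr>carrier :=
     {s \<in> carrier (sections G V). \<forall>p\<in>V. \<exists>W\<in>opens M V. p \<in> W \<and> restr G V W s \<in> P W}\<rparr>)\<rparr>"

definition quotient_module :: "('r, 'm) module \<Rightarrow> 'm set \<Rightarrow> ('r, 'm set) module" where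
  "quotient_module A N =
    \<lparr>carrier = a_rcosets\<^bsub>A\<^esub> N, mult = undefined, one = undefined,
     zero = N, add = (\<lambda>C D. C <+>\<^bsub>A\<^esub> D),
     smult = (\<lambda>r C. \<Union>c\<in>C. N +>\<^bsub>A\<^esub> (r \<odot>\<^bsub>A\<^esub> c))\<rparr>"

definition quotient_presheaf ::
  "('a, 'e) mod_data \<Rightarrow> ('a set \<Rightarrow> 'e set) \<Rightarrow> ('a, 'e set) mod_data" where
  "quotient_presheaf G P =
    \<lparr>sections = (\<lambda>V. quotient_module (sections G V) (P V)),
     restr = (\<lambda>V W C. \<Union>c\<in>C. P W +>\<^bsub>sections G W\<^esub> restr G V W c)\<rparr>"

definition presheaf_image ::
  "('a, 'e) mod_data \<Rightarrow> ('a set \<Rightarrow> 'e \<Rightarrow> 'f) \<Rightarrow> 'a set \<Rightarrow> 'f set" where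
  "presheaf_image F h V = h V ` carrier (sections F V)"

definition image_sheaf ::
  "'a cmanifold \<Rightarrow> ('a, 'e) mod_data \<Rightarrow> ('a, 'f) mod_data \<Rightarrow> ('a set \<Rightarrow> 'e \<Rightarrow> 'f) \<Rightarrow>
   ('a, 'f) mod_data" where
  "image_sheaf M F G h = generated_subsheaf M G (presheaf_image F h)"

definition coker_sheaf ::
  "'a cmanifold \<Rightarrow> 'a set \<Rightarrow> ('a, 'e) mod_data \<Rightarrow> ('a, 'f) mod_data \<Rightarrow> ('a set \<Rightarrow> 'e \<Rightarrow> 'f) \<Rightarrow>
   ('a, 'a \<Rightarrow> ('a set \<times> 'f set) set) mod_data" where
  "coker_sheaf M U F G h = sheafify M U (quotient_presheaf G (presheaf_image F h))"


subsection \<open>Free modules\<close>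

definition product_sheaf :: "'a cmanifold \<Rightarrow> 'i set \<Rightarrow> ('a, 'i \<Rightarrow> 'a \<Rightarrow> complex) mod_data" where
  "product_sheaf M I =
    \<lparr>sections = (\<lambda>V.
       \<lparr>carrier = (\<Pi>\<^sub>E i\<in>I. carrier (hol_ring M V)), mult = undefined, one = undefined,
        zero = (\<lambda>i\<in>I. \<zero>\<^bsub>hol_ring M V\<^esub>),
        add = (\<lambda>s t. \<lambda>i\<in>I. s i \<oplus>\<^bsub>hol_ring M V\<^esub> t i),
        smult = (\<lambda>f s. \<lambda>i\<in>I. f \<otimes>\<^bsub>hol_ring M V\<^esub> s i)\<rparr>),
     restr = (\<lambda>V W s. \<lambda>i\<in>I. restrict (s i) W)\<rparr>"

text \<open>The free module of rank \<open>I\<close> is the sheafification of the presheaf of finitely supported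
  families; for infinite \<open>I\<close> the latter need not be a sheaf.\<close>

definition free_sheaf :: "'a cmanifold \<Rightarrow> 'i set \<Rightarrow> ('a, 'i \<Rightarrow> 'a \<Rightarrow> complex) mod_data" where
  "free_sheaf M I = generated_subsheaf M (product_sheaf M I)
     (\<lambda>V. {s \<in> carrier (sections (product_sheaf M I) V). finite {i\<in>I. s i \<noteq> \<zero>\<^bsub>hol_ring M V\<^esub>}})"

definition locally_free :: "'a cmanifold \<Rightarrow> ('a, 'e) mod_data \<Rightarrow> bool" where
  "locally_free M E \<longleftrightarrow>
     (\<forall>x\<in>mpoints M. \<exists>U n. openin (mtop M) U \<and> x \<in> U \<and>
        sheaf_isomorphic M U E (free_sheaf M {..<n::nat}))"

definition finitely_generated :: "'r ring \<Rightarrow> ('r, 'm) module \<Rightarrow> bool" where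
  "finitely_generated R A \<longleftrightarrow>
     (\<exists>S\<subseteq>carrier A. finite S \<and>
        (\<forall>m\<in>carrier A. \<exists>c\<in>S \<rightarrow> carrier R. m = (\<Oplus>\<^bsub>A\<^esub>s\<in>S. c s \<odot>\<^bsub>A\<^esub> s)))"


section \<open>Vector fields and connections\<close>

definition holomorphic_near :: "'a cmanifold \<Rightarrow> 'a \<Rightarrow> ('a \<Rightarrow> complex) \<Rightarrow> bool" where
  "holomorphic_near M p f \<longleftrightarrow>
     (\<exists>V. openin (mtop M) V \<and> p \<in> V \<and> restrict f V \<in> carrier (hol_ring M V))"

text \<open>Holomorphic tangent vectors at \<open>p\<close> are the point derivations of the ring of germs of
  holomorphic functions at \<open>p\<close>; by convention they vanish on functions that are not holomorphic
  near \<open>p\<close>.\<close>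

definition tangent_space :: "'a cmanifold \<Rightarrow> 'a \<Rightarrow> (('a \<Rightarrow> complex) \<Rightarrow> complex) set" where
  "tangent_space M p = {D.
     (\<forall>f. \<not> holomorphic_near M p f \<longrightarrow> D f = 0) \<and>
     (\<forall>f g. holomorphic_near M p f \<longrightarrow> holomorphic_near M p g \<longrightarrow>
        (\<exists>V. openin (mtop M) V \<and> p \<in> V \<and> (\<forall>x\<in>V. f x = g x)) \<longrightarrow> D f = D g) \<and>
     (\<forall>f c. holomorphic_near M p f \<longrightarrow> D (\<lambda>x. c * f x) = c * D f) \<and>
     (\<forall>f g. holomorphic_near M p f \<longrightarrow> holomorphic_near M p g \<longrightarrow>
        D (\<lambda>x. f x + g x) = D f + D g \<and> D (\<lambda>x. f x * g x) = D f * g p + f p * D g)}"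

text \<open>A vector field is holomorphic if it maps holomorphic functions to holomorphic functions.\<close>

definition Theta :: "'a cmanifold \<Rightarrow> ('a, 'a \<Rightarrow> ('a \<Rightarrow> complex) \<Rightarrow> complex) mod_data" where
  "Theta M =
    \<lparr>sections = (\<lambda>U.
       \<lparr>carrier = {v \<in> (\<Pi>\<^sub>E p\<in>U. tangent_space M p).
                     \<forall>V\<in>opens M U. \<forall>f\<in>carrier (hol_ring M V). (\<lambda>p\<in>V. v p f) \<in> carrier (hol_ring M V)},
        mult = undefined, one = undefined,
        zero = (\<lambda>p\<in>U. \<lambda>f. 0),
        add = (\<lambda>v w. \<lambda>p\<in>U. \<lambda>f. v p f + w p f),
        smult = (\<lambda>h v. \<lambda>p\<in>U. \<lambda>f. h p * v p f)\<rparr>),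
     restr = (\<lambda>U V v. restrict v V)\<rparr>"

text \<open>Bilinearity is over the complex numbers, which act as constant functions.\<close>

locale connection =
  fixes M :: "'a cmanifold" and E :: "('a, 'e) mod_data"
    and nabla :: "'a set \<Rightarrow> ('a \<Rightarrow> ('a \<Rightarrow> complex) \<Rightarrow> complex) \<Rightarrow> 'e \<Rightarrow> 'e"
  assumes nabla_closed:
      "\<lbrakk>openin (mtop M) U; v \<in> carrier (sections (Theta M) U); s \<in> carrier (sections E U)\<rbrakk>
      \<Longrightarrow> nabla U v s \<in> carrier (sections E U)"
    and nabla_add_left:
      "\<lbrakk>openin (mtop M) U; v \<in> carrier (sections (Theta M) U); w \<in> carrier (sections (Theta M) U);
        s \<in> carrier (sections E U)\<rbrakk>
      \<Longrightarrow> nabla U (v \<oplus>\<^bsub>sections (Theta M) U\<^esub> w) s = nabla U v s \<oplus>\<^bsub>sections E U\<^esub> nabla U w s"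
    and nabla_add_right:
      "\<lbrakk>openin (mtop M) U; v \<in> carrier (sections (Theta M) U);
        s \<in> carrier (sections E U); t \<in> carrier (sections E U)\<rbrakk>
      \<Longrightarrow> nabla U v (s \<oplus>\<^bsub>sections E U\<^esub> t) = nabla U v s \<oplus>\<^bsub>sections E U\<^esub> nabla U v t"
    and nabla_scale_left:
      "\<lbrakk>openin (mtop M) U; v \<in> carrier (sections (Theta M) U); s \<in> carrier (sections E U)\<rbrakk>
      \<Longrightarrow> nabla U ((\<lambda>x\<in>U. c) \<odot>\<^bsub>sections (Theta M) U\<^esub> v) s = (\<lambda>x\<in>U. c) \<odot>\<^bsub>sections E U\<^esub> nabla U v s"
    and nabla_scale_right:
      "\<lbrakk>openin (mtop M) U; v \<in> carrier (sections (Theta M) U); s \<in> carrier (sections E U)\<rbrakk>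
      \<Longrightarrow> nabla U v ((\<lambda>x\<in>U. c) \<odot>\<^bsub>sections E U\<^esub> s) = (\<lambda>x\<in>U. c) \<odot>\<^bsub>sections E U\<^esub> nabla U v s"
    and nabla_restr:
      "\<lbrakk>openin (mtop M) U; V \<in> opens M U; v \<in> carrier (sections (Theta M) U);
        s \<in> carrier (sections E U)\<rbrakk>
      \<Longrightarrow> nabla V (restr (Theta M) U V v) (restr E U V s) = restr E U V (nabla U v s)"
    and nabla_smult:
      "\<lbrakk>openin (mtop M) U; f \<in> carrier (hol_ring M U); v \<in> carrier (sections (Theta M) U);
        s \<in> carrier (sections E U)\<rbrakk>
      \<Longrightarrow> nabla U (f \<odot>\<^bsub>sections (Theta M) U\<^esub> v) s = f \<odot>\<^bsub>sections E U\<^esub> nabla U v s"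
    and nabla_Leibniz:
      "\<lbrakk>openin (mtop M) U; f \<in> carrier (hol_ring M U); v \<in> carrier (sections (Theta M) U);
        s \<in> carrier (sections E U)\<rbrakk>
      \<Longrightarrow> nabla U v (f \<odot>\<^bsub>sections E U\<^esub> s) =
          ((\<lambda>x\<in>U. v x f) \<odot>\<^bsub>sections E U\<^esub> s) \<oplus>\<^bsub>sections E U\<^esub> (f \<odot>\<^bsub>sections E U\<^esub> nabla U v s)"

end

theory Submission
  imports Defs "HOL-Complex_Analysis.Cauchy_Integral_Formula"
begin

text \<open>
  Let \<open>x\<close> be a point. The hypotheses provide, on a neighbourhood of \<open>x\<close>, an epimorphism onto \<open>E\<close> from the
  free sheaf on \<open>J\<close> with kernel generated by the images of the basis of the free sheaf on \<open>I\<close>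
  (\<open>cokernel_epi\<close>), and finitely many sections \<open>s\<^sub>1, \<dots>, s\<^sub>n\<close> such that the images of all basis elements
  \<open>j \<in> J\<close> are combinations of them over the whole neighbourhood (\<open>spans_of_finitely_generated\<close>). Take \<open>n\<close>
  minimal, allowing the neighbourhood to shrink. Then a relation \<open>\<Sum>\<^sub>k a\<^sub>k s\<^sub>k = 0\<close> near \<open>x\<close> has \<open>a\<^sub>k(x) = 0\<close>
  for all \<open>k\<close>, because otherwise it could be solved for one of the generators (\<open>spans_eliminate\<close>).

  By an argument as in Schanuel's lemma, the sheaf of relations between the \<open>s\<^sub>k\<close> is generated by a family
  \<open>R\<close> of relations defined on a whole coordinate box \<open>B\<close> around \<open>x\<close>. Pointwise: if all \<open>r \<in> R\<close> vanish at
  \<open>p \<in> B\<close>, then every relation near \<open>p\<close> vanishes at \<open>p\<close> (\<open>relations_value_zero\<close>).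

  The connection differentiates relations. For a coordinate vector field \<open>\<partial>\<^sub>i\<close> write \<open>\<nabla>s\<^sub>k = \<Sum>\<^sub>l \<gamma>\<^sub>k\<^sub>l s\<^sub>l\<close>
  near \<open>p\<close>; with \<open>a\<close> also the tuple with components \<open>\<partial>\<^sub>i a\<^sub>l + \<Sum>\<^sub>k a\<^sub>k \<gamma>\<^sub>k\<^sub>l\<close> is a relation
  (\<open>relation_derivative\<close>). So if all relations near \<open>p\<close> vanish at \<open>p\<close>, then by induction all their
  derivatives in the \<open>i\<close>-th coordinate vanish at \<open>p\<close>, and by the identity theorem in one variable the \<open>r \<in> R\<close>
  vanish along the coordinate line through \<open>p\<close>. Starting at \<open>x\<close> and moving along one coordinate after the
  other reaches every point of \<open>B\<close> (\<open>generator_relations_vanish_on_box\<close>). Hence there are no nonzero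
  relations on open subsets of \<open>B\<close>, and the \<open>s\<^sub>k\<close> form a basis of \<open>E\<close> over \<open>B\<close> (\<open>isomorphic_free\<close>).

  Analysis in several variables enters only through the coordinate vector fields: that partial
  derivatives are holomorphic and that holomorphy does not depend on the chart. Both are derived from
  Cauchy's integral formula in one variable.
\<close>

section \<open>Open sets in complex coordinate space\<close>

lemma open_rectangle:
  assumes "open S" "(x, y) \<in> S"
  obtains A B where "open A" "open B" "x \<in> A" "y \<in> B" "A \<times> B \<subseteq> S"
proof -
  obtain A B where "open A" "open B" "(x, y) \<in> A \<times> B" "A \<times> B \<subseteq> S"
    using open_prod_elim[OF assms] by blast
  then show thesis using that by simp
qed

lemma Cn_openin_zero:
  assumes "openin (Cn n) D" "z \<in> D"
  shows "\<forall>i\<ge>n. z i = 0"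
  using assms openin_imp_subset by (fastforce simp: Cn_def)

lemma continuous_on_fun_upd:
  fixes f :: "'t::topological_space \<Rightarrow> 'i \<Rightarrow> 'b::topological_space"
  assumes "continuous_on A f" "continuous_on A g"
  shows "continuous_on A (\<lambda>t. (f t)(i := g t))"
proof (rule continuous_on_coordinatewise_then_product)
  fix j
  have "continuous_on A (\<lambda>t. f t j)"
    using assms(1) by (rule continuous_on_product_then_coordinatewise)
  then show "continuous_on A (\<lambda>t. ((f t)(i := g t)) j)"
    using assms(2) by (cases "j = i") auto
qed

lemma Cn_openin_preimage:
  assumes "openin (Cn n) D" "continuous_on A h" "open A" "\<And>t i. t \<in> A \<Longrightarrow> i \<ge> n \<Longrightarrow> h t i = 0"
  shows "open {t \<in> A. h t \<in> D}"
proof -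
  obtain T where T: "open T" "D = {z. \<forall>i\<ge>n. z i = 0} \<inter> T"
    using assms(1) by (auto simp: Cn_def openin_open)
  have "{t \<in> A. h t \<in> D} = h -` T \<inter> A"
    using assms(4) T(2) by auto
  then show ?thesis
    using assms(2,3) T(1) by (metis continuous_on_open_vimage)
qed

lemma Cn_openin_upd2:
  fixes z :: "nat \<Rightarrow> complex"
  assumes D: "openin (Cn n) D" and z: "z \<in> D" and i: "i < n" and j: "j < n"
  obtains e where "e > 0"
    "\<And>u w. u \<in> cball (z j) e \<Longrightarrow> w \<in> cball (z i) e \<Longrightarrow> z(j := u, i := w) \<in> D"
proof -
  let ?h = "\<lambda>(u::complex, w::complex). z(j := u, i := w)"
  have "continuous_on UNIV ?h"
    unfolding split_beta by (intro continuous_on_fun_upd continuous_intros)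
  then have "open {t \<in> UNIV. ?h t \<in> D}"
    by (rule Cn_openin_preimage[OF D]) (use Cn_openin_zero[OF D z] i j in auto)
  moreover have "(z j, z i) \<in> {t \<in> UNIV. ?h t \<in> D}"
    using z by simp
  ultimately obtain e where e: "e > 0" "cball (z j, z i) e \<subseteq> {t \<in> UNIV. ?h t \<in> D}"
    unfolding open_contains_cball by blast
  show thesis
  proof (rule that[of "e/2"])
    fix u w assume uw: "u \<in> cball (z j) (e/2)" "w \<in> cball (z i) (e/2)"
    then have "dist (z j, z i) (u, w) \<le> e"
      using dist_Pair_Pair[of "z j" "z i" u w] sqrt_sum_squares_le_sum_abs[of "dist (z j) u" "dist (z i) w"]
      by simp
    then show "z(j := u, i := w) \<in> D" using e(2) by (auto simp: subset_iff)
  qed (use e in auto)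
qed

lemma Cn_openin_upd:
  assumes D: "openin (Cn n) D" and z: "z \<in> D" and i: "i < n"
  obtains e where "e > 0" "\<And>w. w \<in> cball (z i) e \<Longrightarrow> z(i := w) \<in> D"
proof -
  obtain e where "e > 0"
    "\<And>u w. u \<in> cball (z i) e \<Longrightarrow> w \<in> cball (z i) e \<Longrightarrow> z(i := u, i := w) \<in> D"
    using Cn_openin_upd2[OF D z i i] by blast
  then show thesis using that by auto
qed

lemma Cn_openin_upd_nhd:
  fixes z :: "nat \<Rightarrow> complex"
  assumes D: "openin (Cn n) D" and z: "z \<in> D" and i: "i < n"
  obtains N e where "openin (Cn n) N" "z \<in> N" "N \<subseteq> D" "e > 0"
    "\<And>y w. y \<in> N \<Longrightarrow> w \<in> cball (z i) e \<Longrightarrow> y(i := w) \<in> D" "\<And>y. y \<in> N \<Longrightarrow> y i \<in> ball (z i) e"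
proof -
  let ?h = "\<lambda>(y::nat\<Rightarrow>complex, w::complex). y(i := w)"
  obtain T where T: "open T" "D = {z. \<forall>i\<ge>n. z i = 0} \<inter> T"
    using D by (auto simp: Cn_def openin_open)
  have "continuous_on UNIV ?h"
    unfolding split_beta by (intro continuous_on_fun_upd continuous_intros)
  then have "open (?h -` T)" using T(1) by (simp add: open_vimage)
  moreover have "(z, z i) \<in> ?h -` T" using z T by auto
  ultimately obtain A B where AB: "open A" "open B" "z \<in> A" "z i \<in> B" "A \<times> B \<subseteq> ?h -` T"
    by (rule open_rectangle)
  obtain e where e: "e > 0" "cball (z i) e \<subseteq> B" using AB open_contains_cball by blast
  have op: "open ((\<lambda>y::nat\<Rightarrow>complex. y i) -` ball (z i) e)"
    by (intro open_vimage continuous_on_product_coordinates) auto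
  show thesis
  proof (rule that[of "D \<inter> (A \<inter> (\<lambda>y. y i) -` ball (z i) e)" e])
    show "openin (Cn n) (D \<inter> (A \<inter> (\<lambda>y. y i) -` ball (z i) e))"
      using D AB(1) op unfolding Cn_def by (simp add: openin_Int_open open_Int)
    fix y w assume y: "y \<in> D \<inter> (A \<inter> (\<lambda>y. y i) -` ball (z i) e)" and w: "w \<in> cball (z i) e"
    have "(y, w) \<in> A \<times> B" using y w e by auto
    then have "y(i := w) \<in> T" using AB(5) by auto
    then show "y(i := w) \<in> D" using T(2) y i by auto
  qed (use z AB e in auto)
qed

section \<open>Partial derivatives and the chain rule\<close>

definition partial_deriv :: "nat \<Rightarrow> ((nat \<Rightarrow> complex) \<Rightarrow> complex) \<Rightarrow> (nat \<Rightarrow> complex) \<Rightarrow> complex" where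
  "partial_deriv i f z = deriv (\<lambda>w. f (z(i := w))) (z i)"

lemma holomorphic_Cn_line:
  assumes "holomorphic_Cn n D f" "i < n" "\<And>w. w \<in> S \<Longrightarrow> z(i := w) \<in> D"
  shows "(\<lambda>w. f (z(i := w))) holomorphic_on S"
proof -
  have "(\<lambda>w. f (z(i := w))) field_differentiable (at w)" if "w \<in> S" for w
  proof -
    have "(\<lambda>v. f ((z(i := w))(i := v))) field_differentiable at ((z(i := w)) i)"
      using assms(1,2) assms(3)[OF that] unfolding holomorphic_Cn_def by blast
    then show ?thesis by simp
  qed
  then show ?thesis
    by (simp add: holomorphic_on_def field_differentiable_at_within)
qed

text \<open>
  Cauchy's formula expresses the derivative as an integral over a circle that depends neither on the
  parameter nor on the evaluation point, so that joint continuity of the integrand suffices.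
\<close>

lemma continuous_on_deriv_param:
  fixes q :: "'t::topological_space \<Rightarrow> complex \<Rightarrow> complex"
  assumes cont: "continuous_on (A \<times> cball w0 r) (\<lambda>(x, w). q x w)"
    and hol: "\<And>x. x \<in> A \<Longrightarrow> q x holomorphic_on ball w0 r" and r: "r > 0"
  shows "\<And>x w. x \<in> A \<Longrightarrow> w \<in> ball w0 r \<Longrightarrow> deriv (q x) w =
      1 / (2 * of_real pi * \<i>) * integral (cbox 0 1) (\<lambda>t. q x (circlepath w0 r t) / (circlepath w0 r t - w)^2 * vector_derivative (circlepath w0 r) (at t))"
   and "continuous_on (A \<times> ball w0 r) (\<lambda>(x, w). deriv (q x) w)"
proof -
  have qc: "continuous_on (cball w0 r) (q x)" if "x \<in> A" for x
  proof -
    have "continuous_on (cball w0 r) (\<lambda>w. (\<lambda>(x, w). q x w) (x, w))"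
      by (rule continuous_on_compose2[OF cont]) (use that in \<open>auto intro!: continuous_intros\<close>)
    then show ?thesis by simp
  qed
  show th1: "deriv (q x) w =
      1 / (2 * of_real pi * \<i>) * integral (cbox 0 1) (\<lambda>t. q x (circlepath w0 r t) / (circlepath w0 r t - w)^2 * vector_derivative (circlepath w0 r) (at t))" if "x \<in> A" "w \<in> ball w0 r" for x w
    using Cauchy_derivative_integral_circlepath(2)[OF qc hol that(2)] that(1)
    by (simp add: contour_integral_integral DERIV_imp_deriv)
  have ball: "circlepath w0 r t - w \<noteq> 0" if "w \<in> ball w0 r" for w t
    using that by (auto simp: circlepath dist_norm norm_mult norm_exp_i_times)
  have cb: "circlepath w0 r t \<in> cball w0 r" for t
    using r by (auto simp: circlepath dist_norm norm_mult norm_minus_commute)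
  have c1: "continuous_on B (circlepath w0 r)" for B
    unfolding circlepath by (intro continuous_intros)
  have "continuous_on ((A \<times> ball w0 r) \<times> cbox 0 (1::real))
      (\<lambda>x. (\<lambda>(x, w). q x w) (fst (fst x), circlepath w0 r (snd x)))"
    by (rule continuous_on_compose2[OF cont])
      (use cb in \<open>auto intro!: continuous_intros continuous_on_compose2[OF c1[of UNIV]]\<close>)
  then have q1: "continuous_on ((A \<times> ball w0 r) \<times> cbox 0 (1::real)) (\<lambda>x. q (fst (fst x)) (circlepath w0 r (snd x)))"
    by simp
  have c2: "continuous_on ((A \<times> ball w0 r) \<times> cbox 0 (1::real))
     (\<lambda>((x,w), t). q x (circlepath w0 r t) / (circlepath w0 r t - w)^2 * (2 * pi * \<i> * r * exp (2 * of_real pi * \<i> * t)))"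
    unfolding split_beta
    by (intro continuous_intros q1 continuous_on_compose2[OF c1[of UNIV]]) (use ball in auto)
  have c3: "continuous_on ((A \<times> ball w0 r) \<times> cbox 0 (1::real))
     (\<lambda>(xw, t). q (fst xw) (circlepath w0 r t) / (circlepath w0 r t - snd xw)^2 * vector_derivative (circlepath w0 r) (at t))"
    by (rule continuous_on_eq[OF c2]) (auto simp: vector_derivative_circlepath)
  show "continuous_on (A \<times> ball w0 r) (\<lambda>(x, w). deriv (q x) w)"
    by (rule continuous_on_eq[where f = "\<lambda>xw. 1 / (2 * of_real pi * \<i>) * integral (cbox 0 1) (\<lambda>t. q (fst xw) (circlepath w0 r t) / (circlepath w0 r t - snd xw)^2 * vector_derivative (circlepath w0 r) (at t))"],
       intro continuous_intros integral_continuous_on_param[OF c3]) (auto simp: th1)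
qed

text \<open>
  The \<open>i\<close>-th coordinate, at which the derivative is taken, varies with the point as well. Near a given
  point it stays in one disc, which serves for all points nearby.
\<close>

lemma continuous_on_partial_deriv:
  assumes D: "openin (Cn n) D" and f: "holomorphic_Cn n D f" and i: "i < n"
  shows "continuous_on D (partial_deriv i f)"
proof -
  have "continuous (at z within D) (partial_deriv i f)" if z: "z \<in> D" for z
  proof -
    obtain N e where N: "openin (Cn n) N" "z \<in> N" "N \<subseteq> D" "e > 0"
      "\<And>y w. y \<in> N \<Longrightarrow> w \<in> cball (z i) e \<Longrightarrow> y(i := w) \<in> D" "\<And>y. y \<in> N \<Longrightarrow> y i \<in> ball (z i) e"
      using Cn_openin_upd_nhd[OF D z i] by blast
    have fc: "continuous_on D f" using f by (simp add: holomorphic_Cn_def)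
    have "continuous_on (N \<times> ball (z i) e) (\<lambda>(y, w). deriv (\<lambda>w. f (y(i := w))) w)"
    proof (rule continuous_on_deriv_param(2))
      show "continuous_on (N \<times> cball (z i) e) (\<lambda>(x, w). f (x(i := w)))"
        unfolding split_beta
        by (rule continuous_on_compose2[OF fc])
          (intro continuous_on_fun_upd continuous_on_fst continuous_on_snd continuous_on_id continuous_on_const,
            use N in auto)
      show "(\<lambda>w. f (y(i := w))) holomorphic_on ball (z i) e" if "y \<in> N" for y
        by (rule holomorphic_Cn_line[OF f i]) (use N that in auto)
    qed (use N in auto)
    then have "continuous_on N (\<lambda>y. (\<lambda>(y, w). deriv (\<lambda>w. f (y(i := w))) w) (y, y i))"
    proof (rule continuous_on_compose2)
      show "continuous_on N (\<lambda>y. (y, y i))"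
        by (intro continuous_intros continuous_on_product_then_coordinatewise)
    qed (use N in auto)
    then have "continuous_on N (partial_deriv i f)" unfolding partial_deriv_def by simp
    then have cw: "continuous (at z within N) (partial_deriv i f)"
      using N(2) by (simp add: continuous_on_eq_continuous_within)
    obtain T where T: "open T" "N = {z. \<forall>i\<ge>n. z i = 0} \<inter> T"
      using N(1) by (auto simp: Cn_def openin_open)
    have "at z within N = at z within D"
      by (rule at_within_nhd[of _ T]) (use N T Cn_openin_zero[OF D] in auto)
    with cw show ?thesis by simp
  qed
  then show ?thesis by (simp add: continuous_on_eq_continuous_within)
qed

text \<open>
  In a variable \<open>j \<noteq> i\<close>, Cauchy's integral for the \<open>i\<close>-th partial derivative is differentiated under
  the integral sign; the Leibniz rule needs the joint continuity of the \<open>j\<close>-th partial derivative.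
\<close>

lemma holomorphic_Cn_partial_deriv:
  assumes D: "openin (Cn n) D" and f: "holomorphic_Cn n D f" and i: "i < n"
  shows "holomorphic_Cn n D (partial_deriv i f)"
  unfolding holomorphic_Cn_def
proof (intro conjI ballI allI impI)
  show "continuous_on D (partial_deriv i f)" by (rule continuous_on_partial_deriv[OF assms])
  fix z j assume z: "z \<in> D" and j: "j < n"
  have fc: "continuous_on D f" using f by (simp add: holomorphic_Cn_def)
  obtain e where e: "e > 0"
    "\<And>u w. u \<in> cball (z j) e \<Longrightarrow> w \<in> cball (z i) e \<Longrightarrow> z(j := u, i := w) \<in> D"
    using Cn_openin_upd2[OF D z i j] by blast
  show "(\<lambda>w. partial_deriv i f (z(j := w))) field_differentiable at (z j)"
  proof (cases "i = j")
    case True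
    have "(\<lambda>w. f (z(i := w))) holomorphic_on ball (z i) e"
      by (rule holomorphic_Cn_line[OF f i]) (use e(2)[of "z i"] e(1) True in \<open>auto simp: less_imp_le\<close>)
    then have "deriv (\<lambda>w. f (z(i := w))) field_differentiable at (z i)"
      using e(1) by (meson centre_in_ball holomorphic_deriv holomorphic_on_imp_differentiable_at open_ball)
    then show ?thesis using True by (simp add: partial_deriv_def)
  next
    case False
    define q where "q u w = f (z(j := u, i := w))" for u w
    define q' where "q' u w = partial_deriv j f (z(j := u, i := w))" for u w
    have mem: "z(j := u, i := w) \<in> D" if "u \<in> ball (z j) e" "w \<in> cball (z i) e" for u w
      using e(2) that by (simp add: less_imp_le)
    have hol1: "q u holomorphic_on ball (z i) e" if "u \<in> ball (z j) e" for u
      unfolding q_def by (rule holomorphic_Cn_line[OF f i]) (use mem that in auto)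
    have contq: "continuous_on (ball (z j) e \<times> cball (z i) e) (\<lambda>(u, w). q u w)"
      unfolding q_def split_beta
      by (rule continuous_on_compose2[OF fc])
          (intro continuous_on_fun_upd continuous_on_fst continuous_on_snd continuous_on_id continuous_on_const,
            use mem in auto)
    have contq': "continuous_on (ball (z j) e \<times> cball (z i) e) (\<lambda>(u, w). q' u w)"
      unfolding q'_def split_beta
      by (rule continuous_on_compose2[OF continuous_on_partial_deriv[OF D f j]])
          (intro continuous_on_fun_upd continuous_on_fst continuous_on_snd continuous_on_id continuous_on_const,
            use mem in auto)
    have der: "((\<lambda>u. q u w) has_field_derivative q' u w) (at u within ball (z j) e)"
      if "u \<in> ball (z j) e" "w \<in> cball (z i) e" for u w
    proof -
      have "(\<lambda>v. f ((z(j := u, i := w))(j := v))) field_differentiable at ((z(j := u, i := w)) j)"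
        using f mem[OF that] j unfolding holomorphic_Cn_def by blast
      then have "((\<lambda>v. f ((z(j := u, i := w))(j := v))) has_field_derivative q' u w) (at u)"
        using False unfolding q'_def partial_deriv_def by (simp add: field_differentiable_derivI fun_upd_twist)
      moreover have "(\<lambda>v. f ((z(j := u, i := w))(j := v))) = (\<lambda>v. q v w)"
        using False by (auto simp: q_def fun_upd_twist)
      ultimately show ?thesis by (simp add: has_field_derivative_at_within)
    qed
    let ?c = "circlepath (z i) e"
    let ?F = "\<lambda>u t. q u (?c t) / (?c t - z i)^2 * vector_derivative ?c (at t)"
    have cb: "?c t \<in> cball (z i) e" for t
      using e by (auto simp: circlepath dist_norm norm_mult norm_minus_commute)
    have nz: "?c t \<noteq> z i" for t using e by (auto simp: circlepath)
    have c1: "continuous_on B ?c" for B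
      unfolding circlepath by (intro continuous_intros)
    have cont_gen: "continuous_on (ball (z j) e \<times> cbox 0 (1::real))
       (\<lambda>(u, t). g u (?c t) / (?c t - z i)^2 * vector_derivative ?c (at t))"
      if g: "continuous_on (ball (z j) e \<times> cball (z i) e) (\<lambda>(u, w). g u w)" for g
    proof -
      have "continuous_on (ball (z j) e \<times> cbox 0 (1::real)) (\<lambda>x. (\<lambda>(u, w). g u w) (fst x, ?c (snd x)))"
        by (rule continuous_on_compose2[OF g])
          (use cb in \<open>auto intro!: continuous_intros continuous_on_compose2[OF c1[of UNIV]]\<close>)
      then have g1: "continuous_on (ball (z j) e \<times> cbox 0 (1::real)) (\<lambda>x. g (fst x) (?c (snd x)))"
        by simp
      have "continuous_on (ball (z j) e \<times> cbox 0 (1::real))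
         (\<lambda>(u, t). g u (?c t) / (?c t - z i)^2 * (2 * pi * \<i> * e * exp (2 * of_real pi * \<i> * t)))"
        unfolding split_beta
        by (intro continuous_intros g1 continuous_on_compose2[OF c1[of UNIV]]) (use nz in auto)
      then show ?thesis
        by (rule continuous_on_eq) (auto simp: vector_derivative_circlepath)
    qed
    have int: "?F u integrable_on cbox 0 1" if "u \<in> ball (z j) e" for u
    proof (rule integrable_continuous)
      have "continuous_on (cbox 0 1) (\<lambda>t. (\<lambda>(u, t). ?F u t) (u, t))"
        by (rule continuous_on_compose2[OF cont_gen[OF contq]])
          (use that in \<open>auto intro!: continuous_on_Pair continuous_on_const continuous_on_id\<close>)
      then show "continuous_on (cbox 0 1) (?F u)" by simp
    qed
    have "((\<lambda>u. integral (cbox 0 1) (?F u)) has_field_derivative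
         integral (cbox 0 1) (\<lambda>t. q' (z j) (?c t) / (?c t - z i)^2 * vector_derivative ?c (at t)))
         (at (z j) within ball (z j) e)"
    proof (rule leibniz_rule_field_derivative[OF _ int cont_gen[OF contq']])
      fix u t assume "u \<in> ball (z j) e"
      then show "((\<lambda>u. ?F u t) has_field_derivative
          q' u (?c t) / (?c t - z i)^2 * vector_derivative ?c (at t)) (at u within ball (z j) e)"
        by (intro DERIV_cmult_right DERIV_cdivide der cb)
    qed (use e in auto)
    then have "((\<lambda>u. integral (cbox 0 1) (?F u)) has_field_derivative
         integral (cbox 0 1) (\<lambda>t. q' (z j) (?c t) / (?c t - z i)^2 * vector_derivative ?c (at t))) (at (z j))"
      by (subst (asm) at_within_open) (use e(1) in auto)
    from DERIV_cmult[OF this, of "1 / (2 * of_real pi * \<i>)"]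
    have "(\<lambda>u. 1 / (2 * of_real pi * \<i>) * integral (cbox 0 1) (?F u)) field_differentiable at (z j)"
      unfolding field_differentiable_def by (rule exI)
    then show ?thesis
    proof (rule field_differentiable_transform_within[OF e(1), rotated 2])
      fix u assume "dist u (z j) < e"
      then have u: "u \<in> ball (z j) e" by (simp add: dist_commute)
      have "deriv (q u) (z i) = 1 / (2 * of_real pi * \<i>) * integral (cbox 0 1) (?F u)"
        by (rule continuous_on_deriv_param(1)[OF contq hol1 e(1) u]) (use e in auto)
      moreover have "partial_deriv i f (z(j := u)) = deriv (q u) (z i)"
        using False by (simp add: partial_deriv_def q_def[abs_def])
      ultimately show "1 / (2 * of_real pi * \<i>) * integral (cbox 0 1) (?F u) = partial_deriv i f (z(j := u))"
        by simp
    qed auto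
  qed
qed

text \<open>
  Continuous partial derivatives give the chain rule. The coordinates of the curve are released one
  after the other: \<open>mix k\<close> follows the curve in the first \<open>k\<close> coordinates and rests at \<open>h w0\<close> in the
  others, and releasing the next coordinate is a problem in two variables.
\<close>

lemma holomorphic_Cn_compose_curve:
  assumes D: "openin (Cn n) D" and f: "holomorphic_Cn n D f"
    and S: "open S" and hol: "\<And>i. i < n \<Longrightarrow> (\<lambda>w. h w i) holomorphic_on S"
    and hD: "\<And>w. w \<in> S \<Longrightarrow> h w \<in> D" and w0: "w0 \<in> S"
  shows "(\<lambda>w. f (h w)) field_differentiable at w0"
proof -
  have h0: "h w i = 0" if "i \<ge> n" "w \<in> S" for w i using Cn_openin_zero[OF D hD] that by blast
  have contS: "continuous_on S h"
  proof (rule continuous_on_coordinatewise_then_product)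
    fix i show "continuous_on S (\<lambda>w. h w i)"
      using hol[of i] h0[of i] by (cases "i < n") (auto simp: holomorphic_on_imp_continuous_on cong: continuous_on_cong)
  qed
  define mix where "mix k w = (\<lambda>i. if i < k then h w i else h w0 i)" for k w
  have mix_cont: "continuous_on S (mix k)" for k
  proof (rule continuous_on_coordinatewise_then_product)
    fix i show "continuous_on S (\<lambda>w. mix k w i)"
      unfolding mix_def using continuous_on_product_then_coordinatewise[OF contS, of i]
      by (cases "i < k") auto
  qed
  have mix_w0: "mix k w0 = h w0" for k by (auto simp: mix_def)
  have "k \<le> n \<Longrightarrow> (\<lambda>w. f (mix k w)) field_differentiable at w0" for k
  proof (induction k)
    case 0
    then show ?case by (simp add: mix_def)
  next
    case (Suc k)
    then have k: "k < n" by simp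
    obtain F' where F': "((\<lambda>w. f (mix k w)) has_field_derivative F') (at w0)"
      using Suc by (auto simp: field_differentiable_def)
    let ?P = "\<lambda>(u, v). (mix k u)(k := v)"
    have cP: "continuous_on (S \<times> UNIV) ?P"
      unfolding split_beta
      by (intro continuous_on_fun_upd continuous_on_compose2[OF mix_cont] continuous_intros) auto
    have oP: "open {t \<in> S \<times> UNIV. ?P t \<in> D}"
      by (rule Cn_openin_preimage[OF D cP]) (use S k h0 w0 in \<open>auto simp: mix_def open_Times\<close>)
    have self: "(mix k w0)(k := h w0 k) = h w0" by (auto simp: mix_w0)
    have "(w0, h w0 k) \<in> {t \<in> S \<times> UNIV. ?P t \<in> D}"
      using w0 hD self by auto
    from oP this obtain A B where AB: "open A" "open B" "w0 \<in> A" "h w0 k \<in> B" "A \<times> B \<subseteq> {t \<in> S \<times> UNIV. ?P t \<in> D}"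
      by (rule open_rectangle)
    obtain e where e: "e > 0" "ball (h w0 k) e \<subseteq> B" using AB open_contains_ball by blast
    let ?Y = "ball (h w0 k) e"
    have mem: "(mix k u)(k := v) \<in> D" if "u \<in> A" "v \<in> ?Y" for u v
    proof -
      have "(u, v) \<in> A \<times> B" using that e(2) by auto
      from subsetD[OF AB(5) this] show ?thesis by simp
    qed
    \<comment> \<open>Differentiability in \<open>u\<close> is the induction hypothesis; in \<open>v\<close> the derivative is a
      continuous partial derivative, so the function of the pair is Frechet differentiable.\<close>
    have "((\<lambda>(u, v). f ((mix k u)(k := v))) has_derivative
       (\<lambda>(tu, tv). F' * tu + blinfun_apply (blinfun_mult_right (partial_deriv k f ((mix k w0)(k := h w0 k)))) tv)) (at (w0, h w0 k) within A \<times> ?Y)"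
    proof (rule has_derivative_partialsI[where fy = "\<lambda>u v. blinfun_mult_right (partial_deriv k f ((mix k u)(k := v)))"])
      have "(mix k u)(k := h w0 k) = mix k u" for u
        by (rule fun_upd_idem) (simp add: mix_def)
      then show "((\<lambda>u. f ((mix k u)(k := h w0 k))) has_derivative (*) F') (at w0 within A)"
        using F' by (simp add: has_field_derivative_def has_derivative_at_withinI)
      show "((\<lambda>v. f ((mix k u)(k := v))) has_derivative
           blinfun_apply (blinfun_mult_right (partial_deriv k f ((mix k u)(k := v))))) (at v within ?Y)"
        if "u \<in> A" "v \<in> ?Y" for u v
      proof -
        have "(\<lambda>v'. f ((mix k u)(k := v, k := v'))) field_differentiable at (((mix k u)(k := v)) k)"
          using f mem[OF that] k unfolding holomorphic_Cn_def by blast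
        then have "((\<lambda>v'. f ((mix k u)(k := v'))) has_field_derivative partial_deriv k f ((mix k u)(k := v))) (at v)"
          by (simp add: partial_deriv_def field_differentiable_derivI)
        then show ?thesis
          by (simp add: has_field_derivative_def has_derivative_at_withinI)
      qed
      have "continuous_on (A \<times> ?Y) (\<lambda>t. blinfun_mult_right (partial_deriv k f (?P t)))"
        by (intro bounded_linear.continuous_on[OF bounded_linear_blinfun_mult_right]
            continuous_on_compose2[OF continuous_on_partial_deriv[OF D f k]] continuous_on_subset[OF cP])
           (use AB mem in auto)
      moreover have "(w0, h w0 k) \<in> A \<times> ?Y" using AB(3) e(1) by simp
      ultimately have "continuous (at (w0, h w0 k) within A \<times> ?Y) (\<lambda>t. blinfun_mult_right (partial_deriv k f (?P t)))"
        by (simp add: continuous_on_eq_continuous_within)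
      then show "continuous (at (w0, h w0 k) within A \<times> ?Y) (\<lambda>(u, v). blinfun_mult_right (partial_deriv k f ((mix k u)(k := v))))"
        by (simp add: split_beta')
    qed (use e in auto)
    then have frechet: "((\<lambda>(u, v). f ((mix k u)(k := v))) has_derivative
       (\<lambda>(tu, tv). F' * tu + partial_deriv k f (h w0) * tv)) (at (w0, h w0 k))"
      using AB(1,3) e(1) by (subst (asm) at_within_open) (auto simp: open_Times self)
    obtain h' where h': "((\<lambda>w. h w k) has_field_derivative h') (at w0)"
      using holomorphic_on_imp_differentiable_at[OF hol[OF k] S w0] by (auto simp: field_differentiable_def)
    have "((\<lambda>w. (w, h w k)) has_derivative (\<lambda>t. (t, h' * t))) (at w0)"
      using h' by (auto intro!: derivative_eq_intros simp: has_field_derivative_def)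
    from has_derivative_compose[OF this frechet]
    have "((\<lambda>w. f ((mix k w)(k := h w k))) has_derivative (\<lambda>t. F' * t + partial_deriv k f (h w0) * (h' * t))) (at w0)"
      by simp
    moreover have "(mix k w)(k := h w k) = mix (Suc k) w" for w
      by (auto simp: mix_def)
    moreover have "(\<lambda>t. F' * t + partial_deriv k f (h w0) * (h' * t)) = (*) (F' + partial_deriv k f (h w0) * h')"
      by (auto simp: algebra_simps)
    ultimately show ?case
      by (auto simp: field_differentiable_def has_field_derivative_def)
  qed
  from this[of n] have "(\<lambda>w. f (mix n w)) field_differentiable at w0" by simp
  moreover obtain d where d: "d > 0" "ball w0 d \<subseteq> S" using S w0 open_contains_ball by blast
  ultimately show ?thesis
  proof (elim field_differentiable_transform_within[rotated 3])
    fix w assume "dist w w0 < d"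
    then have "w \<in> S" using d by (auto simp: dist_commute)
    then have "mix n w = h w" using h0 w0 by (auto simp: mix_def)
    then show "f (mix n w) = f (h w)" by simp
  qed auto
qed

text \<open>
  With a transition map for \<open>h\<close>, this carries holomorphy from one chart to another.
\<close>

lemma holomorphic_Cn_compose:
  assumes D: "openin (Cn n) D" and f: "holomorphic_Cn n D f"
    and D': "openin (Cn m) D'" and h: "\<And>i. i < n \<Longrightarrow> holomorphic_Cn m D' (\<lambda>z. h z i)"
    and hD: "h ` D' \<subseteq> D"
  shows "holomorphic_Cn m D' (\<lambda>z. f (h z))"
  unfolding holomorphic_Cn_def
proof (intro conjI ballI allI impI)
  have h0: "h z i = 0" if "i \<ge> n" "z \<in> D'" for z i using Cn_openin_zero[OF D] hD that by blast
  have "continuous_on D' h"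
  proof (rule continuous_on_coordinatewise_then_product)
    fix i show "continuous_on D' (\<lambda>w. h w i)"
      using h[of i] h0[of i] by (cases "i < n") (auto simp: holomorphic_Cn_def cong: continuous_on_cong)
  qed
  with f[unfolded holomorphic_Cn_def, THEN conjunct1] show "continuous_on D' (\<lambda>z. f (h z))"
    using hD by (rule continuous_on_compose2)
  fix z i assume z: "z \<in> D'" and i: "i < m"
  obtain e where e: "e > 0" "\<And>w. w \<in> cball (z i) e \<Longrightarrow> z(i := w) \<in> D'"
    using Cn_openin_upd[OF D' z i] by blast
  show "(\<lambda>w. f (h (z(i := w)))) field_differentiable at (z i)"
  proof (rule holomorphic_Cn_compose_curve[OF D f, of "ball (z i) e"])
    show "(\<lambda>w. h (z(i := w)) k) holomorphic_on ball (z i) e" if "k < n" for k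
      by (rule holomorphic_Cn_line[OF h[OF that] i]) (use e in force)
    show "h (z(i := w)) \<in> D" if "w \<in> ball (z i) e" for w
      using e that hD by force
  qed (use e in auto)
qed

section \<open>Rings of holomorphic functions on a complex manifold\<close>

lemma holomorphic_Cn_subset:
  assumes "holomorphic_Cn n D f" "openin (Cn n) D'" "D' \<subseteq> D" and eq: "\<And>z. z \<in> D' \<Longrightarrow> g z = f z"
  shows "holomorphic_Cn n D' g"
  unfolding holomorphic_Cn_def
proof (intro conjI ballI allI impI)
  have "continuous_on D' f"
    using assms(1,3) unfolding holomorphic_Cn_def by (blast intro: continuous_on_subset)
  then show "continuous_on D' g"
    by (rule continuous_on_eq) (simp add: eq)
  fix z i assume z: "z \<in> D'" and i: "i < n"
  obtain e where e: "e > 0" "\<And>w. w \<in> cball (z i) e \<Longrightarrow> z(i := w) \<in> D'"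
    using Cn_openin_upd[OF assms(2) z i] by blast
  have "(\<lambda>w. f (z(i := w))) field_differentiable at (z i)"
    using assms(1,3) z i unfolding holomorphic_Cn_def by blast
  then show "(\<lambda>w. g (z(i := w))) field_differentiable at (z i)"
  proof (rule field_differentiable_transform_within[OF e(1), rotated 2])
    fix w assume "dist w (z i) < e"
    then have "w \<in> cball (z i) e" by (simp add: dist_commute)
    from eq[OF e(2)[OF this]] show "f (z(i := w)) = g (z(i := w))" by simp
  qed auto
qed

lemma holomorphic_Cn_local:
  assumes "openin (Cn n) D"
    and loc: "\<And>z. z \<in> D \<Longrightarrow> \<exists>D'. openin (Cn n) D' \<and> z \<in> D' \<and> D' \<subseteq> D \<and> holomorphic_Cn n D' f"
  shows "holomorphic_Cn n D f"
  unfolding holomorphic_Cn_def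
proof (intro conjI ballI allI impI)
  have "continuous (at z within D) f" if z: "z \<in> D" for z
  proof -
    obtain N where N: "openin (Cn n) N" "z \<in> N" "N \<subseteq> D" "holomorphic_Cn n N f"
      using loc[OF z] by blast
    then have cw: "continuous (at z within N) f"
      by (simp add: continuous_on_eq_continuous_within holomorphic_Cn_def)
    obtain T where T: "open T" "N = {z. \<forall>i\<ge>n. z i = 0} \<inter> T"
      using N(1) by (auto simp: Cn_def openin_open)
    have "at z within N = at z within D"
      by (rule at_within_nhd[of _ T]) (use N T Cn_openin_zero[OF assms(1)] in auto)
    with cw show ?thesis by simp
  qed
  then show "continuous_on D f" by (simp add: continuous_on_eq_continuous_within)
  fix z i assume z: "z \<in> D" and i: "i < n"
  obtain N where N: "z \<in> N" "holomorphic_Cn n N f"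
    using loc[OF z] by blast
  then show "(\<lambda>w. f (z(i := w))) field_differentiable at (z i)"
    using i unfolding holomorphic_Cn_def by blast
qed

lemma holomorphic_Cn_const: "holomorphic_Cn n D (\<lambda>z. c)"
  unfolding holomorphic_Cn_def by (auto intro: continuous_intros)

lemma holomorphic_Cn_add:
  "holomorphic_Cn n D f \<Longrightarrow> holomorphic_Cn n D g \<Longrightarrow> holomorphic_Cn n D (\<lambda>z. f z + g z)"
  unfolding holomorphic_Cn_def
  by (auto intro!: continuous_on_add field_differentiable_add)

lemma holomorphic_Cn_mult:
  "holomorphic_Cn n D f \<Longrightarrow> holomorphic_Cn n D g \<Longrightarrow> holomorphic_Cn n D (\<lambda>z. f z * g z)"
  unfolding holomorphic_Cn_def
  by (auto intro!: continuous_on_mult field_differentiable_mult)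

lemma holomorphic_Cn_inverse:
  "holomorphic_Cn n D f \<Longrightarrow> (\<And>z. z \<in> D \<Longrightarrow> f z \<noteq> 0) \<Longrightarrow> holomorphic_Cn n D (\<lambda>z. inverse (f z))"
  unfolding holomorphic_Cn_def
  by (auto intro!: continuous_on_inverse field_differentiable_inverse)

lemma hol_ring_sel [simp]:
  "f \<otimes>\<^bsub>hol_ring M U\<^esub> g = (\<lambda>x\<in>U. f x * g x)" "\<one>\<^bsub>hol_ring M U\<^esub> = (\<lambda>x\<in>U. 1)"
  "f \<oplus>\<^bsub>hol_ring M U\<^esub> g = (\<lambda>x\<in>U. f x + g x)" "\<zero>\<^bsub>hol_ring M U\<^esub> = (\<lambda>x\<in>U. 0)"
  by (simp_all add: hol_ring_def)

lemma hol_ring_ext: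
  assumes "f \<in> carrier (hol_ring M U)" "g \<in> carrier (hol_ring M U)" "\<And>x. x \<in> U \<Longrightarrow> f x = g x"
  shows "f = g"
  using assms by (auto simp: hol_ring_def intro: extensionalityI)

lemma hol_ring_restrict_id: "f \<in> carrier (hol_ring M U) \<Longrightarrow> restrict f U = f"
  by (auto simp: hol_ring_def extensional_restrict)

lemma in_hol_ring_iff:
  "f \<in> carrier (hol_ring M U) \<longleftrightarrow> f \<in> extensional U \<and>
    (\<forall>n W \<phi>. (n, W, \<phi>) \<in> charts M \<longrightarrow> holomorphic_Cn n (\<phi> ` (U \<inter> W)) (\<lambda>z. f (inv_into W \<phi> z)))"
  by (auto simp: hol_ring_def comp_def)

lemma opens_subset: "V \<in> opens M U \<Longrightarrow> W \<in> opens M V \<Longrightarrow> W \<in> opens M U"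
  by (auto simp: opens_def)

context complex_manifold
begin

lemma chart_subset: "(n, W, \<phi>) \<in> charts M \<Longrightarrow> W \<subseteq> mpoints M"
  using chart_open openin_subset by blast

lemma chart_inj: "(n, W, \<phi>) \<in> charts M \<Longrightarrow> inj_on \<phi> W"
  using homeomorphic_imp_injective_map[OF chart_homeomorphic] chart_subset
  by (metis topspace_subtopology inf.absorb_iff2)

lemma chart_image_openin:
  assumes c: "(n, W, \<phi>) \<in> charts M" and V: "openin (mtop M) V"
  shows "openin (Cn n) (\<phi> ` (V \<inter> W))"
proof -
  have "openin (subtopology (mtop M) W) (V \<inter> W)"
    using V by (rule openin_subtopology_Int)
  then have "openin (subtopology (Cn n) (\<phi> ` W)) (\<phi> ` (V \<inter> W))"
    using homeomorphic_imp_open_map[OF chart_homeomorphic[OF c]] unfolding open_map_def by blast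
  then show ?thesis
    using chart_image_open[OF c] by (rule openin_trans_full)
qed

lemma chart_preimage_openin:
  assumes c: "(n, W, \<phi>) \<in> charts M" and D: "openin (Cn n) D"
  shows "openin (mtop M) {p \<in> W. \<phi> p \<in> D}"
proof -
  have "continuous_map (subtopology (mtop M) W) (subtopology (Cn n) (\<phi> ` W)) \<phi>"
    by (rule homeomorphic_imp_continuous_map[OF chart_homeomorphic[OF c]])
  then have "openin (subtopology (mtop M) W) {p \<in> topspace (subtopology (mtop M) W). \<phi> p \<in> D \<inter> \<phi> ` W}"
    using openin_subtopology_Int[OF D] unfolding continuous_map_def by blast
  moreover have "{p \<in> topspace (subtopology (mtop M) W). \<phi> p \<in> D \<inter> \<phi> ` W} = {p \<in> W. \<phi> p \<in> D}"
    using chart_subset[OF c] by auto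
  ultimately show ?thesis
    using chart_open[OF c] openin_trans_full by metis
qed

lemma hol_ring_restrict:
  assumes f: "f \<in> carrier (hol_ring M U)" and V: "V \<in> opens M U"
  shows "restrict f V \<in> carrier (hol_ring M V)"
  unfolding in_hol_ring_iff
proof (intro conjI allI impI)
  fix n W \<phi> assume c: "(n, W, \<phi>) \<in> charts M"
  show "holomorphic_Cn n (\<phi> ` (V \<inter> W)) (\<lambda>z. restrict f V (inv_into W \<phi> z))"
  proof (rule holomorphic_Cn_subset)
    show "holomorphic_Cn n (\<phi> ` (U \<inter> W)) (\<lambda>z. f (inv_into W \<phi> z))"
      using f c unfolding in_hol_ring_iff by blast
    show "openin (Cn n) (\<phi> ` (V \<inter> W))"
      using V by (intro chart_image_openin[OF c]) (simp add: opens_def)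
  qed (use V inv_into_f_f[OF chart_inj[OF c]] in \<open>auto simp: opens_def\<close>)
qed auto

lemma hol_ring_local:
  assumes U: "openin (mtop M) U" and f: "f \<in> extensional U"
    and loc: "\<And>p. p \<in> U \<Longrightarrow> \<exists>V\<in>opens M U. p \<in> V \<and> restrict f V \<in> carrier (hol_ring M V)"
  shows "f \<in> carrier (hol_ring M U)"
  unfolding in_hol_ring_iff
proof (intro conjI allI impI)
  fix n W \<phi> assume c: "(n, W, \<phi>) \<in> charts M"
  show "holomorphic_Cn n (\<phi> ` (U \<inter> W)) (\<lambda>z. f (inv_into W \<phi> z))"
  proof (rule holomorphic_Cn_local[OF chart_image_openin[OF c U]])
    fix z assume "z \<in> \<phi> ` (U \<inter> W)"
    then obtain p where p: "p \<in> U" "p \<in> W" "z = \<phi> p" by blast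
    then obtain V where V: "V \<in> opens M U" "p \<in> V" "restrict f V \<in> carrier (hol_ring M V)"
      using loc by blast
    have oV: "openin (Cn n) (\<phi> ` (V \<inter> W))"
      using V by (intro chart_image_openin[OF c]) (simp add: opens_def)
    have "holomorphic_Cn n (\<phi> ` (V \<inter> W)) (\<lambda>z. restrict f V (inv_into W \<phi> z))"
      using V(3) c unfolding in_hol_ring_iff by blast
    then have "holomorphic_Cn n (\<phi> ` (V \<inter> W)) (\<lambda>z. f (inv_into W \<phi> z))"
      by (rule holomorphic_Cn_subset[OF _ oV]) (use inv_into_f_f[OF chart_inj[OF c]] in auto)
    then show "\<exists>D'. openin (Cn n) D' \<and> z \<in> D' \<and> D' \<subseteq> \<phi> ` (U \<inter> W) \<and>
        holomorphic_Cn n D' (\<lambda>z. f (inv_into W \<phi> z))"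
      using oV V p by (intro exI[of _ "\<phi> ` (V \<inter> W)"]) (auto simp: opens_def)
  qed
qed (fact f)

text \<open>
  Closure properties of the rings of holomorphic functions follow from those in charts, although
  restriction changes a function outside \<open>U\<close>.
\<close>

lemma hol_ring_chartwise:
  assumes U: "openin (mtop M) U"
    and hol: "\<And>n W \<phi>. (n, W, \<phi>) \<in> charts M \<Longrightarrow> holomorphic_Cn n (\<phi> ` (U \<inter> W)) (\<lambda>z. f (inv_into W \<phi> z))"
  shows "(\<lambda>x\<in>U. f x) \<in> carrier (hol_ring M U)"
  unfolding in_hol_ring_iff
proof (intro conjI allI impI)
  fix n W \<phi> assume c: "(n, W, \<phi>) \<in> charts M"
  show "holomorphic_Cn n (\<phi> ` (U \<inter> W)) (\<lambda>z. (\<lambda>x\<in>U. f x) (inv_into W \<phi> z))"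
    by (rule holomorphic_Cn_subset[OF hol[OF c] chart_image_openin[OF c U]])
      (use inv_into_f_f[OF chart_inj[OF c]] in auto)
qed auto

lemma hol_ring_const: "openin (mtop M) U \<Longrightarrow> (\<lambda>x\<in>U. c) \<in> carrier (hol_ring M U)"
  by (rule hol_ring_chartwise) (simp_all add: holomorphic_Cn_const)

lemma hol_ring_add:
  assumes U: "openin (mtop M) U" and "f \<in> carrier (hol_ring M U)" "g \<in> carrier (hol_ring M U)"
  shows "(\<lambda>x\<in>U. f x + g x) \<in> carrier (hol_ring M U)"
  using assms by (intro hol_ring_chartwise holomorphic_Cn_add) (auto simp: in_hol_ring_iff)

lemma hol_ring_mult:
  assumes U: "openin (mtop M) U" and "f \<in> carrier (hol_ring M U)" "g \<in> carrier (hol_ring M U)"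
  shows "(\<lambda>x\<in>U. f x * g x) \<in> carrier (hol_ring M U)"
  using assms by (intro hol_ring_chartwise holomorphic_Cn_mult) (auto simp: in_hol_ring_iff)

lemma hol_ring_inverse:
  assumes U: "openin (mtop M) U" and f: "f \<in> carrier (hol_ring M U)" and nz: "\<And>x. x \<in> U \<Longrightarrow> f x \<noteq> 0"
  shows "(\<lambda>x\<in>U. inverse (f x)) \<in> carrier (hol_ring M U)"
proof (intro hol_ring_chartwise[OF U] holomorphic_Cn_inverse)
  fix n W \<phi> z assume c: "(n, W, \<phi>) \<in> charts M"
  show "holomorphic_Cn n (\<phi> ` (U \<inter> W)) (\<lambda>z. f (inv_into W \<phi> z))"
    using f c by (simp add: in_hol_ring_iff)
  assume "z \<in> \<phi> ` (U \<inter> W)"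
  then show "f (inv_into W \<phi> z) \<noteq> 0" using nz inv_into_f_f[OF chart_inj[OF c]] by auto
qed

lemma hol_ring_sum:
  assumes U: "openin (mtop M) U" and "finite A" and "\<And>a. a \<in> A \<Longrightarrow> f a \<in> carrier (hol_ring M U)"
  shows "(\<lambda>x\<in>U. \<Sum>a\<in>A. f a x) \<in> carrier (hol_ring M U)"
  using assms(2,3)
proof (induction A rule: finite_induct)
  case empty
  show ?case unfolding sum.empty by (rule hol_ring_const[OF U])
next
  case (insert a A)
  then have "(\<lambda>x\<in>U. f a x + (\<lambda>x\<in>U. \<Sum>a\<in>A. f a x) x) \<in> carrier (hol_ring M U)"
    by (intro hol_ring_add[OF U]) auto
  also have "(\<lambda>x\<in>U. f a x + (\<lambda>x\<in>U. \<Sum>a\<in>A. f a x) x) = (\<lambda>x\<in>U. \<Sum>a\<in>insert a A. f a x)"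
    using insert.hyps by (auto simp: restrict_def)
  finally show ?case .
qed

lemma hol_ring_cring:
  assumes U: "openin (mtop M) U"
  shows "cring (hol_ring M U)"
proof (rule cringI)
  show "abelian_group (hol_ring M U)"
  proof (rule abelian_groupI)
    fix f assume f: "f \<in> carrier (hol_ring M U)"
    have "(\<lambda>x\<in>U. (\<lambda>x\<in>U. -1) x * f x) \<in> carrier (hol_ring M U)"
      using f U hol_ring_const by (intro hol_ring_mult)
    then show "\<exists>y\<in>carrier (hol_ring M U). y \<oplus>\<^bsub>hol_ring M U\<^esub> f = \<zero>\<^bsub>hol_ring M U\<^esub>"
      by (rule bexI[rotated]) (auto simp: restrict_def)
    show "\<zero>\<^bsub>hol_ring M U\<^esub> \<oplus>\<^bsub>hol_ring M U\<^esub> f = f"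
      by (rule extensionalityI[of _ U]) (use f in \<open>auto simp: in_hol_ring_iff\<close>)
  qed (use U hol_ring_add hol_ring_const in \<open>auto simp: restrict_def algebra_simps\<close>)
  show "Group.comm_monoid (hol_ring M U)"
  proof (rule comm_monoidI)
    fix f assume f: "f \<in> carrier (hol_ring M U)"
    show "\<one>\<^bsub>hol_ring M U\<^esub> \<otimes>\<^bsub>hol_ring M U\<^esub> f = f"
      by (rule extensionalityI[of _ U]) (use f in \<open>auto simp: in_hol_ring_iff\<close>)
  qed (use U hol_ring_mult hol_ring_const in \<open>auto simp: restrict_def algebra_simps\<close>)
qed (auto simp: restrict_def algebra_simps)

section \<open>Coordinate boxes, lines and vector fields\<close>

text \<open>
  The point of using a box is that it meets every coordinate line in a disc, which is connected, so
  that the identity theorem in one variable applies.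
\<close>

definition chart_box :: "nat \<Rightarrow> 'a set \<Rightarrow> ('a \<Rightarrow> nat \<Rightarrow> complex) \<Rightarrow> 'a \<Rightarrow> real \<Rightarrow> 'a set \<Rightarrow> bool" where
  "chart_box n W \<phi> x e B \<longleftrightarrow> (n, W, \<phi>) \<in> charts M \<and> openin (mtop M) B \<and> x \<in> B \<and> B \<subseteq> W \<and>
    \<phi> ` B = {z. (\<forall>i<n. z i \<in> ball (\<phi> x i) e) \<and> (\<forall>i\<ge>n. z i = 0)}"

text \<open>
  A basic open set of the product topology restricts only finitely many coordinates, and the
  coordinates from \<open>n\<close> on are 0 anyway; the least of the \<open>n\<close> remaining radii is a common one.
\<close>

lemma chart_box_exists:
  assumes "x \<in> U" "openin (mtop M) U"
  obtains n W \<phi> e B where "chart_box n W \<phi> x e B" "B \<subseteq> U"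
proof -
  have "x \<in> mpoints M" using assms openin_subset by blast
  then obtain n W \<phi> where c: "(n, W, \<phi>) \<in> charts M" "x \<in> W"
    using charts_cover by auto
  have o: "openin (Cn n) (\<phi> ` (U \<inter> W))"
    by (rule chart_image_openin[OF c(1) assms(2)])
  then obtain T where T: "open T" "\<phi> ` (U \<inter> W) = {z. \<forall>i\<ge>n. z i = 0} \<inter> T"
    by (auto simp: Cn_def openin_open)
  have xT: "\<phi> x \<in> T" using assms(1) c T(2) by auto
  have x0: "\<forall>i\<ge>n. \<phi> x i = 0" using Cn_openin_zero[OF o] assms(1) c by blast
  have "\<exists>X. \<phi> x \<in> Pi\<^sub>E UNIV X \<and> (\<forall>i. open (X i)) \<and> finite {i. X i \<noteq> UNIV} \<and> Pi\<^sub>E UNIV X \<subseteq> T"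
    using product_topology_open_contains_basis[of "\<lambda>i. euclidean" UNIV T "\<phi> x"] T(1) xT
    unfolding open_fun_def by simp
  then obtain X where X: "\<And>i. \<phi> x i \<in> X i" "\<And>i. open (X i)" "Pi\<^sub>E UNIV X \<subseteq> T"
    by (auto simp: PiE_iff)
  have "\<exists>d>0. ball (\<phi> x i) d \<subseteq> X i" for i using X(1,2) open_contains_ball by blast
  then obtain d where d: "\<And>i. d i > 0" "\<And>i. ball (\<phi> x i) (d i) \<subseteq> X i" by metis
  define e where "e = Min (insert 1 (d ` {..<n}))"
  have e: "e > 0" "\<And>i. i < n \<Longrightarrow> e \<le> d i" using d(1) by (auto simp: e_def)
  define Q where "Q = {z. (\<forall>i<n. z i \<in> ball (\<phi> x i) e) \<and> (\<forall>i\<ge>n. z i = 0)}"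
  have QT: "z \<in> T" if "z \<in> Q" for z
  proof -
    have "z i \<in> X i" for i
    proof (cases "i < n")
      case True
      then have "z i \<in> ball (\<phi> x i) (d i)" using that e(2)[OF True] by (auto simp: Q_def)
      then show ?thesis using d(2) by blast
    next
      case False
      then show ?thesis using X(1)[of i] x0 that by (simp add: Q_def)
    qed
    then show ?thesis using X(3) by (auto simp: PiE_iff)
  qed
  have "open (\<Inter>i\<in>{..<n}. (\<lambda>z::nat\<Rightarrow>complex. z i) -` ball (\<phi> x i) e)"
    by (intro open_INT ballI open_vimage continuous_on_product_coordinates) auto
  moreover have Qeq: "Q = {z. \<forall>i\<ge>n. z i = 0} \<inter> (\<Inter>i\<in>{..<n}. (\<lambda>z. z i) -` ball (\<phi> x i) e)"
    by (auto simp: Q_def)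
  ultimately have oQ: "openin (Cn n) Q"
    unfolding Cn_def by (auto simp: openin_open)
  define B where "B = {p \<in> W. \<phi> p \<in> Q}"
  have QU: "Q \<subseteq> \<phi> ` (U \<inter> W)" using QT T(2) by (auto simp: Q_def)
  have "\<phi> ` B = Q" using QU by (auto simp: B_def)
  moreover have "openin (mtop M) B" unfolding B_def by (rule chart_preimage_openin[OF c(1) oQ])
  moreover have "x \<in> B" using c x0 e(1) by (auto simp: B_def Q_def)
  ultimately have "chart_box n W \<phi> x e B"
    using c by (auto simp: chart_box_def B_def Q_def)
  moreover have "B \<subseteq> U"
  proof
    fix p assume p: "p \<in> B"
    then obtain p' where "p' \<in> U" "p' \<in> W" "\<phi> p = \<phi> p'" using QU by (auto simp: B_def)
    then show "p \<in> U" using p inj_onD[OF chart_inj[OF c(1)], of p p'] by (simp add: B_def)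
  qed
  ultimately show thesis by (rule that)
qed

text \<open>
  The value is meaningful only where \<open>(\<phi> p)(i := w)\<close> lies in the image of the chart.
\<close>

definition coord_line :: "'a set \<Rightarrow> ('a \<Rightarrow> nat \<Rightarrow> complex) \<Rightarrow> nat \<Rightarrow> 'a \<Rightarrow> complex \<Rightarrow> 'a" where
  "coord_line W \<phi> i p w = inv_into W \<phi> ((\<phi> p)(i := w))"

lemma coord_line_self: "(n, W, \<phi>) \<in> charts M \<Longrightarrow> p \<in> W \<Longrightarrow> coord_line W \<phi> i p (\<phi> p i) = p"
  by (simp add: coord_line_def inv_into_f_f chart_inj)

lemma coord_line_mem:
  assumes c: "(n, W, \<phi>) \<in> charts M" and "V \<subseteq> W" "(\<phi> p)(i := w) \<in> \<phi> ` V"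
  shows "coord_line W \<phi> i p w \<in> V" "\<phi> (coord_line W \<phi> i p w) = (\<phi> p)(i := w)"
proof -
  obtain q where q: "q \<in> V" "(\<phi> p)(i := w) = \<phi> q" using assms(3) by blast
  then have "inv_into W \<phi> (\<phi> q) = q" using chart_inj[OF c] assms(2) by (simp add: inv_into_f_f subset_iff)
  then show "coord_line W \<phi> i p w \<in> V" "\<phi> (coord_line W \<phi> i p w) = (\<phi> p)(i := w)"
    using q by (simp_all add: coord_line_def)
qed

lemma coord_line_cong: "\<phi> q = (\<phi> p)(i := w) \<Longrightarrow> coord_line W \<phi> i q = coord_line W \<phi> i p"
  by (rule ext) (simp only: coord_line_def fun_upd_upd)

lemma coord_line_open:
  assumes c: "(n, W, \<phi>) \<in> charts M" and i: "i < n" and V: "openin (mtop M) V" "V \<subseteq> W" and p: "p \<in> W"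
  shows "open {w. (\<phi> p)(i := w) \<in> \<phi> ` V}"
proof -
  have "openin (Cn n) (\<phi> ` V)"
    using chart_image_openin[OF c V(1)] V(2) by (simp add: Int_absorb2)
  moreover have "\<forall>i\<ge>n. \<phi> p i = 0" using Cn_openin_zero[OF chart_image_open[OF c]] p by blast
  moreover have "continuous_on UNIV (\<lambda>w. (\<phi> p)(i := w))"
    by (intro continuous_on_fun_upd continuous_on_const continuous_on_id)
  ultimately have "open {w \<in> UNIV. (\<phi> p)(i := w) \<in> \<phi> ` V}"
    using i by (intro Cn_openin_preimage) auto
  then show ?thesis by simp
qed

lemma coord_line_holomorphic:
  assumes c: "(n, W, \<phi>) \<in> charts M" and i: "i < n" and V: "V \<subseteq> W"
    and f: "f \<in> carrier (hol_ring M V)"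
  shows "(\<lambda>w. f (coord_line W \<phi> i p w)) holomorphic_on {w. (\<phi> p)(i := w) \<in> \<phi> ` V}"
proof -
  have "holomorphic_Cn n (\<phi> ` (V \<inter> W)) (\<lambda>z. f (inv_into W \<phi> z))"
    using f c unfolding in_hol_ring_iff by blast
  then have "holomorphic_Cn n (\<phi> ` V) (\<lambda>z. f (inv_into W \<phi> z))"
    unfolding Int_absorb2[OF V] .
  then show ?thesis unfolding coord_line_def
    by (rule holomorphic_Cn_line[OF _ i]) auto
qed

text \<open>
  The coordinate vector field \<open>\<partial>/\<partial>z\<^sub>i\<close>; the value 0 is the convention for tangent vectors at functions
  that are not holomorphic near the point.
\<close>

definition coord_field :: "nat \<Rightarrow> 'a set \<Rightarrow> ('a \<Rightarrow> nat \<Rightarrow> complex) \<Rightarrow> 'a set \<Rightarrow> 'a \<Rightarrow> ('a \<Rightarrow> complex) \<Rightarrow> complex" where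
  "coord_field i W \<phi> U = (\<lambda>p\<in>U. \<lambda>f. if holomorphic_near M p f
     then deriv (\<lambda>w. f (coord_line W \<phi> i p w)) (\<phi> p i) else 0)"

lemma holomorphic_near_carrier:
  "f \<in> carrier (hol_ring M V) \<Longrightarrow> openin (mtop M) V \<Longrightarrow> p \<in> V \<Longrightarrow> holomorphic_near M p f"
  unfolding holomorphic_near_def by (intro exI[of _ V]) (simp add: hol_ring_restrict_id)

text \<open>
  Along the coordinate line through \<open>p\<close> the vector field is the ordinary derivative, also at points other
  than \<open>p\<close>, since these points have the same coordinate line.
\<close>

lemma coord_field_line:
  assumes c: "(n, W, \<phi>) \<in> charts M" and i: "i < n" and V: "openin (mtop M) V" "V \<subseteq> W" "V \<subseteq> U"
    and f: "f \<in> carrier (hol_ring M V)" and w: "(\<phi> p)(i := w) \<in> \<phi> ` V"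
  shows "coord_field i W \<phi> U (coord_line W \<phi> i p w) f = deriv (\<lambda>w. f (coord_line W \<phi> i p w)) w"
proof -
  let ?q = "coord_line W \<phi> i p w"
  have q: "?q \<in> V" "\<phi> ?q = (\<phi> p)(i := w)" using coord_line_mem[OF c V(2) w] by auto
  then have "coord_line W \<phi> i ?q = coord_line W \<phi> i p" by (intro coord_line_cong)
  then show ?thesis
    using q V holomorphic_near_carrier[OF f V(1) q(1)] by (auto simp: coord_field_def)
qed

lemma holomorphic_near_line:
  assumes c: "(n, W, \<phi>) \<in> charts M" and i: "i < n" and p: "p \<in> W" and f: "holomorphic_near M p f"
  shows "(\<lambda>w. f (coord_line W \<phi> i p w)) field_differentiable at (\<phi> p i)"
proof -
  obtain V where V: "openin (mtop M) V" "p \<in> V" "restrict f V \<in> carrier (hol_ring M V)"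
    using f by (auto simp: holomorphic_near_def)
  let ?V = "V \<inter> W"
  let ?S = "{w. (\<phi> p)(i := w) \<in> \<phi> ` ?V}"
  have oV: "openin (mtop M) ?V" using V chart_open[OF c] by auto
  have "restrict (restrict f V) ?V \<in> carrier (hol_ring M ?V)"
    by (rule hol_ring_restrict[OF V(3)]) (use oV in \<open>auto simp: opens_def\<close>)
  then have "(\<lambda>w. restrict (restrict f V) ?V (coord_line W \<phi> i p w)) holomorphic_on ?S"
    by (rule coord_line_holomorphic[OF c i Int_lower2])
  then have "(\<lambda>w. f (coord_line W \<phi> i p w)) holomorphic_on ?S"
  proof (rule holomorphic_transform)
    fix w assume "w \<in> ?S"
    then have "coord_line W \<phi> i p w \<in> ?V" by (intro coord_line_mem[OF c]) auto
    then show "restrict (restrict f V) ?V (coord_line W \<phi> i p w) = f (coord_line W \<phi> i p w)" by simp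
  qed
  moreover have "open ?S" by (rule coord_line_open[OF c i oV _ p]) simp
  moreover have "\<phi> p i \<in> ?S" using V p by simp
  ultimately show ?thesis using holomorphic_on_imp_differentiable_at by blast
qed

lemma holomorphic_near_ops:
  assumes f: "holomorphic_near M p f" and g: "holomorphic_near M p g"
  shows "holomorphic_near M p (\<lambda>x. f x + g x)" "holomorphic_near M p (\<lambda>x. f x * g x)"
proof -
  obtain V where V: "openin (mtop M) V" "p \<in> V" "restrict f V \<in> carrier (hol_ring M V)"
    using f by (auto simp: holomorphic_near_def)
  obtain V' where V': "openin (mtop M) V'" "p \<in> V'" "restrict g V' \<in> carrier (hol_ring M V')"
    using g by (auto simp: holomorphic_near_def)
  let ?N = "V \<inter> V'"
  have N: "openin (mtop M) ?N" "p \<in> ?N" using V V' by auto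
  have fN: "restrict (restrict f V) ?N \<in> carrier (hol_ring M ?N)"
    by (rule hol_ring_restrict[OF V(3)]) (use N in \<open>auto simp: opens_def\<close>)
  have gN: "restrict (restrict g V') ?N \<in> carrier (hol_ring M ?N)"
    by (rule hol_ring_restrict[OF V'(3)]) (use N in \<open>auto simp: opens_def\<close>)
  have "restrict (\<lambda>x. f x + g x) ?N = (\<lambda>x\<in>?N. restrict (restrict f V) ?N x + restrict (restrict g V') ?N x)"
    by (auto simp: restrict_def)
  then show "holomorphic_near M p (\<lambda>x. f x + g x)"
    using hol_ring_add[OF N(1) fN gN] N unfolding holomorphic_near_def by (intro exI[of _ ?N]) simp
  have "restrict (\<lambda>x. f x * g x) ?N = (\<lambda>x\<in>?N. restrict (restrict f V) ?N x * restrict (restrict g V') ?N x)"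
    by (auto simp: restrict_def)
  then show "holomorphic_near M p (\<lambda>x. f x * g x)"
    using hol_ring_mult[OF N(1) fN gN] N unfolding holomorphic_near_def by (intro exI[of _ ?N]) simp
qed

lemma coord_field_tangent:
  assumes c: "(n, W, \<phi>) \<in> charts M" and i: "i < n" and U: "U \<subseteq> W" and p: "p \<in> U"
  shows "coord_field i W \<phi> U p \<in> tangent_space M p"
proof -
  have pW: "p \<in> W" using U p by blast
  have eq: "coord_field i W \<phi> U p f = deriv (\<lambda>w. f (coord_line W \<phi> i p w)) (\<phi> p i)"
    if "holomorphic_near M p f" for f using that p by (simp add: coord_field_def)
  note diff = holomorphic_near_line[OF c i pW]
  have const: "holomorphic_near M p (\<lambda>x. c)" for c
    using hol_ring_const[of "mpoints M" c] pW chart_subset[OF c] unfolding holomorphic_near_def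
    by (intro exI[of _ "mpoints M"]) auto
  show ?thesis unfolding tangent_space_def
  proof (intro CollectI conjI allI impI)
    fix f assume "\<not> holomorphic_near M p f"
    then show "coord_field i W \<phi> U p f = 0" using p by (simp add: coord_field_def)
  next
    fix f g assume f: "holomorphic_near M p f" and g: "holomorphic_near M p g"
      and "\<exists>V. openin (mtop M) V \<and> p \<in> V \<and> (\<forall>x\<in>V. f x = g x)"
    then obtain V where V: "openin (mtop M) V" "p \<in> V" "\<And>x. x \<in> V \<Longrightarrow> f x = g x" by blast
    let ?S = "{w. (\<phi> p)(i := w) \<in> \<phi> ` (V \<inter> W)}"
    have "open ?S" by (rule coord_line_open[OF c i _ _ pW]) (use V chart_open[OF c] in auto)
    moreover have "\<phi> p i \<in> ?S" using V pW by simp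
    moreover have "f (coord_line W \<phi> i p w) = g (coord_line W \<phi> i p w)" if "w \<in> ?S" for w
      using coord_line_mem(1)[OF c, of "V \<inter> W" p i w] that V(3) by auto
    ultimately have "\<forall>\<^sub>F w in nhds (\<phi> p i). f (coord_line W \<phi> i p w) = g (coord_line W \<phi> i p w)"
      unfolding eventually_nhds by blast
    then have "deriv (\<lambda>w. f (coord_line W \<phi> i p w)) (\<phi> p i) = deriv (\<lambda>w. g (coord_line W \<phi> i p w)) (\<phi> p i)"
      by (rule deriv_cong_ev) simp
    then show "coord_field i W \<phi> U p f = coord_field i W \<phi> U p g" by (simp add: eq f g)
  next
    fix f k assume f: "holomorphic_near M p f"
    show "coord_field i W \<phi> U p (\<lambda>x. k * f x) = k * coord_field i W \<phi> U p f"
      using diff[OF f] by (simp add: eq f holomorphic_near_ops(2)[OF const f])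
  next
    fix f g assume f: "holomorphic_near M p f" and g: "holomorphic_near M p g"
    show "coord_field i W \<phi> U p (\<lambda>x. f x + g x) = coord_field i W \<phi> U p f + coord_field i W \<phi> U p g"
      using diff[OF f] diff[OF g] by (simp add: eq f g holomorphic_near_ops)
    show "coord_field i W \<phi> U p (\<lambda>x. f x * g x) = coord_field i W \<phi> U p f * g p + f p * coord_field i W \<phi> U p g"
      using diff[OF f] diff[OF g] coord_line_self[OF c pW]
      by (simp add: eq f g holomorphic_near_ops)
  qed
qed

text \<open>
  Seen from another chart, the function is a partial derivative composed with a transition map.
\<close>

lemma coord_field_holomorphic:
  assumes c: "(n, W, \<phi>) \<in> charts M" and i: "i < n" and V: "openin (mtop M) V" "V \<subseteq> W" "V \<subseteq> U"
    and f: "f \<in> carrier (hol_ring M V)"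
  shows "(\<lambda>p\<in>V. coord_field i W \<phi> U p f) \<in> carrier (hol_ring M V)"
proof (rule hol_ring_chartwise[OF V(1)])
  fix m W' \<psi> assume c': "(m, W', \<psi>) \<in> charts M"
  let ?f = "\<lambda>z. f (inv_into W \<phi> z)"
  have VW: "V \<inter> W = V" using V by auto
  have oD: "openin (Cn n) (\<phi> ` V)" using chart_image_openin[OF c V(1)] VW by simp
  have "holomorphic_Cn n (\<phi> ` (V \<inter> W)) ?f" using f c unfolding in_hol_ring_iff by blast
  then have hf: "holomorphic_Cn n (\<phi> ` V) ?f" unfolding VW .
  have oD': "openin (Cn m) (\<psi> ` (V \<inter> W'))" by (rule chart_image_openin[OF c' V(1)])
  have inv: "inv_into W' \<psi> (\<psi> p) = p" if "p \<in> W'" for p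
    using that chart_inj[OF c'] by (simp add: inv_into_f_f)
  have "holomorphic_Cn m (\<psi> ` (V \<inter> W')) (\<lambda>z. partial_deriv i ?f (\<phi> (inv_into W' \<psi> z)))"
  proof (rule holomorphic_Cn_compose[OF oD holomorphic_Cn_partial_deriv[OF oD hf i] oD'])
    fix k assume "k < n"
    then have "holomorphic_Cn m (\<psi> ` (W' \<inter> W)) (\<lambda>z. \<phi> (inv_into W' \<psi> z) k)"
      by (rule charts_compatible[OF c' c])
    then show "holomorphic_Cn m (\<psi> ` (V \<inter> W')) (\<lambda>z. \<phi> (inv_into W' \<psi> z) k)"
      by (rule holomorphic_Cn_subset[OF _ oD']) (use V in auto)
  next
    show "(\<lambda>z. \<phi> (inv_into W' \<psi> z)) ` \<psi> ` (V \<inter> W') \<subseteq> \<phi> ` V" using inv by auto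
  qed
  then show "holomorphic_Cn m (\<psi> ` (V \<inter> W')) (\<lambda>z. coord_field i W \<phi> U (inv_into W' \<psi> z) f)"
  proof (rule holomorphic_Cn_subset[OF _ oD' subset_refl])
    fix z assume "z \<in> \<psi> ` (V \<inter> W')"
    then obtain p where p: "p \<in> V" "z = \<psi> p" "p \<in> W'" by blast
    then show "coord_field i W \<phi> U (inv_into W' \<psi> z) f = partial_deriv i ?f (\<phi> (inv_into W' \<psi> z))"
      using V holomorphic_near_carrier[OF f V(1) p(1)]
      by (auto simp: inv coord_field_def coord_line_def partial_deriv_def)
  qed
qed

lemma coord_field_Theta:
  assumes c: "(n, W, \<phi>) \<in> charts M" and i: "i < n" and U: "openin (mtop M) U" "U \<subseteq> W"
  shows "coord_field i W \<phi> U \<in> carrier (sections (Theta M) U)"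
  using coord_field_tangent[OF c i U(2)] coord_field_holomorphic[OF c i _ _ _] U
  by (auto simp: Theta_def opens_def coord_field_def)

end

section \<open>Quotient presheaves and their sheafification\<close>

lemma opens_self: "V \<in> opens M U \<Longrightarrow> V \<in> opens M V"
  by (auto simp: opens_def)

lemma O_presheaf_restrict:
  assumes "O_presheaf M U E" "U' \<subseteq> U"
  shows "O_presheaf M U' E"
proof -
  have "V \<in> opens M U' \<Longrightarrow> V \<in> opens M U" for V using assms(2) by (auto simp: opens_def)
  then show ?thesis using assms(1) unfolding O_presheaf_def by blast
qed

context O_presheaf
begin

lemma sections_abelian_group: "V \<in> opens M U \<Longrightarrow> abelian_group (sections E V)"
  using module_sections by (simp add: module_def)

lemma restr_zero:
  assumes "V \<in> opens M U" "W \<in> opens M V"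
  shows "restr E V W \<zero>\<^bsub>sections E V\<^esub> = \<zero>\<^bsub>sections E W\<^esub>"
proof -
  interpret V: abelian_group "sections E V" by (rule sections_abelian_group[OF assms(1)])
  interpret W: abelian_group "sections E W" by (rule sections_abelian_group[OF opens_subset[OF assms]])
  let ?z = "restr E V W \<zero>\<^bsub>sections E V\<^esub>"
  have "?z \<in> carrier (sections E W)" by (rule restr_closed[OF assms]) simp
  moreover have "?z \<oplus>\<^bsub>sections E W\<^esub> ?z = ?z"
    using restr_add[OF assms V.zero_closed V.zero_closed] by simp
  ultimately show ?thesis by (metis W.add.r_cancel_one')
qed

end

text \<open>
  Scalar multiplication and restriction of cosets are defined as unions over representatives; they are
  well defined because the union has only one member.
\<close>

lemma coset_image_Union:
  assumes A: "abelian_group A" and N: "subgroup N (add_monoid A)"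
    and B: "abelian_group B" and N': "subgroup N' (add_monoid B)"
    and f: "\<And>x. x \<in> carrier A \<Longrightarrow> f x \<in> carrier B"
    and add: "\<And>x y. x \<in> carrier A \<Longrightarrow> y \<in> carrier A \<Longrightarrow> f (x \<oplus>\<^bsub>A\<^esub> y) = f x \<oplus>\<^bsub>B\<^esub> f y"
    and sub: "\<And>x. x \<in> N \<Longrightarrow> f x \<in> N'" and a: "a \<in> carrier A"
  shows "(\<Union>c\<in>N +>\<^bsub>A\<^esub> a. N' +>\<^bsub>B\<^esub> f c) = N' +>\<^bsub>B\<^esub> f a"
proof -
  interpret A: abelian_subgroup N A
    using A N by (intro abelian_subgroupI3 additive_subgroup.intro)
  interpret B: abelian_group B by (rule B)
  have "N' +>\<^bsub>B\<^esub> f c = N' +>\<^bsub>B\<^esub> f a" if c: "c \<in> N +>\<^bsub>A\<^esub> a" for c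
  proof -
    obtain x where x: "x \<in> N" "c = x \<oplus>\<^bsub>A\<^esub> a" using c by (auto simp: a_r_coset_def')
    then have "f c = f x \<oplus>\<^bsub>B\<^esub> f a" using add[of x a] a A.a_Hcarr by simp
    then have "f c \<in> N' +>\<^bsub>B\<^esub> f a" using sub[OF x(1)] by (auto simp: a_r_coset_def')
    then show ?thesis by (rule B.a_repr_independence[OF _ f[OF a] N', symmetric])
  qed
  then have "(\<Union>c\<in>N +>\<^bsub>A\<^esub> a. N' +>\<^bsub>B\<^esub> f c) = (\<Union>c\<in>N +>\<^bsub>A\<^esub> a. N' +>\<^bsub>B\<^esub> f a)" by blast
  then show ?thesis using A.a_rcos_self[OF a] by blast
qed

context
  fixes R :: "('r, 'x) ring_scheme" and A :: "('r, 'm) module" and N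
  assumes mod: "module R A" and sub: "submodule N R A"
begin

interpretation module R A by (rule mod)

lemma quotient_subgroup: "abelian_subgroup N A"
  using submodule.axioms(1)[OF sub] M.abelian_group_axioms by (intro abelian_subgroupI3 additive_subgroup.intro)

interpretation N: abelian_subgroup N A by (rule quotient_subgroup)

lemma quotient_carrier: "carrier (quotient_module A N) = {N +>\<^bsub>A\<^esub> a | a. a \<in> carrier A}"
  by (auto simp: quotient_module_def A_RCOSETS_def')

lemma quotient_add:
  "a \<in> carrier A \<Longrightarrow> b \<in> carrier A \<Longrightarrow>
    (N +>\<^bsub>A\<^esub> a) \<oplus>\<^bsub>quotient_module A N\<^esub> (N +>\<^bsub>A\<^esub> b) = N +>\<^bsub>A\<^esub> (a \<oplus>\<^bsub>A\<^esub> b)"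
  by (simp add: quotient_module_def N.a_rcos_sum)

lemma quotient_smult:
  assumes "r \<in> carrier R" "a \<in> carrier A"
  shows "r \<odot>\<^bsub>quotient_module A N\<^esub> (N +>\<^bsub>A\<^esub> a) = N +>\<^bsub>A\<^esub> (r \<odot>\<^bsub>A\<^esub> a)"
  unfolding quotient_module_def module.simps
  by (rule coset_image_Union)
    (use assms submodule.axioms(1)[OF sub] submodule.smult_closed[OF sub] smult_r_distr M.abelian_group_axioms in auto)

lemma quotient_eq_zero_iff: "a \<in> carrier A \<Longrightarrow> N +>\<^bsub>A\<^esub> a = N \<longleftrightarrow> a \<in> N"
  using N.a_rcos_self N.a_rcos_const by blast

lemma quotient_abelian_group: "abelian_group (quotient_module A N)"
proof (rule abelian_groupI)
  have zero: "\<zero>\<^bsub>quotient_module A N\<^esub> = N +>\<^bsub>A\<^esub> \<zero>\<^bsub>A\<^esub>"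
    using N.a_rcos_const[of "\<zero>\<^bsub>A\<^esub>"] by (simp add: quotient_module_def)
  then show "\<zero>\<^bsub>quotient_module A N\<^esub> \<in> carrier (quotient_module A N)"
    by (auto simp: quotient_carrier)
  fix x assume "x \<in> carrier (quotient_module A N)"
  then obtain a where a: "x = N +>\<^bsub>A\<^esub> a" "a \<in> carrier A" by (auto simp: quotient_carrier)
  then show "\<zero>\<^bsub>quotient_module A N\<^esub> \<oplus>\<^bsub>quotient_module A N\<^esub> x = x"
    by (simp add: zero quotient_add)
  show "\<exists>y\<in>carrier (quotient_module A N). y \<oplus>\<^bsub>quotient_module A N\<^esub> x = \<zero>\<^bsub>quotient_module A N\<^esub>"
    using a by (intro bexI[of _ "N +>\<^bsub>A\<^esub> (\<ominus>\<^bsub>A\<^esub> a)"]) (auto simp: zero quotient_add quotient_carrier M.l_neg)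
qed (auto simp: quotient_carrier quotient_add M.a_ac)

lemma quotient_is_module: "module R (quotient_module A N)"
  by (rule moduleI[OF R.cring_axioms quotient_abelian_group])
    (auto simp: quotient_carrier quotient_add quotient_smult smult_l_distr smult_r_distr smult_assoc1)

end

locale subpresheaf = complex_manifold M + O_presheaf M U G for M :: "'a cmanifold" and U and G :: "('a, 'e) mod_data" +
  fixes P :: "'a set \<Rightarrow> 'e set"
  assumes sub: "V \<in> opens M U \<Longrightarrow> submodule (P V) (hol_ring M V) (sections G V)"
    and restr_sub: "V \<in> opens M U \<Longrightarrow> W \<in> opens M V \<Longrightarrow> s \<in> P V \<Longrightarrow> restr G V W s \<in> P W"
begin

abbreviation "Q \<equiv> quotient_presheaf G P"

abbreviation coset :: "'a set \<Rightarrow> 'e \<Rightarrow> 'e set" where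
  "coset V g \<equiv> P V +>\<^bsub>sections G V\<^esub> g"

lemma Q_sections: "sections Q V = quotient_module (sections G V) (P V)"
  by (simp add: quotient_presheaf_def)

lemma Q_restr:
  assumes "V \<in> opens M U" "W \<in> opens M V" "g \<in> carrier (sections G V)"
  shows "restr Q V W (coset V g) = coset W (restr G V W g)"
  unfolding quotient_presheaf_def mod_data.simps
  using assms sub[OF assms(1)] sub[OF opens_subset[OF assms(1,2)]]
  by (intro coset_image_Union sections_abelian_group submodule.axioms(1))
    (auto intro: opens_subset restr_closed restr_add restr_sub)

lemma O_presheaf_quotient: "O_presheaf M U Q"
proof (rule O_presheaf.intro)
  fix V assume V: "V \<in> opens M U"
  note mV = module_sections[OF V] sub[OF V]
  show "module (hol_ring M V) (sections Q V)"
    unfolding Q_sections by (rule quotient_is_module[OF mV])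
  fix s assume "s \<in> carrier (sections Q V)"
  then obtain g where g: "s = coset V g" "g \<in> carrier (sections G V)"
    unfolding Q_sections quotient_carrier[OF mV] by blast
  show "restr Q V V s = s"
    using Q_restr[OF V opens_self[OF V] g(2)] restr_id[OF V g(2)] g(1) by simp
  fix W assume W: "W \<in> opens M V"
  have WU: "W \<in> opens M U" by (rule opens_subset[OF V W])
  note mW = module_sections[OF WU] sub[OF WU]
  have gW: "restr G V W g \<in> carrier (sections G W)" by (rule restr_closed[OF V W g(2)])
  show "restr Q V W s \<in> carrier (sections Q W)"
    using gW unfolding g(1) Q_restr[OF V W g(2)] Q_sections quotient_carrier[OF mW] by blast
  show "restr Q W W' (restr Q V W s) = restr Q V W' s" if W': "W' \<in> opens M W" for W'
    using Q_restr[OF V W g(2)] Q_restr[OF WU W' gW] Q_restr[OF V opens_subset[OF W W'] g(2)]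
      restr_restr[OF V W W' g(2)] g(1) by simp
  show "restr Q V W (f \<odot>\<^bsub>sections Q V\<^esub> s) = restrict f W \<odot>\<^bsub>sections Q W\<^esub> restr Q V W s"
    if f: "f \<in> carrier (hol_ring M V)" for f
  proof -
    have fg: "f \<odot>\<^bsub>sections G V\<^esub> g \<in> carrier (sections G V)"
      using module.smult_closed[OF mV(1) f g(2)] .
    have fW: "restrict f W \<in> carrier (hol_ring M W)"
      by (rule hol_ring_restrict[OF f W])
    show ?thesis
      unfolding g(1) Q_restr[OF V W g(2)] Q_sections quotient_smult[OF mV f g(2)]
        quotient_smult[OF mW fW gW] Q_restr[OF V W fg, unfolded Q_sections] restr_smult[OF V W f g(2)] ..
  qed
  fix t assume "t \<in> carrier (sections Q V)"
  then obtain k where k: "t = coset V k" "k \<in> carrier (sections G V)"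
    unfolding Q_sections quotient_carrier[OF mV] by blast
  have kW: "restr G V W k \<in> carrier (sections G W)" by (rule restr_closed[OF V W k(2)])
  have gk: "g \<oplus>\<^bsub>sections G V\<^esub> k \<in> carrier (sections G V)"
    using abelian_monoid.a_closed[OF abelian_group.axioms(1)[OF sections_abelian_group[OF V]] g(2) k(2)] .
  show "restr Q V W (s \<oplus>\<^bsub>sections Q V\<^esub> t) = restr Q V W s \<oplus>\<^bsub>sections Q W\<^esub> restr Q V W t"
    unfolding g(1) k(1) Q_restr[OF V W g(2)] Q_restr[OF V W k(2)] Q_sections quotient_add[OF mV g(2) k(2)]
      quotient_add[OF mW gW kW] Q_restr[OF V W gk, unfolded Q_sections] restr_add[OF V W g(2) k(2)] ..
qed

end

context O_presheaf
begin

lemma germ_refl: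
  assumes "W \<in> opens M U" "p \<in> W" "s \<in> carrier (sections E W)"
  shows "(W, s) \<in> germ M U E p W s"
  using assms by (auto simp: germ_def opens_def intro!: bexI[of _ W])

lemma germ_mono:
  assumes W: "W \<in> opens M U" "W' \<in> opens M U"
    and s: "s \<in> carrier (sections E W)" "s' \<in> carrier (sections E W')"
    and N: "N \<in> opens M (W \<inter> W')" "p \<in> N" and eq: "restr E W N s = restr E W' N s'"
  shows "germ M U E p W' s' \<subseteq> germ M U E p W s"
proof
  fix x assume "x \<in> germ M U E p W' s'"
  then obtain V t N' where x: "x = (V, t)" "V \<in> opens M U" "p \<in> V" "t \<in> carrier (sections E V)"
      "N' \<in> opens M (W' \<inter> V)" "p \<in> N'" "restr E W' N' s' = restr E V N' t"
    by (auto simp: germ_def)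
  let ?N = "N \<inter> N'"
  have sub: "?N \<in> opens M N" "?N \<in> opens M N'" "N \<in> opens M W" "N \<in> opens M W'"
      "N' \<in> opens M W'" "N' \<in> opens M V" "?N \<in> opens M (W \<inter> V)"
    using N x(5) by (auto simp: opens_def)
  have "restr E W ?N s = restr E N ?N (restr E W N s)"
    using restr_restr[OF W(1) sub(3,1) s(1)] by simp
  also have "\<dots> = restr E W' ?N s'"
    unfolding eq using restr_restr[OF W(2) sub(4,1) s(2)] by simp
  also have "\<dots> = restr E N' ?N (restr E W' N' s')"
    using restr_restr[OF W(2) sub(5,2) s(2)] by simp
  also have "\<dots> = restr E V ?N t"
    unfolding x(7) using restr_restr[OF x(2) sub(6,2) x(4)] by simp
  finally show "x \<in> germ M U E p W s"
    using x N(2) sub(7) by (auto simp: germ_def)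
qed

lemma germ_eq_iff:
  assumes W: "W \<in> opens M U" "W' \<in> opens M U" "p \<in> W" "p \<in> W'"
    and s: "s \<in> carrier (sections E W)" "s' \<in> carrier (sections E W')"
  shows "germ M U E p W s = germ M U E p W' s' \<longleftrightarrow>
    (\<exists>N\<in>opens M (W \<inter> W'). p \<in> N \<and> restr E W N s = restr E W' N s')"
proof
  assume "germ M U E p W s = germ M U E p W' s'"
  then have "(W', s') \<in> germ M U E p W s" using germ_refl[OF W(2,4) s(2)] by simp
  then show "\<exists>N\<in>opens M (W \<inter> W'). p \<in> N \<and> restr E W N s = restr E W' N s'"
    by (auto simp: germ_def)
next
  assume "\<exists>N\<in>opens M (W \<inter> W'). p \<in> N \<and> restr E W N s = restr E W' N s'"
  then obtain N where N: "N \<in> opens M (W \<inter> W')" "p \<in> N" "restr E W N s = restr E W' N s'" by blast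
  then have N': "N \<in> opens M (W' \<inter> W)" by (simp add: Int_commute)
  show "germ M U E p W s = germ M U E p W' s'"
    using germ_mono[OF W(1,2) s N] germ_mono[OF W(2,1) s(2,1) N' N(2) N(3)[symmetric]] by blast
qed

definition sheafify_unit :: "'a set \<Rightarrow> 'e \<Rightarrow> 'a \<Rightarrow> ('a set \<times> 'e) set" where
  "sheafify_unit V s = (\<lambda>q\<in>V. germ M U E q V s)"

lemma sheafify_unit_restr:
  assumes V: "V \<in> opens M U" "W \<in> opens M V" and s: "s \<in> carrier (sections E V)"
  shows "restrict (sheafify_unit V s) W = sheafify_unit W (restr E V W s)"
proof
  fix q
  have W: "W \<in> opens M (V \<inter> W)" "W \<in> opens M W" using V by (auto simp: opens_def)
  have WU: "W \<in> opens M U" by (rule opens_subset[OF V])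
  note sW = restr_closed[OF V s]
  show "restrict (sheafify_unit V s) W q = sheafify_unit W (restr E V W s) q"
  proof (cases "q \<in> W")
    case True
    then have "q \<in> V" using V by (auto simp: opens_def)
    have "germ M U E q V s = germ M U E q W (restr E V W s)"
      unfolding germ_eq_iff[OF V(1) WU \<open>q \<in> V\<close> True s sW]
      using W True restr_id[OF WU sW] by (intro bexI[of _ W]) auto
    then show ?thesis using True \<open>q \<in> V\<close> by (simp add: sheafify_unit_def)
  qed (simp add: sheafify_unit_def)
qed

lemma sheafify_unit_eq_iff:
  assumes V: "V \<in> opens M U" and s: "s \<in> carrier (sections E V)" "t \<in> carrier (sections E V)"
  shows "sheafify_unit V s = sheafify_unit V t \<longleftrightarrow>
    (\<forall>q\<in>V. \<exists>N\<in>opens M V. q \<in> N \<and> restr E V N s = restr E V N t)"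
proof -
  have "sheafify_unit V s = sheafify_unit V t \<longleftrightarrow> (\<forall>q\<in>V. germ M U E q V s = germ M U E q V t)"
  proof
    assume eq: "sheafify_unit V s = sheafify_unit V t"
    show "\<forall>q\<in>V. germ M U E q V s = germ M U E q V t"
    proof
      fix q assume "q \<in> V"
      then show "germ M U E q V s = germ M U E q V t"
        using fun_cong[OF eq, of q] by (simp add: sheafify_unit_def)
    qed
  qed (auto simp: sheafify_unit_def intro: restrict_ext)
  then show ?thesis by (simp add: germ_eq_iff V s cong: ball_cong)
qed

lemma sheafify_unit_closed:
  assumes V: "V \<in> opens M U" and s: "s \<in> carrier (sections E V)"
  shows "sheafify_unit V s \<in> carrier (sections (sheafify M U E) V)"
  using opens_self[OF V] s by (auto simp: sheafify_def sheafify_unit_def)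

lemma sheafify_locally_unit:
  assumes V: "V \<in> opens M U" and t: "t \<in> carrier (sections (sheafify M U E) V)" and p: "p \<in> V"
  obtains W s where "W \<in> opens M V" "p \<in> W" "s \<in> carrier (sections E W)" "restrict t W = sheafify_unit W s"
proof -
  obtain W s where W: "W \<in> opens M V" "p \<in> W" "s \<in> carrier (sections E W)" "\<forall>q\<in>W. t q = germ M U E q W s"
    using t p by (auto simp: sheafify_def)
  then have "restrict t W = sheafify_unit W s"
    unfolding sheafify_unit_def by (intro restrict_ext) blast
  with W(1-3) show thesis by (rule that)
qed

lemma sheafify_unit_add:
  assumes V: "V \<in> opens M U" and s: "s \<in> carrier (sections E V)" "t \<in> carrier (sections E V)"
  shows "sheafify_unit V (s \<oplus>\<^bsub>sections E V\<^esub> t) =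
    sheafify_unit V s \<oplus>\<^bsub>sections (sheafify M U E) V\<^esub> sheafify_unit V t"
proof
  fix q
  interpret V: abelian_group "sections E V" by (rule sections_abelian_group[OF V])
  show "sheafify_unit V (s \<oplus>\<^bsub>sections E V\<^esub> t) q =
    (sheafify_unit V s \<oplus>\<^bsub>sections (sheafify M U E) V\<^esub> sheafify_unit V t) q"
  proof (cases "q \<in> V")
    case True
    let ?X = "germ M U E q V (s \<oplus>\<^bsub>sections E V\<^esub> t)"
    \<comment> \<open>Every choice of representatives yields the same germ, so the union that defines the sum is a
      union of copies of \<open>?X\<close>.\<close>
    have eq: "germ M U E q W (a \<oplus>\<^bsub>sections E W\<^esub> b) = ?X"
      if a: "(W, a) \<in> germ M U E q V s" and b: "(W, b) \<in> germ M U E q V t" for W a b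
    proof -
      obtain N where N: "W \<in> opens M U" "q \<in> W" "a \<in> carrier (sections E W)" "N \<in> opens M (V \<inter> W)" "q \<in> N"
          "restr E V N s = restr E W N a"
        using a by (auto simp: germ_def)
      obtain N' where N': "b \<in> carrier (sections E W)" "N' \<in> opens M (V \<inter> W)" "q \<in> N'"
          "restr E V N' t = restr E W N' b"
        using b by (auto simp: germ_def)
      interpret W: abelian_group "sections E W" by (rule sections_abelian_group[OF N(1)])
      let ?N = "N \<inter> N'"
      have sub: "?N \<in> opens M N" "?N \<in> opens M N'" "?N \<in> opens M V" "?N \<in> opens M W" "?N \<in> opens M (W \<inter> V)"
          "N \<in> opens M V" "N \<in> opens M W" "N' \<in> opens M V" "N' \<in> opens M W"
        using N N' by (auto simp: opens_def)
      have "restr E V ?N s = restr E W ?N a"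
        using restr_restr[OF V sub(6,1) s(1)] restr_restr[OF N(1) sub(7,1) N(3)] N(6) by simp
      moreover have "restr E V ?N t = restr E W ?N b"
        using restr_restr[OF V sub(8,2) s(2)] restr_restr[OF N(1) sub(9,2) N'(1)] N'(4) by simp
      ultimately have "restr E W ?N (a \<oplus>\<^bsub>sections E W\<^esub> b) = restr E V ?N (s \<oplus>\<^bsub>sections E V\<^esub> t)"
        using restr_add[OF V sub(3) s] restr_add[OF N(1) sub(4) N(3) N'(1)] by simp
      then show ?thesis
        using N(5) N'(3) sub(5)
        by (subst germ_eq_iff[OF N(1) V N(2) True]) (auto intro: s N(3) N'(1))
    qed
    have "{germ M U E q W (a \<oplus>\<^bsub>sections E W\<^esub> b) | W a b.
        (W, a) \<in> germ M U E q V s \<and> (W, b) \<in> germ M U E q V t} = {?X}"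
      using eq germ_refl[OF V True s(1)] germ_refl[OF V True s(2)] by blast
    then show ?thesis using True by (simp add: sheafify_unit_def sheafify_def)
  qed (simp add: sheafify_unit_def sheafify_def)
qed

lemma sheafify_unit_smult:
  assumes V: "V \<in> opens M U" and f: "f \<in> carrier (hol_ring M V)" and s: "s \<in> carrier (sections E V)"
    and M: "complex_manifold M"
  shows "sheafify_unit V (f \<odot>\<^bsub>sections E V\<^esub> s) = f \<odot>\<^bsub>sections (sheafify M U E) V\<^esub> sheafify_unit V s"
proof
  fix q
  interpret complex_manifold M by (rule M)
  interpret V: module "hol_ring M V" "sections E V" by (rule module_sections[OF V])
  show "sheafify_unit V (f \<odot>\<^bsub>sections E V\<^esub> s) q = (f \<odot>\<^bsub>sections (sheafify M U E) V\<^esub> sheafify_unit V s) q"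
  proof (cases "q \<in> V")
    case True
    let ?X = "germ M U E q V (f \<odot>\<^bsub>sections E V\<^esub> s)"
    have eq: "germ M U E q W (restrict f W \<odot>\<^bsub>sections E W\<^esub> a) = ?X"
      if a: "(W, a) \<in> germ M U E q V s" and WV: "W \<subseteq> V" for W a
    proof -
      obtain N where N: "W \<in> opens M U" "q \<in> W" "a \<in> carrier (sections E W)" "N \<in> opens M (V \<inter> W)" "q \<in> N"
          "restr E V N s = restr E W N a"
        using a by (auto simp: germ_def)
      interpret W: module "hol_ring M W" "sections E W" by (rule module_sections[OF N(1)])
      have sub: "N \<in> opens M V" "N \<in> opens M W" "W \<in> opens M V" "N \<in> opens M (W \<inter> V)"
        using N WV by (auto simp: opens_def)
      have fW: "restrict f W \<in> carrier (hol_ring M W)" by (rule hol_ring_restrict[OF f sub(3)])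
      have "restrict (restrict f W) N = restrict f N"
        by (rule ext) (use sub(2) in \<open>auto simp: opens_def\<close>)
      then have "restr E W N (restrict f W \<odot>\<^bsub>sections E W\<^esub> a) = restr E V N (f \<odot>\<^bsub>sections E V\<^esub> s)"
        using restr_smult[OF V sub(1) f s] restr_smult[OF N(1) sub(2) fW N(3)] N(6) by simp
      then show ?thesis
        using N(5) sub(4)
        by (subst germ_eq_iff[OF N(1) V N(2) True]) (auto intro: s N(3) fW f)
    qed
    have "{germ M U E q W (restrict f W \<odot>\<^bsub>sections E W\<^esub> a) | W a. (W, a) \<in> germ M U E q V s \<and> W \<subseteq> V} = {?X}"
      using eq germ_refl[OF V True s] by blast
    then show ?thesis using True by (simp add: sheafify_unit_def sheafify_def)
  qed (simp add: sheafify_unit_def sheafify_def)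
qed

end

text \<open>
  A homomorphism that is an epimorphism of sheaves and has as its kernel the subsheaf generated by the
  presheaf \<open>P\<close>.
\<close>

definition epi_with_kernel ::
  "'a cmanifold \<Rightarrow> 'a set \<Rightarrow> ('a, 'g) mod_data \<Rightarrow> ('a, 'e) mod_data \<Rightarrow> ('a set \<Rightarrow> 'g set) \<Rightarrow>
    ('a set \<Rightarrow> 'g \<Rightarrow> 'e) \<Rightarrow> bool" where
  "epi_with_kernel M U G E P e \<longleftrightarrow> sheaf_hom M U G E e \<and>
    (\<forall>V\<in>opens M U. \<forall>t\<in>carrier (sections E V). \<forall>p\<in>V. \<exists>W\<in>opens M V. p \<in> W \<and>
       (\<exists>g\<in>carrier (sections G W). e W g = restr E V W t)) \<and>
    (\<forall>V\<in>opens M U. \<forall>g\<in>carrier (sections G V). e V g = \<zero>\<^bsub>sections E V\<^esub> \<longleftrightarrow>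
       (\<forall>p\<in>V. \<exists>W\<in>opens M V. p \<in> W \<and> restr G V W g \<in> P W))"

text \<open>
  The map is the composite of the quotient map, the map to the sheafification and the inverse of the
  given isomorphism. It replaces germs and cosets by a homomorphism into \<open>E\<close> itself, which is all that
  is needed of a cokernel.
\<close>

lemma (in subpresheaf) cokernel_epi:
  assumes E: "O_presheaf M U E" and iso: "sheaf_isomorphic M U E (sheafify M U (quotient_presheaf G P))"
  shows "\<exists>e. epi_with_kernel M U G E P e"
proof -
  interpret E: O_presheaf M U E by (rule E)
  interpret Q: O_presheaf M U Q by (rule O_presheaf_quotient)
  let ?S = "sheafify M U Q"
  obtain h where h: "sheaf_hom M U E ?S h"
      "\<And>V. V \<in> opens M U \<Longrightarrow> bij_betw (h V) (carrier (sections E V)) (carrier (sections ?S V))"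
    using iso by (auto simp: sheaf_isomorphic_def)
  have h_add: "h V (s \<oplus>\<^bsub>sections E V\<^esub> t) = h V s \<oplus>\<^bsub>sections ?S V\<^esub> h V t"
    if "V \<in> opens M U" "s \<in> carrier (sections E V)" "t \<in> carrier (sections E V)" for V s t
    using h(1) that by (simp add: sheaf_hom_def module_hom_def)
  have h_smult: "h V (f \<odot>\<^bsub>sections E V\<^esub> s) = f \<odot>\<^bsub>sections ?S V\<^esub> h V s"
    if "V \<in> opens M U" "s \<in> carrier (sections E V)" "f \<in> carrier (hol_ring M V)" for V s f
    using h(1) that by (simp add: sheaf_hom_def module_hom_def)
  have h_restr: "restrict (h V s) W = h W (restr E V W s)"
    if "V \<in> opens M U" "W \<in> opens M V" "s \<in> carrier (sections E V)" for V W s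
    using h(1) that by (simp add: sheaf_hom_def sheafify_def)
  have h_inj: "s = t" if "V \<in> opens M U" "s \<in> carrier (sections E V)" "t \<in> carrier (sections E V)" "h V s = h V t" for V s t
    using h(2)[OF that(1)] that by (auto simp: bij_betw_def inj_on_def)
  let ?c = "\<lambda>V g. Q.sheafify_unit V (coset V g)"
  have coset_carrier: "coset V g \<in> carrier (sections Q V)" if "V \<in> opens M U" "g \<in> carrier (sections G V)" for V g
    using that unfolding Q_sections by (auto simp: quotient_carrier[OF module_sections sub])
  define e where "e V g = inv_into (carrier (sections E V)) (h V) (?c V g)" for V g
  have e: "e V g \<in> carrier (sections E V)" "h V (e V g) = ?c V g" if "V \<in> opens M U" "g \<in> carrier (sections G V)" for V g
  proof -
    have "?c V g \<in> h V ` carrier (sections E V)"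
      using Q.sheafify_unit_closed[OF that(1) coset_carrier[OF that]] h(2)[OF that(1)] by (simp add: bij_betw_def)
    then show "e V g \<in> carrier (sections E V)" "h V (e V g) = ?c V g"
      unfolding e_def by (simp_all add: inv_into_into f_inv_into_f)
  qed
  have e_add: "e V (g \<oplus>\<^bsub>sections G V\<^esub> k) = e V g \<oplus>\<^bsub>sections E V\<^esub> e V k"
    if V: "V \<in> opens M U" and g: "g \<in> carrier (sections G V)" and k: "k \<in> carrier (sections G V)" for V g k
  proof -
    interpret EV: abelian_group "sections E V" by (rule E.sections_abelian_group[OF V])
    interpret GV: abelian_group "sections G V" by (rule sections_abelian_group[OF V])
    note mV = module_sections[OF V] sub[OF V]
    have "h V (e V (g \<oplus>\<^bsub>sections G V\<^esub> k)) = ?c V (g \<oplus>\<^bsub>sections G V\<^esub> k)"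
      by (rule e(2)[OF V]) (simp add: g k)
    also have "\<dots> = ?c V g \<oplus>\<^bsub>sections ?S V\<^esub> ?c V k"
      using Q.sheafify_unit_add[OF V coset_carrier[OF V g] coset_carrier[OF V k]]
      unfolding Q_sections quotient_add[OF mV g k] .
    also have "\<dots> = h V (e V g \<oplus>\<^bsub>sections E V\<^esub> e V k)"
      using h_add[OF V e(1)[OF V g] e(1)[OF V k]] e(2)[OF V g] e(2)[OF V k] by simp
    finally show ?thesis
      by (rule h_inj[OF V, rotated 2]) (auto intro: e V g k)
  qed
  have e_smult: "e V (f \<odot>\<^bsub>sections G V\<^esub> g) = f \<odot>\<^bsub>sections E V\<^esub> e V g"
    if V: "V \<in> opens M U" and g: "g \<in> carrier (sections G V)" and f: "f \<in> carrier (hol_ring M V)" for V g f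
  proof -
    interpret EV: module "hol_ring M V" "sections E V" by (rule E.module_sections[OF V])
    interpret GV: module "hol_ring M V" "sections G V" by (rule module_sections[OF V])
    note mV = module_sections[OF V] sub[OF V]
    have "h V (e V (f \<odot>\<^bsub>sections G V\<^esub> g)) = ?c V (f \<odot>\<^bsub>sections G V\<^esub> g)"
      by (rule e(2)[OF V]) (simp add: g f)
    also have "\<dots> = f \<odot>\<^bsub>sections ?S V\<^esub> ?c V g"
      using Q.sheafify_unit_smult[OF V f coset_carrier[OF V g] complex_manifold_axioms]
      unfolding Q_sections quotient_smult[OF mV f g] .
    also have "\<dots> = h V (f \<odot>\<^bsub>sections E V\<^esub> e V g)"
      using h_smult[OF V e(1)[OF V g] f] e(2)[OF V g] by simp
    finally show ?thesis
      by (rule h_inj[OF V, rotated 2]) (auto intro: e V g f)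
  qed
  have e_restr: "restr E V W (e V g) = e W (restr G V W g)"
    if V: "V \<in> opens M U" and W: "W \<in> opens M V" and g: "g \<in> carrier (sections G V)" for V W g
  proof -
    have WU: "W \<in> opens M U" by (rule opens_subset[OF V W])
    have gW: "restr G V W g \<in> carrier (sections G W)" by (rule restr_closed[OF V W g])
    have "h W (restr E V W (e V g)) = restrict (?c V g) W"
      using h_restr[OF V W e(1)[OF V g]] e(2)[OF V g] by simp
    also have "\<dots> = h W (e W (restr G V W g))"
      using Q.sheafify_unit_restr[OF V W coset_carrier[OF V g]] Q_restr[OF V W g] e(2)[OF WU gW] by simp
    finally show ?thesis
      by (rule h_inj[OF WU E.restr_closed[OF V W e(1)[OF V g]] e(1)[OF WU gW]])
  qed
  have "sheaf_hom M U G E e"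
    using e(1) e_add e_smult e_restr by (auto simp: sheaf_hom_def module_hom_def)
  moreover have "\<exists>W\<in>opens M V. p \<in> W \<and> (\<exists>g\<in>carrier (sections G W). e W g = restr E V W t)"
    if V: "V \<in> opens M U" and t: "t \<in> carrier (sections E V)" and p: "p \<in> V" for V t p
  proof -
    have "h V t \<in> carrier (sections ?S V)" using h(2)[OF V] t by (auto simp: bij_betw_def)
    then obtain W s where W: "W \<in> opens M V" "p \<in> W" "s \<in> carrier (sections Q W)"
        "restrict (h V t) W = Q.sheafify_unit W s"
      using Q.sheafify_locally_unit[OF V _ p, of "h V t"] by blast
    have WU: "W \<in> opens M U" by (rule opens_subset[OF V W(1)])
    obtain g where g: "s = coset W g" "g \<in> carrier (sections G W)"
      using W(3) unfolding Q_sections quotient_carrier[OF module_sections[OF WU] sub[OF WU]] by blast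
    have "h W (e W g) = h W (restr E V W t)"
      using e(2)[OF WU g(2)] g(1) W(4) h_restr[OF V W(1) t] by simp
    then have "e W g = restr E V W t"
      by (rule h_inj[OF WU e(1)[OF WU g(2)] E.restr_closed[OF V W(1) t]])
    then show ?thesis using W(1,2) g(2) by blast
  qed
  moreover have "e V g = \<zero>\<^bsub>sections E V\<^esub> \<longleftrightarrow> (\<forall>p\<in>V. \<exists>W\<in>opens M V. p \<in> W \<and> restr G V W g \<in> P W)"
    if V: "V \<in> opens M U" and g: "g \<in> carrier (sections G V)" for V g
  proof -
    interpret EV: abelian_group "sections E V" by (rule E.sections_abelian_group[OF V])
    interpret GV: abelian_group "sections G V" by (rule sections_abelian_group[OF V])
    let ?z = "\<zero>\<^bsub>sections G V\<^esub>"
    have z: "?z \<in> carrier (sections G V)" by simp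
    have "e V ?z \<oplus>\<^bsub>sections E V\<^esub> e V ?z = e V ?z"
      using e_add[OF V z z] by simp
    then have e0: "e V ?z = \<zero>\<^bsub>sections E V\<^esub>"
      using e(1)[OF V z] by (metis EV.add.r_cancel_one')
    have "e V g = e V ?z \<longleftrightarrow> ?c V g = ?c V ?z"
      using e(2)[OF V g] e(2)[OF V z] h_inj[OF V e(1)[OF V g] e(1)[OF V z]] by auto
    also have "\<dots> \<longleftrightarrow> (\<forall>p\<in>V. \<exists>W\<in>opens M V. p \<in> W \<and> restr Q V W (coset V g) = restr Q V W (coset V ?z))"
      by (rule Q.sheafify_unit_eq_iff[OF V coset_carrier[OF V g] coset_carrier[OF V z]])
    also have "\<dots> \<longleftrightarrow> (\<forall>p\<in>V. \<exists>W\<in>opens M V. p \<in> W \<and> restr G V W g \<in> P W)"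
    proof -
      have "restr Q V W (coset V g) = restr Q V W (coset V ?z) \<longleftrightarrow> restr G V W g \<in> P W" if W: "W \<in> opens M V" for W
      proof -
        have WU: "W \<in> opens M U" by (rule opens_subset[OF V W])
        note mW = module_sections[OF WU] sub[OF WU]
        have gW: "restr G V W g \<in> carrier (sections G W)" by (rule restr_closed[OF V W g])
        interpret N: abelian_subgroup "P W" "sections G W" by (rule quotient_subgroup[OF mW])
        have "coset W \<zero>\<^bsub>sections G W\<^esub> = P W" by (rule N.a_rcos_const) simp
        then show ?thesis
          using Q_restr[OF V W g] Q_restr[OF V W z] restr_zero[OF V W] quotient_eq_zero_iff[OF mW gW] by simp
      qed
      then show ?thesis by (simp cong: bex_cong)
    qed
    finally show ?thesis using e0 by simp
  qed
  ultimately show ?thesis unfolding epi_with_kernel_def by blast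
qed

section \<open>Free sheaves and finite generation\<close>

lemma free_sheaf_sel:
  "\<zero>\<^bsub>sections (free_sheaf M J) V\<^esub> = (\<lambda>j\<in>J. \<lambda>x\<in>V. 0)"
  "s \<oplus>\<^bsub>sections (free_sheaf M J) V\<^esub> t = (\<lambda>j\<in>J. \<lambda>x\<in>V. s j x + t j x)"
  "f \<odot>\<^bsub>sections (free_sheaf M J) V\<^esub> s = (\<lambda>j\<in>J. \<lambda>x\<in>V. f x * s j x)"
  "restr (free_sheaf M J) V W s = (\<lambda>j\<in>J. restrict (s j) W)"
  by (simp_all add: free_sheaf_def generated_subsheaf_def product_sheaf_def)

lemma free_sheaf_apply [simp]:
  "j \<in> J \<Longrightarrow> x \<in> V \<Longrightarrow> \<zero>\<^bsub>sections (free_sheaf M J) V\<^esub> j x = 0"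
  "j \<in> J \<Longrightarrow> x \<in> V \<Longrightarrow> (s \<oplus>\<^bsub>sections (free_sheaf M J) V\<^esub> t) j x = s j x + t j x"
  "j \<in> J \<Longrightarrow> x \<in> V \<Longrightarrow> (f \<odot>\<^bsub>sections (free_sheaf M J) V\<^esub> s) j x = f x * s j x"
  "j \<in> J \<Longrightarrow> x \<in> W \<Longrightarrow> (restr (free_sheaf M J) V W s) j x = s j x"
  by (simp_all add: free_sheaf_sel)

definition basis_section :: "'j set \<Rightarrow> 'a set \<Rightarrow> 'j \<Rightarrow> 'j \<Rightarrow> 'a \<Rightarrow> complex" where
  "basis_section J V i = (\<lambda>j\<in>J. \<lambda>x\<in>V. if j = i then 1 else 0)"

lemma basis_section_apply [simp]: "j \<in> J \<Longrightarrow> x \<in> V \<Longrightarrow> basis_section J V i j x = (if j = i then 1 else 0)"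
  by (simp add: basis_section_def)

context complex_manifold
begin

lemma free_carrier:
  assumes V: "openin (mtop M) V"
  shows "s \<in> carrier (sections (free_sheaf M J) V) \<longleftrightarrow>
    s \<in> (\<Pi>\<^sub>E j\<in>J. carrier (hol_ring M V)) \<and>
    (\<forall>p\<in>V. \<exists>W\<in>opens M V. p \<in> W \<and> finite {j\<in>J. \<exists>x\<in>W. s j x \<noteq> 0})"
proof -
  have "restr (product_sheaf M J) V W s \<in>
      {s \<in> carrier (sections (product_sheaf M J) W). finite {j\<in>J. s j \<noteq> \<zero>\<^bsub>hol_ring M W\<^esub>}} \<longleftrightarrow>
      finite {j\<in>J. \<exists>x\<in>W. s j x \<noteq> 0}"
    if W: "W \<in> opens M V" and s: "s \<in> (\<Pi>\<^sub>E j\<in>J. carrier (hol_ring M V))" for W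
  proof -
    have "restrict (s j) W = (\<lambda>x\<in>W. 0) \<longleftrightarrow> (\<forall>x\<in>W. s j x = 0)" for j
    proof
      assume eq: "restrict (s j) W = (\<lambda>x\<in>W. 0)"
      show "\<forall>x\<in>W. s j x = 0"
      proof
        fix x assume "x \<in> W"
        then show "s j x = 0" using fun_cong[OF eq, of x] by simp
      qed
    qed (auto intro: restrict_ext)
    then have "{j\<in>J. (\<lambda>j\<in>J. restrict (s j) W) j \<noteq> (\<lambda>x\<in>W. 0)} = {j\<in>J. \<exists>x\<in>W. s j x \<noteq> 0}"
      by auto
    moreover have "(\<lambda>j\<in>J. restrict (s j) W) \<in> (\<Pi>\<^sub>E j\<in>J. carrier (hol_ring M W))"
      using s hol_ring_restrict[OF _ W] by auto
    ultimately show ?thesis by (simp add: product_sheaf_def)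
  qed
  moreover have "carrier (sections (free_sheaf M J) V) = {s \<in> (\<Pi>\<^sub>E j\<in>J. carrier (hol_ring M V)).
      \<forall>p\<in>V. \<exists>W\<in>opens M V. p \<in> W \<and> restr (product_sheaf M J) V W s \<in>
      {s \<in> carrier (sections (product_sheaf M J) W). finite {j\<in>J. s j \<noteq> \<zero>\<^bsub>hol_ring M W\<^esub>}}}"
    unfolding free_sheaf_def generated_subsheaf_def by (simp add: product_sheaf_def)
  ultimately show ?thesis
    by (simp only: mem_Collect_eq cong: bex_cong conj_cong)
qed

lemma free_carrierD:
  assumes "openin (mtop M) V" "s \<in> carrier (sections (free_sheaf M J) V)"
  shows "j \<in> J \<Longrightarrow> s j \<in> carrier (hol_ring M V)" "s \<in> extensional J"
    "p \<in> V \<Longrightarrow> \<exists>W\<in>opens M V. p \<in> W \<and> finite {j\<in>J. \<exists>x\<in>W. s j x \<noteq> 0}"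
    "p \<in> V \<Longrightarrow> finite {j\<in>J. s j p \<noteq> 0}"
proof -
  show c: "j \<in> J \<Longrightarrow> s j \<in> carrier (hol_ring M V)" "s \<in> extensional J"
    "p \<in> V \<Longrightarrow> \<exists>W\<in>opens M V. p \<in> W \<and> finite {j\<in>J. \<exists>x\<in>W. s j x \<noteq> 0}"
    using assms by (auto simp: free_carrier PiE_iff)
  assume "p \<in> V"
  then obtain W where "W \<in> opens M V" "p \<in> W" "finite {j\<in>J. \<exists>x\<in>W. s j x \<noteq> 0}" using c(3) by blast
  then show "finite {j\<in>J. s j p \<noteq> 0}" by (elim finite_subset[rotated]) auto
qed

lemma free_ext:
  assumes V: "openin (mtop M) V" and s: "s \<in> carrier (sections (free_sheaf M J) V)" "t \<in> carrier (sections (free_sheaf M J) V)"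
    and eq: "\<And>j x. j \<in> J \<Longrightarrow> x \<in> V \<Longrightarrow> s j x = t j x"
  shows "s = t"
proof (rule extensionalityI[of _ J])
  fix j assume "j \<in> J"
  then show "s j = t j"
    by (intro hol_ring_ext[OF free_carrierD(1)[OF V s(1)] free_carrierD(1)[OF V s(2)]] eq)
qed (use free_carrierD(2)[OF V] s in auto)

lemma free_carrierI:
  assumes V: "openin (mtop M) V" and "s \<in> extensional J" "\<And>j. j \<in> J \<Longrightarrow> s j \<in> carrier (hol_ring M V)"
    and "\<And>p. p \<in> V \<Longrightarrow> \<exists>W\<in>opens M V. p \<in> W \<and> (\<exists>F. finite F \<and> (\<forall>j\<in>J-F. \<forall>x\<in>W. s j x = 0))"
  shows "s \<in> carrier (sections (free_sheaf M J) V)"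
  unfolding free_carrier[OF V]
proof (intro conjI ballI)
  fix p assume "p \<in> V"
  then obtain W F where W: "W \<in> opens M V" "p \<in> W" "finite F" "\<forall>j\<in>J-F. \<forall>x\<in>W. s j x = 0"
    using assms(4) by blast
  moreover have "finite {j\<in>J. \<exists>x\<in>W. s j x \<noteq> 0}"
    by (rule finite_subset[OF _ W(3)]) (use W(4) in blast)
  ultimately show "\<exists>W\<in>opens M V. p \<in> W \<and> finite {j\<in>J. \<exists>x\<in>W. s j x \<noteq> 0}" by blast
qed (use assms in \<open>auto simp: PiE_iff\<close>)

lemma free_carrier_finite:
  assumes "openin (mtop M) V" "finite J"
  shows "s \<in> carrier (sections (free_sheaf M J) V) \<longleftrightarrow> s \<in> (\<Pi>\<^sub>E j\<in>J. carrier (hol_ring M V))"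
  using assms by (auto simp: free_carrier opens_def)

lemma basis_section_closed:
  assumes V: "openin (mtop M) V"
  shows "basis_section J V i \<in> carrier (sections (free_sheaf M J) V)"
proof (rule free_carrierI[OF V])
  fix j assume "j \<in> J"
  then show "basis_section J V i j \<in> carrier (hol_ring M V)"
    using hol_ring_const[OF V] by (simp add: basis_section_def)
next
  fix p assume "p \<in> V"
  then show "\<exists>W\<in>opens M V. p \<in> W \<and> (\<exists>F. finite F \<and> (\<forall>j\<in>J-F. \<forall>x\<in>W. basis_section J V i j x = 0))"
    using V by (intro bexI[of _ V] conjI exI[of _ "{i}"]) (auto simp: opens_def)
qed (simp add: basis_section_def)

lemma basis_section_restr: "W \<subseteq> V \<Longrightarrow> restr (free_sheaf M J) V W (basis_section J V i) = basis_section J W i"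
  unfolding free_sheaf_sel basis_section_def by (intro restrict_ext) (auto simp: fun_eq_iff)

lemma free_add_closed:
  assumes V: "openin (mtop M) V" and s: "s \<in> carrier (sections (free_sheaf M J) V)" and t: "t \<in> carrier (sections (free_sheaf M J) V)"
  shows "s \<oplus>\<^bsub>sections (free_sheaf M J) V\<^esub> t \<in> carrier (sections (free_sheaf M J) V)"
proof (rule free_carrierI[OF V])
  fix p assume p: "p \<in> V"
  obtain W where W: "W\<in>opens M V" "p \<in> W" "finite {j\<in>J. \<exists>x\<in>W. s j x \<noteq> 0}"
    using free_carrierD(3)[OF V s p] by blast
  obtain W' where W': "W'\<in>opens M V" "p \<in> W'" "finite {j\<in>J. \<exists>x\<in>W'. t j x \<noteq> 0}"
    using free_carrierD(3)[OF V t p] by blast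
  show "\<exists>W\<in>opens M V. p \<in> W \<and> (\<exists>F. finite F \<and> (\<forall>j\<in>J-F. \<forall>x\<in>W. (s \<oplus>\<^bsub>sections (free_sheaf M J) V\<^esub> t) j x = 0))"
    using W W' by (intro bexI[of _ "W \<inter> W'"] conjI exI[of _ "{j\<in>J. \<exists>x\<in>W. s j x \<noteq> 0} \<union> {j\<in>J. \<exists>x\<in>W'. t j x \<noteq> 0}"])
      (auto simp: opens_def free_sheaf_sel)
next
  fix j assume "j \<in> J"
  then show "(s \<oplus>\<^bsub>sections (free_sheaf M J) V\<^esub> t) j \<in> carrier (hol_ring M V)"
    using hol_ring_add[OF V free_carrierD(1)[OF V s] free_carrierD(1)[OF V t]] by (simp add: free_sheaf_sel)
qed (simp add: free_sheaf_sel)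

lemma free_smult_closed:
  assumes V: "openin (mtop M) V" and f: "f \<in> carrier (hol_ring M V)" and s: "s \<in> carrier (sections (free_sheaf M J) V)"
  shows "f \<odot>\<^bsub>sections (free_sheaf M J) V\<^esub> s \<in> carrier (sections (free_sheaf M J) V)"
proof (rule free_carrierI[OF V])
  fix p assume p: "p \<in> V"
  obtain W where W: "W\<in>opens M V" "p \<in> W" "finite {j\<in>J. \<exists>x\<in>W. s j x \<noteq> 0}"
    using free_carrierD(3)[OF V s p] by blast
  show "\<exists>W\<in>opens M V. p \<in> W \<and> (\<exists>F. finite F \<and> (\<forall>j\<in>J-F. \<forall>x\<in>W. (f \<odot>\<^bsub>sections (free_sheaf M J) V\<^esub> s) j x = 0))"
    using W by (intro bexI[of _ W] conjI exI[of _ "{j\<in>J. \<exists>x\<in>W. s j x \<noteq> 0}"])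
      (auto simp: opens_def free_sheaf_sel)
next
  fix j assume "j \<in> J"
  then show "(f \<odot>\<^bsub>sections (free_sheaf M J) V\<^esub> s) j \<in> carrier (hol_ring M V)"
    using hol_ring_mult[OF V f free_carrierD(1)[OF V s]] by (simp add: free_sheaf_sel)
qed (simp add: free_sheaf_sel)

lemma free_restr_closed:
  assumes V: "openin (mtop M) V" and W: "W \<in> opens M V" and s: "s \<in> carrier (sections (free_sheaf M J) V)"
  shows "restr (free_sheaf M J) V W s \<in> carrier (sections (free_sheaf M J) W)"
proof (rule free_carrierI)
  show oW: "openin (mtop M) W" using W by (simp add: opens_def)
  fix p assume p: "p \<in> W"
  then have "p \<in> V" using W by (auto simp: opens_def)
  then obtain N where N: "N\<in>opens M V" "p \<in> N" "finite {j\<in>J. \<exists>x\<in>N. s j x \<noteq> 0}"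
    using free_carrierD(3)[OF V s] by blast
  show "\<exists>N\<in>opens M W. p \<in> N \<and> (\<exists>F. finite F \<and> (\<forall>j\<in>J-F. \<forall>x\<in>N. restr (free_sheaf M J) V W s j x = 0))"
    using W N p by (intro bexI[of _ "W \<inter> N"] conjI exI[of _ "{j\<in>J. \<exists>x\<in>N. s j x \<noteq> 0}"])
      (auto simp: opens_def free_sheaf_sel)
next
  fix j assume "j \<in> J"
  then show "restr (free_sheaf M J) V W s j \<in> carrier (hol_ring M W)"
    using hol_ring_restrict[OF free_carrierD(1)[OF V s] W] by (simp add: free_sheaf_sel)
qed (simp add: free_sheaf_sel)

lemma free_module:
  assumes V: "openin (mtop M) V"
  shows "module (hol_ring M V) (sections (free_sheaf M J) V)" (is "module _ ?G")
proof -
  have zero: "\<zero>\<^bsub>?G\<^esub> \<in> carrier ?G"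
  proof (rule free_carrierI[OF V])
    fix p assume "p \<in> V"
    then show "\<exists>W\<in>opens M V. p \<in> W \<and> (\<exists>F. finite F \<and> (\<forall>j\<in>J-F. \<forall>x\<in>W. \<zero>\<^bsub>?G\<^esub> j x = 0))"
      using V by (intro bexI[of _ V] conjI exI[of _ "{}"]) (auto simp: opens_def)
  qed (use hol_ring_const[OF V] in \<open>auto simp: free_sheaf_sel\<close>)
  note closed = zero free_add_closed[OF V, where J = J] free_smult_closed[OF V, where J = J]
  show ?thesis
  proof (rule moduleI[OF hol_ring_cring[OF V]])
    show "abelian_group ?G"
    proof (rule abelian_groupI)
      fix s assume s: "s \<in> carrier ?G"
      have neg: "(\<lambda>x\<in>V. -1) \<odot>\<^bsub>?G\<^esub> s \<in> carrier ?G"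
        by (rule free_smult_closed[OF V hol_ring_const[OF V] s])
      have "(\<lambda>x\<in>V. -1) \<odot>\<^bsub>?G\<^esub> s \<oplus>\<^bsub>?G\<^esub> s = \<zero>\<^bsub>?G\<^esub>"
        by (rule free_ext[OF V free_add_closed[OF V neg s] zero]) simp
      with neg show "\<exists>y\<in>carrier ?G. y \<oplus>\<^bsub>?G\<^esub> s = \<zero>\<^bsub>?G\<^esub>" by blast
    qed (use closed in \<open>auto intro!: free_ext[OF V, where J = J]\<close>)
  next
    fix f g s assume "f \<in> carrier (hol_ring M V)" "g \<in> carrier (hol_ring M V)" "s \<in> carrier ?G"
    then show "(f \<oplus>\<^bsub>hol_ring M V\<^esub> g) \<odot>\<^bsub>?G\<^esub> s = f \<odot>\<^bsub>?G\<^esub> s \<oplus>\<^bsub>?G\<^esub> g \<odot>\<^bsub>?G\<^esub> s"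
      "(f \<otimes>\<^bsub>hol_ring M V\<^esub> g) \<odot>\<^bsub>?G\<^esub> s = f \<odot>\<^bsub>?G\<^esub> (g \<odot>\<^bsub>?G\<^esub> s)"
      using closed hol_ring_add[OF V] hol_ring_mult[OF V] by (auto intro!: free_ext[OF V, where J = J] simp: algebra_simps)
  next
    fix f s t assume "f \<in> carrier (hol_ring M V)" "t \<in> carrier ?G" "s \<in> carrier ?G"
    then show "f \<odot>\<^bsub>?G\<^esub> (s \<oplus>\<^bsub>?G\<^esub> t) = f \<odot>\<^bsub>?G\<^esub> s \<oplus>\<^bsub>?G\<^esub> f \<odot>\<^bsub>?G\<^esub> t"
      using closed by (auto intro!: free_ext[OF V, where J = J] simp: algebra_simps)
  next
    fix s assume "s \<in> carrier ?G"
    then show "\<one>\<^bsub>hol_ring M V\<^esub> \<odot>\<^bsub>?G\<^esub> s = s"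
      using closed hol_ring_const[OF V] by (auto intro!: free_ext[OF V, where J = J])
  qed (use closed in auto)
qed

lemma free_O_presheaf: "O_presheaf M U (free_sheaf M J)"
proof (rule O_presheaf.intro)
  fix V assume V: "V \<in> opens M U"
  then have oV: "openin (mtop M) V" by (simp add: opens_def)
  show "module (hol_ring M V) (sections (free_sheaf M J) V)" by (rule free_module[OF oV])
  fix s assume s: "s \<in> carrier (sections (free_sheaf M J) V)"
  show "restr (free_sheaf M J) V V s = s"
    by (rule free_ext[OF oV free_restr_closed[OF oV opens_self[OF V] s] s]) simp
  fix W assume W: "W \<in> opens M V"
  then have WV: "W \<subseteq> V" by (simp add: opens_def)
  show "restr (free_sheaf M J) V W s \<in> carrier (sections (free_sheaf M J) W)"
    by (rule free_restr_closed[OF oV W s])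
  show "restr (free_sheaf M J) V W (s \<oplus>\<^bsub>sections (free_sheaf M J) V\<^esub> t) =
      restr (free_sheaf M J) V W s \<oplus>\<^bsub>sections (free_sheaf M J) W\<^esub> restr (free_sheaf M J) V W t" for t
    using WV by (auto simp: free_sheaf_sel fun_eq_iff)
  show "restr (free_sheaf M J) V W (f \<odot>\<^bsub>sections (free_sheaf M J) V\<^esub> s) =
      restrict f W \<odot>\<^bsub>sections (free_sheaf M J) W\<^esub> restr (free_sheaf M J) V W s" for f
    using WV by (auto simp: free_sheaf_sel fun_eq_iff)
  show "restr (free_sheaf M J) W W' (restr (free_sheaf M J) V W s) = restr (free_sheaf M J) V W' s"
    if "W' \<in> opens M W" for W'
    using that by (auto simp: free_sheaf_sel fun_eq_iff opens_def)
qed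

lemma free_finsum_apply:
  assumes V: "openin (mtop M) V" and "finite A" and "f \<in> A \<rightarrow> carrier (sections (free_sheaf M J) V)"
    and j: "j \<in> J" and x: "x \<in> V"
  shows "finsum (sections (free_sheaf M J) V) f A j x = (\<Sum>a\<in>A. f a j x)"
proof -
  interpret G: module "hol_ring M V" "sections (free_sheaf M J) V" by (rule free_module[OF V])
  show ?thesis using assms(2,3)
    by (induction A rule: finite_induct) (auto simp: j x)
qed

end

lemma additive_map_finsum:
  assumes "abelian_group A" "abelian_group B"
    and hc: "\<And>x. x \<in> carrier A \<Longrightarrow> h x \<in> carrier B"
    and ha: "\<And>x y. x \<in> carrier A \<Longrightarrow> y \<in> carrier A \<Longrightarrow> h (x \<oplus>\<^bsub>A\<^esub> y) = h x \<oplus>\<^bsub>B\<^esub> h y"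
    and "finite S" "f \<in> S \<rightarrow> carrier A"
  shows "h (finsum A f S) = finsum B (\<lambda>s. h (f s)) S"
proof -
  interpret A: abelian_group A by fact
  interpret B: abelian_group B by fact
  show ?thesis using assms(5,6)
  proof (induction S rule: finite_induct)
    case empty
    have "h \<zero>\<^bsub>A\<^esub> \<oplus>\<^bsub>B\<^esub> h \<zero>\<^bsub>A\<^esub> = h \<zero>\<^bsub>A\<^esub>" using ha[of "\<zero>\<^bsub>A\<^esub>" "\<zero>\<^bsub>A\<^esub>"] by simp
    then show ?case using hc[of "\<zero>\<^bsub>A\<^esub>"] by (metis A.finsum_empty A.zero_closed B.add.r_cancel_one' B.finsum_empty)
  next
    case (insert a S)
    then have f: "f a \<in> carrier A" "f \<in> S \<rightarrow> carrier A" by auto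
    have "h (finsum A f (insert a S)) = h (f a) \<oplus>\<^bsub>B\<^esub> h (finsum A f S)"
      using ha[OF f(1) A.finsum_closed[OF f(2)]] insert.hyps f by (simp add: A.finsum_insert)
    also have "\<dots> = finsum B (\<lambda>s. h (f s)) (insert a S)"
      using insert by (subst B.finsum_insert) (auto intro: hc)
    finally show ?case .
  qed
qed

lemma module_hom_finsum:
  assumes "module R A" "module R B" and h: "h \<in> module_hom R A B" and "finite S" "f \<in> S \<rightarrow> carrier A"
  shows "h (finsum A f S) = finsum B (\<lambda>s. h (f s)) S"
  using assms by (intro additive_map_finsum) (auto simp: module_hom_def module_def)

lemma module_hom_image_submodule:
  assumes "module R A" "module R B" and h: "h \<in> module_hom R A B"
  shows "submodule (h ` carrier A) R B"
proof -
  interpret A: module R A by fact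
  interpret B: module R B by fact
  have sm: "r \<odot>\<^bsub>B\<^esub> y \<in> h ` carrier A" if r: "r \<in> carrier R" and y: "y \<in> h ` carrier A" for r y
  proof -
    obtain x where x: "x \<in> carrier A" "y = h x" using y by blast
    have "h (r \<odot>\<^bsub>A\<^esub> x) = r \<odot>\<^bsub>B\<^esub> y" using h x r by (simp add: module_hom_def)
    then show ?thesis using A.smult_closed[OF r x(1)] by (metis imageI)
  qed
  show ?thesis
  proof (rule B.submoduleI)
    show sub: "h ` carrier A \<subseteq> carrier B" using h by (auto simp: module_hom_def)
    have "\<zero>\<^bsub>R\<^esub> \<odot>\<^bsub>B\<^esub> h \<zero>\<^bsub>A\<^esub> \<in> h ` carrier A" by (rule sm) auto
    moreover have "h \<zero>\<^bsub>A\<^esub> \<in> carrier B" using sub by auto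
    ultimately show "\<zero>\<^bsub>B\<^esub> \<in> h ` carrier A" by simp
    show "\<ominus>\<^bsub>B\<^esub> y \<in> h ` carrier A" if y: "y \<in> h ` carrier A" for y
    proof -
      have "(\<ominus>\<^bsub>R\<^esub> \<one>\<^bsub>R\<^esub>) \<odot>\<^bsub>B\<^esub> y = \<ominus>\<^bsub>B\<^esub> y"
        using sub y by (subst B.smult_l_minus) auto
      then show ?thesis using sm[OF _ y, of "\<ominus>\<^bsub>R\<^esub> \<one>\<^bsub>R\<^esub>"] by simp
    qed
    show "x \<oplus>\<^bsub>B\<^esub> y \<in> h ` carrier A" if xy: "x \<in> h ` carrier A" "y \<in> h ` carrier A" for x y
    proof -
      obtain a b where "a \<in> carrier A" "x = h a" "b \<in> carrier A" "y = h b" using xy by blast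
      then have "h (a \<oplus>\<^bsub>A\<^esub> b) = x \<oplus>\<^bsub>B\<^esub> y" "a \<oplus>\<^bsub>A\<^esub> b \<in> carrier A" using h by (auto simp: module_hom_def)
      then show ?thesis by (metis imageI)
    qed
  qed (rule sm)
qed

lemma presheaf_image_subpresheaf:
  assumes M: "complex_manifold M" and F: "O_presheaf M U F" and G: "O_presheaf M U G"
    and h: "sheaf_hom M U F G h"
  shows "subpresheaf M U G (presheaf_image F h)"
proof (intro subpresheaf.intro subpresheaf_axioms.intro)
  interpret F: O_presheaf M U F by fact
  interpret G: O_presheaf M U G by fact
  fix V assume V: "V \<in> opens M U"
  show "submodule (presheaf_image F h V) (hol_ring M V) (sections G V)"
    unfolding presheaf_image_def
    by (rule module_hom_image_submodule[OF F.module_sections[OF V] G.module_sections[OF V]])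
      (use h V in \<open>simp add: sheaf_hom_def\<close>)
  fix W s assume W: "W \<in> opens M V" and "s \<in> presheaf_image F h V"
  then obtain t where t: "t \<in> carrier (sections F V)" "s = h V t" by (auto simp: presheaf_image_def)
  have "restr G V W s = h W (restr F V W t)" using h V W t by (simp add: sheaf_hom_def)
  then show "restr G V W s \<in> presheaf_image F h W"
    using F.restr_closed[OF V W t(1)] by (auto simp: presheaf_image_def)
qed (use assms in auto)

definition lincomb :: "('r, 'm) module \<Rightarrow> 'k set \<Rightarrow> ('k \<Rightarrow> 'r) \<Rightarrow> ('k \<Rightarrow> 'm) \<Rightarrow> 'm" where
  "lincomb A K a s = (\<Oplus>\<^bsub>A\<^esub>k\<in>K. a k \<odot>\<^bsub>A\<^esub> s k)"

definition spans :: "'r ring \<Rightarrow> ('r, 'm) module \<Rightarrow> 'k set \<Rightarrow> ('k \<Rightarrow> 'm) \<Rightarrow> 'm set \<Rightarrow> bool" where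
  "spans R A K s T \<longleftrightarrow> finite K \<and> s \<in> K \<rightarrow> carrier A \<and> (\<forall>t\<in>T. \<exists>a\<in>K \<rightarrow> carrier R. t = lincomb A K a s)"

text \<open>
  Indexing by an initial segment of the natural numbers turns the size of a spanning family into a
  number that can be minimised.
\<close>

lemma spans_reindex:
  assumes A: "module R A" and sp: "spans R A K s T"
  shows "\<exists>s'. spans R A {..<card K} s' T"
proof -
  interpret module R A by fact
  have K: "finite K" "s \<in> K \<rightarrow> carrier A" using sp by (auto simp: spans_def)
  obtain \<pi> where p: "bij_betw \<pi> {..<card K} K"
    using ex_bij_betw_nat_finite[OF K(1)] by (auto simp: atLeast0LessThan)
  then have img: "\<pi> ` {..<card K} = K" and inj: "inj_on \<pi> {..<card K}" by (auto simp: bij_betw_def)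
  have piK: "\<pi> i \<in> K" if "i < card K" for i using img that by blast
  have "\<exists>b\<in>{..<card K} \<rightarrow> carrier R. t = lincomb A {..<card K} b (s \<circ> \<pi>)" if t: "t \<in> T" for t
  proof -
    obtain a where a: "a \<in> K \<rightarrow> carrier R" "t = lincomb A K a s" using sp t by (auto simp: spans_def)
    have "lincomb A K a s = lincomb A (\<pi> ` {..<card K}) a s" by (simp add: img)
    also have "\<dots> = lincomb A {..<card K} (a \<circ> \<pi>) (s \<circ> \<pi>)"
      unfolding lincomb_def using a(1) K(2) img by (subst M.finsum_reindex[OF _ inj]) auto
    finally show ?thesis using a piK by (intro bexI[of _ "a \<circ> \<pi>"]) (auto simp: Pi_iff)
  qed
  moreover have "s \<circ> \<pi> \<in> {..<card K} \<rightarrow> carrier A" using K(2) piK by (auto simp: Pi_iff)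
  ultimately show ?thesis unfolding spans_def by (intro exI[of _ "s \<circ> \<pi>"]) auto
qed

text \<open>
  The homomorphism factors through the quotient, and the images of generators of the quotient span.
\<close>

lemma spans_of_finitely_generated:
  assumes A: "module R A" and B: "module R B" and h: "h \<in> module_hom R A B"
    and N: "submodule N R A" and ker: "\<And>x. x \<in> N \<Longrightarrow> h x = \<zero>\<^bsub>B\<^esub>"
    and fg: "finitely_generated R (quotient_module A N)"
  shows "\<exists>(n::nat) s. spans R B {..<n} s (h ` carrier A)"
proof -
  interpret A: module R A by fact
  interpret B: module R B by fact
  let ?Q = "quotient_module A N"
  interpret Q: module R ?Q by (rule quotient_is_module[OF A N])
  interpret N: abelian_subgroup N A by (rule quotient_subgroup[OF A N])
  have hc: "h x \<in> carrier B" if "x \<in> carrier A" for x using h that by (auto simp: module_hom_def)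
  have ha: "h (x \<oplus>\<^bsub>A\<^esub> y) = h x \<oplus>\<^bsub>B\<^esub> h y" if "x \<in> carrier A" "y \<in> carrier A" for x y
    using h that by (simp add: module_hom_def)
  have hs: "h (r \<odot>\<^bsub>A\<^esub> y) = r \<odot>\<^bsub>B\<^esub> h y" if "r \<in> carrier R" "y \<in> carrier A" for r y
    using h that by (simp add: module_hom_def)
  \<comment> \<open>The induced map on cosets; any representative gives the same value since \<open>h\<close> vanishes on \<open>N\<close>.\<close>
  define hq where "hq C = h (SOME x. x \<in> C)" for C
  have hq: "hq (N +>\<^bsub>A\<^esub> x) = h x" if x: "x \<in> carrier A" for x
  proof -
    have "(SOME y. y \<in> N +>\<^bsub>A\<^esub> x) \<in> N +>\<^bsub>A\<^esub> x" using N.a_rcos_self[OF x] by (rule someI)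
    then obtain y where y: "y \<in> N" "(SOME y. y \<in> N +>\<^bsub>A\<^esub> x) = y \<oplus>\<^bsub>A\<^esub> x" by (auto simp: a_r_coset_def')
    then have "hq (N +>\<^bsub>A\<^esub> x) = h y \<oplus>\<^bsub>B\<^esub> h x" using ha[OF N.a_Hcarr[OF y(1)] x] by (simp add: hq_def)
    then show ?thesis using ker[OF y(1)] hc[OF x] by simp
  qed
  have "hq \<in> module_hom R ?Q B"
    unfolding module_hom_def quotient_carrier[OF A N]
    by (auto simp: quotient_add[OF A N] quotient_smult[OF A N] hq hc ha hs)
  note hq_sum = module_hom_finsum[OF Q.module_axioms B this]
  obtain S where S: "S \<subseteq> carrier ?Q" "finite S"
    "\<And>m. m \<in> carrier ?Q \<Longrightarrow> \<exists>c\<in>S \<rightarrow> carrier R. m = (\<Oplus>\<^bsub>?Q\<^esub>s\<in>S. c s \<odot>\<^bsub>?Q\<^esub> s)"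
    using fg unfolding finitely_generated_def by blast
  have hqS: "hq C \<in> carrier B" if "C \<in> carrier ?Q" for C
    using that unfolding quotient_carrier[OF A N] by (auto simp: hq hc)
  have "\<exists>c\<in>S \<rightarrow> carrier R. h x = lincomb B S c hq" if x: "x \<in> carrier A" for x
  proof -
    have "N +>\<^bsub>A\<^esub> x \<in> carrier ?Q" using x by (auto simp: quotient_carrier[OF A N])
    then obtain c where c: "c \<in> S \<rightarrow> carrier R" "N +>\<^bsub>A\<^esub> x = (\<Oplus>\<^bsub>?Q\<^esub>s\<in>S. c s \<odot>\<^bsub>?Q\<^esub> s)" using S(3) by blast
    have "h x = hq (\<Oplus>\<^bsub>?Q\<^esub>s\<in>S. c s \<odot>\<^bsub>?Q\<^esub> s)" using hq[OF x] c(2) by simp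
    also have "\<dots> = (\<Oplus>\<^bsub>B\<^esub>s\<in>S. hq (c s \<odot>\<^bsub>?Q\<^esub> s))"
      by (rule hq_sum[OF S(2)]) (use c S in auto)
    also have "\<dots> = lincomb B S c hq"
      unfolding lincomb_def
    proof (rule B.M.finsum_cong'[OF refl])
      fix C assume C: "C \<in> S"
      then have cC: "c C \<in> carrier R" using c(1) by auto
      obtain y where y: "C = N +>\<^bsub>A\<^esub> y" "y \<in> carrier A"
        using C S(1) unfolding quotient_carrier[OF A N] by blast
      have "hq (c C \<odot>\<^bsub>?Q\<^esub> C) = h (c C \<odot>\<^bsub>A\<^esub> y)"
        using quotient_smult[OF A N cC y(2)] hq[OF A.smult_closed[OF cC y(2)]] y(1) by simp
      then show "hq (c C \<odot>\<^bsub>?Q\<^esub> C) = c C \<odot>\<^bsub>B\<^esub> hq C"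
        using hs[OF cC y(2)] hq[OF y(2)] y(1) by simp
    next
      show "(\<lambda>C. c C \<odot>\<^bsub>B\<^esub> hq C) \<in> S \<rightarrow> carrier B"
      proof
        fix C assume "C \<in> S"
        then show "c C \<odot>\<^bsub>B\<^esub> hq C \<in> carrier B" using c(1) S(1) hqS by (intro B.smult_closed) auto
      qed
    qed
    finally show ?thesis using c(1) by blast
  qed
  then have "spans R B S hq (h ` carrier A)" using S hqS by (auto simp: spans_def)
  then show ?thesis using spans_reindex[OF B] by blast
qed

section \<open>Presentations by finitely many generators\<close>

lemma (in complex_manifold) hol_ring_nonzero_open:
  assumes U: "openin (mtop M) U" and f: "f \<in> carrier (hol_ring M U)"
  shows "openin (mtop M) {x \<in> U. f x \<noteq> 0}"
proof (subst openin_subopen, intro ballI)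
  fix x assume x: "x \<in> {x \<in> U. f x \<noteq> 0}"
  then have "x \<in> mpoints M" using U openin_subset by blast
  then obtain n W \<phi> where c: "(n, W, \<phi>) \<in> charts M" "x \<in> W"
    using charts_cover by auto
  let ?D = "\<phi> ` (U \<inter> W)" and ?g = "\<lambda>z. f (inv_into W \<phi> z)"
  have oD: "openin (Cn n) ?D" by (rule chart_image_openin[OF c(1) U])
  have "holomorphic_Cn n ?D ?g" using f c(1) unfolding in_hol_ring_iff by blast
  then have "continuous_on ?D ?g" by (simp add: holomorphic_Cn_def)
  then have "openin (top_of_set ?D) (?D \<inter> ?g -` (- {0}))"
    by (rule continuous_openin_preimage_gen) auto
  then have "openin (Cn n) (?D \<inter> ?g -` (- {0}))"
    using oD unfolding Cn_def by (rule openin_trans)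
  then have o: "openin (mtop M) {p \<in> W. \<phi> p \<in> ?D \<inter> ?g -` (- {0})}"
    by (rule chart_preimage_openin[OF c(1)])
  have inv: "inv_into W \<phi> (\<phi> p) = p" if "p \<in> W" for p
    using that chart_inj[OF c(1)] by (simp add: inv_into_f_f)
  have "{p \<in> W. \<phi> p \<in> ?D \<inter> ?g -` (- {0})} \<subseteq> {x \<in> U. f x \<noteq> 0}"
  proof
    fix p assume p: "p \<in> {p \<in> W. \<phi> p \<in> ?D \<inter> ?g -` (- {0})}"
    then obtain q where q: "q \<in> U" "q \<in> W" "\<phi> p = \<phi> q" by auto
    have pW: "p \<in> W" using p by simp
    have "p = q" by (rule inj_onD[OF chart_inj[OF c(1)] q(3) pW q(2)])
    moreover have "f p \<noteq> 0" using p inv[OF pW] by simp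
    ultimately show "p \<in> {x \<in> U. f x \<noteq> 0}" using q(1) by simp
  qed
  moreover have "x \<in> {p \<in> W. \<phi> p \<in> ?D \<inter> ?g -` (- {0})}" using x c(2) inv by auto
  ultimately show "\<exists>T. openin (mtop M) T \<and> x \<in> T \<and> T \<subseteq> {x \<in> U. f x \<noteq> 0}"
    using o by blast
qed

text \<open>
  Where a section of a free sheaf has finite support it is a finite combination of the basis, so a
  homomorphism is determined there by its values on the basis.
\<close>

lemma (in complex_manifold) sheaf_hom_free_apply:
  assumes h: "sheaf_hom M U (free_sheaf M I) H h" and H: "O_presheaf M U H" and W: "W \<in> opens M U"
    and b: "b \<in> carrier (sections (free_sheaf M I) W)"
    and F: "finite F" "F \<subseteq> I" "\<And>i x. i \<in> I - F \<Longrightarrow> x \<in> W \<Longrightarrow> b i x = 0"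
  shows "h W b = finsum (sections H W) (\<lambda>i. b i \<odot>\<^bsub>sections H W\<^esub> h W (basis_section I W i)) F"
proof -
  have oW: "openin (mtop M) W" using W by (simp add: opens_def)
  interpret H: module "hol_ring M W" "sections H W" by (rule O_presheaf.module_sections[OF H W])
  interpret G: module "hol_ring M W" "sections (free_sheaf M I) W" by (rule free_module[OF oW])
  have hW: "h W \<in> module_hom (hol_ring M W) (sections (free_sheaf M I) W) (sections H W)"
    using h W by (simp add: sheaf_hom_def)
  have bi: "b i \<in> carrier (hol_ring M W)" if "i \<in> F" for i
    using free_carrierD(1)[OF oW b] F(2) that by blast
  let ?t = "\<lambda>i. b i \<odot>\<^bsub>sections (free_sheaf M I) W\<^esub> basis_section I W i"
  have tc: "?t \<in> F \<rightarrow> carrier (sections (free_sheaf M I) W)"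
    using bi basis_section_closed[OF oW, of I] by (auto intro!: G.smult_closed)
  have "b = finsum (sections (free_sheaf M I) W) ?t F"
  proof (rule free_ext[OF oW b G.finsum_closed[OF tc]])
    fix j x assume j: "j \<in> I" and x: "x \<in> W"
    have "finsum (sections (free_sheaf M I) W) ?t F j x = (\<Sum>i\<in>F. b i x * (if j = i then 1 else 0))"
      using free_finsum_apply[OF oW F(1) tc j x] j x by simp
    also have "\<dots> = b j x" using F j x by (cases "j \<in> F") (auto simp: if_distrib[of "\<lambda>c. _ * c"] cong: if_cong)
    finally show "b j x = finsum (sections (free_sheaf M I) W) ?t F j x" by simp
  qed
  then have "h W b = finsum (sections H W) (\<lambda>i. h W (?t i)) F"
    using module_hom_finsum[OF G.module_axioms H.module_axioms hW F(1) tc] by simp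
  also have "\<dots> = finsum (sections H W) (\<lambda>i. b i \<odot>\<^bsub>sections H W\<^esub> h W (basis_section I W i)) F"
  proof (rule H.M.finsum_cong'[OF refl])
    show "(\<lambda>i. b i \<odot>\<^bsub>sections H W\<^esub> h W (basis_section I W i)) \<in> F \<rightarrow> carrier (sections H W)"
      using bi hW basis_section_closed[OF oW, of I] by (auto simp: module_hom_def intro!: H.smult_closed)
    show "h W (?t i) = b i \<odot>\<^bsub>sections H W\<^esub> h W (basis_section I W i)" if "i \<in> F" for i
      using bi[OF that] hW basis_section_closed[OF oW, of I i] by (simp add: module_hom_def)
  qed
  finally show ?thesis .
qed

lemma (in O_presheaf) restr_finsum:
  assumes V: "V \<in> opens M U" and W: "W \<in> opens M V" and "finite S" "f \<in> S \<rightarrow> carrier (sections E V)"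
  shows "restr E V W (finsum (sections E V) f S) = finsum (sections E W) (\<lambda>s. restr E V W (f s)) S"
  using assms opens_subset[OF V W]
  by (intro additive_map_finsum sections_abelian_group restr_closed restr_add) auto

locale generated_module = complex_manifold M + O_module M B E
  for M :: "'a cmanifold" and B and E :: "('a, 'e) mod_data" +
  fixes K :: "'k set" and s :: "'k \<Rightarrow> 'e"
  assumes open_B: "openin (mtop M) B" and finite_K: "finite K"
    and gens: "k \<in> K \<Longrightarrow> s k \<in> carrier (sections E B)"
begin

lemma B_opens: "B \<in> opens M B"
  using open_B by (simp add: opens_def)

lemma opens_open: "V \<in> opens M B \<Longrightarrow> openin (mtop M) V"
  by (simp add: opens_def)

abbreviation FK :: "('a, 'k \<Rightarrow> 'a \<Rightarrow> complex) mod_data" where "FK \<equiv> free_sheaf M K"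

text \<open>
  The homomorphism from the free sheaf on \<open>K\<close> that maps the basis to the given sections.
\<close>

definition comb :: "'a set \<Rightarrow> ('k \<Rightarrow> 'a \<Rightarrow> complex) \<Rightarrow> 'e" where
  "comb V a = lincomb (sections E V) K a (\<lambda>k. restr E B V (s k))"

lemma gens_restr: "V \<in> opens M B \<Longrightarrow> k \<in> K \<Longrightarrow> restr E B V (s k) \<in> carrier (sections E V)"
  using restr_closed[OF B_opens] gens by blast

lemma comb_hom: "sheaf_hom M B FK E comb"
  unfolding sheaf_hom_def
proof (intro ballI conjI)
  fix V assume V: "V \<in> opens M B"
  have oV: "openin (mtop M) V" by (rule opens_open[OF V])
  interpret V: module "hol_ring M V" "sections E V" by (rule module_sections[OF V])
  interpret G: module "hol_ring M V" "sections FK V" by (rule free_module[OF oV])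
  have ak: "a k \<in> carrier (hol_ring M V)" if "a \<in> carrier (sections FK V)" "k \<in> K" for a k
    using free_carrierD(1)[OF oV that] .
  have tm: "(\<lambda>k. a k \<odot>\<^bsub>sections E V\<^esub> restr E B V (s k)) \<in> K \<rightarrow> carrier (sections E V)"
    if "a \<in> carrier (sections FK V)" for a
    using ak[OF that] gens_restr[OF V] by (auto intro!: V.smult_closed)
  show "comb V \<in> module_hom (hol_ring M V) (sections FK V) (sections E V)"
    unfolding module_hom_def
  proof (intro CollectI conjI ballI funcsetI)
    fix a assume a: "a \<in> carrier (sections FK V)"
    show "comb V a \<in> carrier (sections E V)"
      unfolding comb_def lincomb_def by (rule V.finsum_closed[OF tm[OF a]])
    show "comb V (a \<oplus>\<^bsub>sections FK V\<^esub> b) = comb V a \<oplus>\<^bsub>sections E V\<^esub> comb V b"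
      if b: "b \<in> carrier (sections FK V)" for b
      unfolding comb_def lincomb_def V.finsum_addf[OF tm[OF a] tm[OF b], symmetric]
    proof (rule V.M.finsum_cong'[OF refl])
      fix k assume k: "k \<in> K"
      show "(a \<oplus>\<^bsub>sections FK V\<^esub> b) k \<odot>\<^bsub>sections E V\<^esub> restr E B V (s k) =
          a k \<odot>\<^bsub>sections E V\<^esub> restr E B V (s k) \<oplus>\<^bsub>sections E V\<^esub> b k \<odot>\<^bsub>sections E V\<^esub> restr E B V (s k)"
        using V.smult_l_distr[OF ak[OF a k] ak[OF b k] gens_restr[OF V k]] k by (simp add: free_sheaf_sel)
    qed (use tm[OF a] tm[OF b] in \<open>auto simp: Pi_iff\<close>)
    show "comb V (f \<odot>\<^bsub>sections FK V\<^esub> a) = f \<odot>\<^bsub>sections E V\<^esub> comb V a"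
      if f: "f \<in> carrier (hol_ring M V)" for f
      unfolding comb_def lincomb_def V.finsum_smult_ldistr[OF finite_K f tm[OF a]]
    proof (rule V.M.finsum_cong'[OF refl])
      fix k assume k: "k \<in> K"
      show "(f \<odot>\<^bsub>sections FK V\<^esub> a) k \<odot>\<^bsub>sections E V\<^esub> restr E B V (s k) =
          f \<odot>\<^bsub>sections E V\<^esub> (a k \<odot>\<^bsub>sections E V\<^esub> restr E B V (s k))"
        using V.smult_assoc1[OF f ak[OF a k] gens_restr[OF V k]] k by (simp add: free_sheaf_sel)
    qed (use tm[OF a] f in \<open>auto simp: Pi_iff\<close>)
  qed
  fix W a assume W: "W \<in> opens M V" and a: "a \<in> carrier (sections FK V)"
  have WB: "W \<in> opens M B" by (rule opens_subset[OF V W])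
  interpret W: module "hol_ring M W" "sections E W" by (rule module_sections[OF WB])
  have "restr E V W (comb V a) =
      finsum (sections E W) (\<lambda>k. restr E V W (a k \<odot>\<^bsub>sections E V\<^esub> restr E B V (s k))) K"
    unfolding comb_def lincomb_def by (rule restr_finsum[OF V W finite_K tm[OF a]])
  also have "\<dots> = comb W (restr FK V W a)"
    unfolding comb_def lincomb_def
  proof (rule W.M.finsum_cong'[OF refl])
    fix k assume k: "k \<in> K"
    show "restr E V W (a k \<odot>\<^bsub>sections E V\<^esub> restr E B V (s k)) =
        restr FK V W a k \<odot>\<^bsub>sections E W\<^esub> restr E B W (s k)"
      using restr_smult[OF V W ak[OF a k] gens_restr[OF V k]] restr_restr[OF B_opens V W gens[OF k]] k
      by (simp add: free_sheaf_sel)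
  next
    show "(\<lambda>k. restr FK V W a k \<odot>\<^bsub>sections E W\<^esub> restr E B W (s k)) \<in> K \<rightarrow> carrier (sections E W)"
      using hol_ring_restrict[OF ak[OF a] W] gens_restr[OF WB]
      by (auto simp: free_sheaf_sel intro!: W.smult_closed)
  qed
  finally show "restr E V W (comb V a) = comb W (restr FK V W a)" .
qed

lemma comb_closed: "V \<in> opens M B \<Longrightarrow> a \<in> carrier (sections FK V) \<Longrightarrow> comb V a \<in> carrier (sections E V)"
  using comb_hom by (auto simp: sheaf_hom_def module_hom_def)

lemma comb_add: "V \<in> opens M B \<Longrightarrow> a \<in> carrier (sections FK V) \<Longrightarrow> b \<in> carrier (sections FK V) \<Longrightarrow>
    comb V (a \<oplus>\<^bsub>sections FK V\<^esub> b) = comb V a \<oplus>\<^bsub>sections E V\<^esub> comb V b"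
  using comb_hom by (auto simp: sheaf_hom_def module_hom_def)

lemma comb_smult: "V \<in> opens M B \<Longrightarrow> a \<in> carrier (sections FK V) \<Longrightarrow> f \<in> carrier (hol_ring M V) \<Longrightarrow>
    comb V (f \<odot>\<^bsub>sections FK V\<^esub> a) = f \<odot>\<^bsub>sections E V\<^esub> comb V a"
  using comb_hom by (auto simp: sheaf_hom_def module_hom_def)

lemma comb_restr: "V \<in> opens M B \<Longrightarrow> W \<in> opens M V \<Longrightarrow> a \<in> carrier (sections FK V) \<Longrightarrow>
    restr E V W (comb V a) = comb W (restr FK V W a)"
  using comb_hom by (auto simp: sheaf_hom_def)

text \<open>
  A combination of combinations of the generators is a combination of the generators. The family
  indexed by \<open>F\<close> is a different one in each use: the basis of a free module, or the covariant
  derivatives of the generators.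
\<close>

lemma comb_lincomb:
  assumes V: "V \<in> opens M B" and F: "finite F" and c: "\<And>j. j \<in> F \<Longrightarrow> c j \<in> carrier (hol_ring M V)"
    and b: "\<And>j. j \<in> F \<Longrightarrow> b j \<in> carrier (sections FK V)"
  shows "lincomb (sections E V) F c (\<lambda>j. comb V (b j)) = comb V (lincomb (sections FK V) F c b)"
proof -
  have oV: "openin (mtop M) V" by (rule opens_open[OF V])
  interpret V: module "hol_ring M V" "sections E V" by (rule module_sections[OF V])
  interpret G: module "hol_ring M V" "sections FK V" by (rule free_module[OF oV])
  have tc: "(\<lambda>j. c j \<odot>\<^bsub>sections FK V\<^esub> b j) \<in> F \<rightarrow> carrier (sections FK V)"
    using c b by (auto intro!: G.smult_closed)
  have "comb V (lincomb (sections FK V) F c b) = finsum (sections E V) (\<lambda>j. comb V (c j \<odot>\<^bsub>sections FK V\<^esub> b j)) F"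
    unfolding lincomb_def
    by (rule module_hom_finsum[OF G.module_axioms V.module_axioms _ F tc])
      (use comb_hom V in \<open>simp add: sheaf_hom_def\<close>)
  also have "\<dots> = lincomb (sections E V) F c (\<lambda>j. comb V (b j))"
    unfolding lincomb_def
    by (rule V.M.finsum_cong'[OF refl])
      (use c b comb_smult[OF V] comb_closed[OF V] in \<open>auto intro!: V.smult_closed\<close>)
  finally show ?thesis ..
qed

end

lemma (in complex_manifold) free_lincomb:
  assumes V: "openin (mtop M) V" and F: "finite F" and c: "\<And>i. i \<in> F \<Longrightarrow> c i \<in> carrier (hol_ring M V)"
    and b: "\<And>i. i \<in> F \<Longrightarrow> b i \<in> carrier (sections (free_sheaf M J) V)"
  shows "lincomb (sections (free_sheaf M J) V) F c b \<in> carrier (sections (free_sheaf M J) V)"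
    and "j \<in> J \<Longrightarrow> x \<in> V \<Longrightarrow> lincomb (sections (free_sheaf M J) V) F c b j x = (\<Sum>i\<in>F. c i x * b i j x)"
proof -
  interpret G: module "hol_ring M V" "sections (free_sheaf M J) V" by (rule free_module[OF V])
  have tc: "(\<lambda>i. c i \<odot>\<^bsub>sections (free_sheaf M J) V\<^esub> b i) \<in> F \<rightarrow> carrier (sections (free_sheaf M J) V)"
    using c b by (auto intro!: G.smult_closed)
  show "lincomb (sections (free_sheaf M J) V) F c b \<in> carrier (sections (free_sheaf M J) V)"
    unfolding lincomb_def by (rule G.finsum_closed[OF tc])
  show "j \<in> J \<Longrightarrow> x \<in> V \<Longrightarrow> lincomb (sections (free_sheaf M J) V) F c b j x = (\<Sum>i\<in>F. c i x * b i j x)"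
    unfolding lincomb_def by (subst free_finsum_apply[OF V F tc]) auto
qed

text \<open>
  Two families of elements generate \<open>E\<close>: the images of the possibly infinite basis of the free sheaf on
  \<open>J\<close>, with relations given by \<open>\<phi>\<close>, and the finitely many sections \<open>s\<close>. The data \<open>g\<close> and \<open>f\<close> express
  each family by the other over all of \<open>B\<close>. As in Schanuel's lemma, this transfers the relations from
  the first family to the second.
\<close>

locale presented_module = generated_module M B E K s
  for M :: "'a cmanifold" and B and E :: "('a, 'e) mod_data" and K :: "'k set" and s :: "'k \<Rightarrow> 'e" +
  fixes I :: "'i set" and J :: "'j set"
    and \<phi> :: "'a set \<Rightarrow> ('i \<Rightarrow> 'a \<Rightarrow> complex) \<Rightarrow> ('j \<Rightarrow> 'a \<Rightarrow> complex)"
    and e :: "'a set \<Rightarrow> ('j \<Rightarrow> 'a \<Rightarrow> complex) \<Rightarrow> 'e"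
    and g :: "'k \<Rightarrow> 'j \<Rightarrow> 'a \<Rightarrow> complex" and f :: "'j \<Rightarrow> 'k \<Rightarrow> 'a \<Rightarrow> complex"
  assumes \<phi>_hom: "sheaf_hom M B (free_sheaf M I) (free_sheaf M J) \<phi>"
    and epi: "epi_with_kernel M B (free_sheaf M J) E (presheaf_image (free_sheaf M I) \<phi>) e"
    and lift: "k \<in> K \<Longrightarrow> g k \<in> carrier (sections (free_sheaf M J) B)" "k \<in> K \<Longrightarrow> e B (g k) = s k"
    and coord: "j \<in> J \<Longrightarrow> f j \<in> carrier (sections (free_sheaf M K) B)"
      "j \<in> J \<Longrightarrow> e B (basis_section J B j) = comb B (f j)"
begin

abbreviation FI :: "('a, 'i \<Rightarrow> 'a \<Rightarrow> complex) mod_data" where "FI \<equiv> free_sheaf M I"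
abbreviation FJ :: "('a, 'j \<Rightarrow> 'a \<Rightarrow> complex) mod_data" where "FJ \<equiv> free_sheaf M J"

lemma e_hom: "sheaf_hom M B FJ E e"
  using epi by (simp add: epi_with_kernel_def)

text \<open>
  The homomorphism of free sheaves that is given on the basis by \<open>f\<close>. Its composite with \<open>comb\<close> is \<open>e\<close>.
  At each point only finitely many summands are nonzero, because the support of a section is locally
  finite.
\<close>

definition coeff :: "'a set \<Rightarrow> ('j \<Rightarrow> 'a \<Rightarrow> complex) \<Rightarrow> 'k \<Rightarrow> 'a \<Rightarrow> complex" where
  "coeff V h = (\<lambda>k\<in>K. \<lambda>x\<in>V. \<Sum>j\<in>{j\<in>J. h j x \<noteq> 0}. h j x * f j k x)"

lemma coeff_apply:
  assumes "x \<in> V" "k \<in> K" "finite F" "F \<subseteq> J" "\<And>j. j \<in> J - F \<Longrightarrow> h j x = 0"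
  shows "coeff V h k x = (\<Sum>j\<in>F. h j x * f j k x)"
proof -
  have "(\<Sum>j\<in>{j\<in>J. h j x \<noteq> 0}. h j x * f j k x) = (\<Sum>j\<in>F. h j x * f j k x)"
    by (rule sum.mono_neutral_left) (use assms in auto)
  then show ?thesis using assms(1,2) by (simp add: coeff_def)
qed

lemma coeff_closed:
  assumes V: "V \<in> opens M B" and h: "h \<in> carrier (sections FJ V)"
  shows "coeff V h \<in> carrier (sections FK V)"
proof -
  have oV: "openin (mtop M) V" by (rule opens_open[OF V])
  have "coeff V h k \<in> carrier (hol_ring M V)" if k: "k \<in> K" for k
  proof (rule hol_ring_local[OF oV])
    fix p assume p: "p \<in> V"
    obtain W where W: "W \<in> opens M V" "p \<in> W" "finite {j\<in>J. \<exists>x\<in>W. h j x \<noteq> 0}" (is "finite ?F")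
      using free_carrierD(3)[OF oV h p] by blast
    have WB: "W \<in> opens M B" by (rule opens_subset[OF V W(1)])
    have oW: "openin (mtop M) W" and WV: "W \<subseteq> V" using W(1) by (auto simp: opens_def)
    have "(\<lambda>x\<in>W. restrict (h j) W x * restrict (f j k) W x) \<in> carrier (hol_ring M W)" if "j \<in> ?F" for j
    proof -
      from that have j: "j \<in> J" by simp
      show ?thesis
        by (rule hol_ring_mult[OF oW hol_ring_restrict[OF free_carrierD(1)[OF oV h j] W(1)]
              hol_ring_restrict[OF free_carrierD(1)[OF open_B coord(1)[OF j] k] WB]])
    qed
    then have "(\<lambda>x\<in>W. \<Sum>j\<in>?F. (\<lambda>x\<in>W. restrict (h j) W x * restrict (f j k) W x) x) \<in> carrier (hol_ring M W)"
      by (rule hol_ring_sum[OF oW W(3)])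
    also have "(\<lambda>x\<in>W. \<Sum>j\<in>?F. (\<lambda>x\<in>W. restrict (h j) W x * restrict (f j k) W x) x) = restrict (coeff V h k) W"
    proof (rule restrict_ext)
      fix x assume x: "x \<in> W"
      have "coeff V h k x = (\<Sum>j\<in>?F. h j x * f j k x)"
        by (rule coeff_apply) (use x WV k W(3) in auto)
      then show "(\<Sum>j\<in>?F. (\<lambda>x\<in>W. restrict (h j) W x * restrict (f j k) W x) x) = coeff V h k x"
        using x by simp
    qed
    finally show "\<exists>W\<in>opens M V. p \<in> W \<and> restrict (coeff V h k) W \<in> carrier (hol_ring M W)"
      using W by blast
  qed (simp add: coeff_def k)
  then show ?thesis
    unfolding free_carrier_finite[OF oV finite_K] by (auto simp: coeff_def PiE_iff)
qed

text \<open>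
  Over an open set on which \<open>h\<close> has finite support this is linearity; such sets cover \<open>V\<close>, and sections
  of \<open>E\<close> that agree locally are equal.
\<close>

lemma e_eq_comb:
  assumes V: "V \<in> opens M B" and h: "h \<in> carrier (sections FJ V)"
  shows "e V h = comb V (coeff V h)"
proof -
  have oV: "openin (mtop M) V" by (rule opens_open[OF V])
  have eV: "e V h \<in> carrier (sections E V)" using e_hom V h by (auto simp: sheaf_hom_def module_hom_def)
  let ?\<V> = "{W \<in> opens M V. finite {j\<in>J. \<exists>x\<in>W. h j x \<noteq> 0}}"
  show ?thesis
  proof (rule separated[OF V, of ?\<V>])
    show "\<Union>?\<V> = V"
    proof
      show "V \<subseteq> \<Union>?\<V>" using free_carrierD(3)[OF oV h] by blast
    qed (auto simp: opens_def)
    show "comb V (coeff V h) \<in> carrier (sections E V)" by (rule comb_closed[OF V coeff_closed[OF V h]])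
    fix W assume "W \<in> ?\<V>"
    then have W: "W \<in> opens M V" "finite {j\<in>J. \<exists>x\<in>W. h j x \<noteq> 0}" (is "finite ?F") by auto
    have WB: "W \<in> opens M B" by (rule opens_subset[OF V W(1)])
    have oW: "openin (mtop M) W" and WV: "W \<subseteq> V" using W(1) by (auto simp: opens_def)
    let ?h = "restr FJ V W h"
    have hW: "?h \<in> carrier (sections FJ W)" by (rule free_restr_closed[OF oV W(1) h])
    have fW: "restr FK B W (f j) \<in> carrier (sections FK W)" if "j \<in> J" for j
      by (rule free_restr_closed[OF open_B WB coord(1)[OF that]])
    have eb: "e W (basis_section J W j) = comb W (restr FK B W (f j))" if j: "j \<in> J" for j
    proof -
      have "e W (restr FJ B W (basis_section J B j)) = restr E B W (e B (basis_section J B j))"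
        using e_hom B_opens WB basis_section_closed[OF open_B, of J j] by (simp add: sheaf_hom_def)
      then show ?thesis
        using coord[OF j] comb_restr[OF B_opens WB coord(1)[OF j]] WB
        by (simp add: basis_section_restr opens_def)
    qed
    have "restr E V W (e V h) = e W ?h" using e_hom V W(1) h by (simp add: sheaf_hom_def)
    also have "\<dots> = finsum (sections E W) (\<lambda>j. ?h j \<odot>\<^bsub>sections E W\<^esub> e W (basis_section J W j)) ?F"
      by (rule sheaf_hom_free_apply[OF e_hom O_presheaf_axioms WB hW]) (use W(2) in auto)
    also have "\<dots> = lincomb (sections E W) ?F ?h (\<lambda>j. comb W (restr FK B W (f j)))"
    proof -
      interpret W: module "hol_ring M W" "sections E W" by (rule module_sections[OF WB])
      show ?thesis unfolding lincomb_def
        by (rule W.M.finsum_cong'[OF refl])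
          (use eb fW free_carrierD(1)[OF oW hW] comb_closed[OF WB] in \<open>auto intro!: W.smult_closed\<close>)
    qed
    also have "\<dots> = comb W (lincomb (sections FK W) ?F ?h (\<lambda>j. restr FK B W (f j)))"
      by (rule comb_lincomb[OF WB W(2)]) (use fW free_carrierD(1)[OF oW hW] in auto)
    also have "lincomb (sections FK W) ?F ?h (\<lambda>j. restr FK B W (f j)) = restr FK V W (coeff V h)"
    proof (rule free_ext[OF oW])
      show "lincomb (sections FK W) ?F ?h (\<lambda>j. restr FK B W (f j)) \<in> carrier (sections FK W)"
        by (rule free_lincomb(1)[OF oW W(2)]) (use fW free_carrierD(1)[OF oW hW] in auto)
      show "restr FK V W (coeff V h) \<in> carrier (sections FK W)"
        by (rule free_restr_closed[OF oV W(1) coeff_closed[OF V h]])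
      fix k x assume k: "k \<in> K" and x: "x \<in> W"
      have "lincomb (sections FK W) ?F ?h (\<lambda>j. restr FK B W (f j)) k x = (\<Sum>j\<in>?F. ?h j x * restr FK B W (f j) k x)"
        by (rule free_lincomb(2)[OF oW W(2) _ _ k x]) (use fW free_carrierD(1)[OF oW hW] in auto)
      also have "\<dots> = (\<Sum>j\<in>?F. h j x * f j k x)" using k x by (intro sum.cong) auto
      also have "\<dots> = coeff V h k x"
        by (rule coeff_apply[symmetric]) (use x WV k W(2) in auto)
      finally show "lincomb (sections FK W) ?F ?h (\<lambda>j. restr FK B W (f j)) k x = restr FK V W (coeff V h) k x"
        using k x by simp
    qed
    also have "comb W (restr FK V W (coeff V h)) = restr E V W (comb V (coeff V h))"
      by (rule comb_restr[OF V W(1) coeff_closed[OF V h], symmetric])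
    finally show "restr E V W (e V h) = restr E V W (comb V (coeff V h))" .
  qed (use eV in auto)
qed

lemma comb_locally_surj:
  assumes V: "V \<in> opens M B" and t: "t \<in> carrier (sections E V)" and p: "p \<in> V"
  obtains W c where "W \<in> opens M V" "p \<in> W" "c \<in> carrier (sections FK W)" "restr E V W t = comb W c"
proof -
  obtain W h where W: "W \<in> opens M V" "p \<in> W" "h \<in> carrier (sections FJ W)" "e W h = restr E V W t"
    using epi V t p unfolding epi_with_kernel_def by blast
  have WB: "W \<in> opens M B" by (rule opens_subset[OF V W(1)])
  show thesis
    using that[OF W(1,2) coeff_closed[OF WB W(3)]] e_eq_comb[OF WB W(3)] W(4) by simp
qed

definition "relations V = {a \<in> carrier (sections FK V). comb V a = \<zero>\<^bsub>sections E V\<^esub>}"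

text \<open>
  These relations between the generators generate all of them. The first kind comes from the relations
  \<open>\<phi>\<close>, the second compares a generator with what becomes of it when it is rewritten by \<open>g\<close> and then by
  \<open>f\<close>. That they are defined over all of \<open>B\<close> allows information to pass from one point to another.
\<close>

definition "generator_relations = (\<lambda>i. coeff B (\<phi> B (basis_section I B i))) ` I \<union>
  (\<lambda>l. \<lambda>k\<in>K. \<lambda>x\<in>B. basis_section K B l k x - coeff B (g l) k x) ` K"

lemma \<phi>_basis_closed: "\<phi> B (basis_section I B i) \<in> carrier (sections FJ B)"
  using \<phi>_hom B_opens basis_section_closed[OF open_B, of I i] by (auto simp: sheaf_hom_def module_hom_def)

lemma generator_relations_subset: "generator_relations \<subseteq> relations B"
proof
  interpret E: module "hol_ring M B" "sections E B" by (rule module_sections[OF B_opens])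
  interpret G: module "hol_ring M B" "sections FK B" by (rule free_module[OF open_B])
  fix r assume "r \<in> generator_relations"
  then consider i where "i \<in> I" "r = coeff B (\<phi> B (basis_section I B i))"
    | l where "l \<in> K" "r = (\<lambda>k\<in>K. \<lambda>x\<in>B. basis_section K B l k x - coeff B (g l) k x)"
    by (auto simp: generator_relations_def)
  then show "r \<in> relations B"
  proof cases
    case (1 i)
    have "restr FJ B B (\<phi> B (basis_section I B i)) = \<phi> B (basis_section I B i)"
      by (rule O_presheaf.restr_id[OF free_O_presheaf B_opens \<phi>_basis_closed])
    then have "restr FJ B B (\<phi> B (basis_section I B i)) \<in> presheaf_image FI \<phi> B"
      using basis_section_closed[OF open_B, of I i] by (simp add: presheaf_image_def)
    then have "e B (\<phi> B (basis_section I B i)) = \<zero>\<^bsub>sections E B\<^esub>"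
      using epi \<phi>_basis_closed B_opens unfolding epi_with_kernel_def by blast
    then show ?thesis
      using e_eq_comb[OF B_opens \<phi>_basis_closed] coeff_closed[OF B_opens \<phi>_basis_closed] 1
      by (simp add: relations_def)
  next
    case (2 l)
    have cg: "coeff B (g l) \<in> carrier (sections FK B)"
      by (rule coeff_closed[OF B_opens lift(1)[OF 2(1)]])
    have b: "basis_section K B l \<in> carrier (sections FK B)" by (rule basis_section_closed[OF open_B])
    have "r \<in> carrier (sections FK B)"
    proof -
      have "(\<lambda>x\<in>B. -1) \<odot>\<^bsub>sections FK B\<^esub> coeff B (g l) \<in> carrier (sections FK B)"
        by (rule G.smult_closed[OF hol_ring_const[OF open_B] cg])
      then have "basis_section K B l \<oplus>\<^bsub>sections FK B\<^esub> ((\<lambda>x\<in>B. -1) \<odot>\<^bsub>sections FK B\<^esub> coeff B (g l)) \<in> carrier (sections FK B)"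
        using b by simp
      also have "basis_section K B l \<oplus>\<^bsub>sections FK B\<^esub> ((\<lambda>x\<in>B. -1) \<odot>\<^bsub>sections FK B\<^esub> coeff B (g l)) = r"
        unfolding 2 free_sheaf_sel by (intro restrict_ext) simp
      finally show ?thesis .
    qed
    moreover have "r \<oplus>\<^bsub>sections FK B\<^esub> coeff B (g l) = basis_section K B l"
      by (rule free_ext[OF open_B _ b]) (use calculation cg 2 in auto)
    then have "comb B r \<oplus>\<^bsub>sections E B\<^esub> comb B (coeff B (g l)) = comb B (basis_section K B l)"
      using comb_add[OF B_opens calculation cg] by simp
    moreover have "comb B (coeff B (g l)) = s l"
      using e_eq_comb[OF B_opens lift(1)[OF 2(1)]] lift(2)[OF 2(1)] by simp
    moreover have "comb B (basis_section K B l) = s l"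
    proof -
      have "comb B (basis_section K B l) =
          finsum (sections E B) (\<lambda>k. if l = k then s k else \<zero>\<^bsub>sections E B\<^esub>) K"
        unfolding comb_def lincomb_def
      proof (rule E.M.finsum_cong'[OF refl])
        fix k assume k: "k \<in> K"
        have sk: "restr E B B (s k) = s k" by (rule restr_id[OF B_opens gens[OF k]])
        have "basis_section K B l k = (if k = l then \<one>\<^bsub>hol_ring M B\<^esub> else \<zero>\<^bsub>hol_ring M B\<^esub>)"
          using k by (simp add: basis_section_def)
        then show "basis_section K B l k \<odot>\<^bsub>sections E B\<^esub> restr E B B (s k) = (if l = k then s k else \<zero>\<^bsub>sections E B\<^esub>)"
          using sk gens[OF k] E.smult_one[OF gens[OF k]] E.smult_l_null[OF gens[OF k]] by auto
      qed (use gens in auto)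
      also have "\<dots> = s l"
        using E.M.finsum_singleton[OF 2(1) finite_K, of s] gens by auto
      finally show ?thesis .
    qed
    ultimately have "comb B r \<oplus>\<^bsub>sections E B\<^esub> s l = s l" by simp
    then have "comb B r = \<zero>\<^bsub>sections E B\<^esub>"
      using comb_closed[OF B_opens \<open>r \<in> carrier (sections FK B)\<close>] gens[OF 2(1)] by simp
    then show ?thesis using \<open>r \<in> carrier (sections FK B)\<close> by (simp add: relations_def)
  qed
qed

end

section \<open>Relations under a connection\<close>

lemma higher_deriv_sum_mult_eq_0:
  fixes f g :: "'k \<Rightarrow> complex \<Rightarrow> complex"
  assumes S: "open S" "z \<in> S" and "finite K"
    and "\<And>k. k \<in> K \<Longrightarrow> f k holomorphic_on S" "\<And>k. k \<in> K \<Longrightarrow> g k holomorphic_on S"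
    and "\<And>k m. k \<in> K \<Longrightarrow> m \<le> n \<Longrightarrow> (deriv ^^ m) (f k) z = 0"
  shows "(deriv ^^ n) (\<lambda>w. \<Sum>k\<in>K. f k w * g k w) z = 0"
  using assms(3-6)
proof (induction K rule: finite_induct)
  case empty
  then show ?case by simp
next
  case (insert k K)
  have h1: "(\<lambda>w. f k w * g k w) holomorphic_on S" using insert.prems by (intro holomorphic_intros) auto
  have h2: "(\<lambda>w. \<Sum>k\<in>K. f k w * g k w) holomorphic_on S" using insert.prems by (intro holomorphic_intros) auto
  have "(deriv ^^ n) (\<lambda>w. f k w * g k w) z =
      (\<Sum>i=0..n. of_nat (n choose i) * (deriv ^^ i) (f k) z * (deriv ^^ (n-i)) (g k) z)"
    using insert.prems by (intro higher_deriv_mult[OF _ _ S]) auto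
  also have "\<dots> = 0" using insert.prems(3) by (intro sum.neutral) auto
  finally have "(deriv ^^ n) (\<lambda>w. f k w * g k w) z = 0" .
  moreover have "(deriv ^^ n) (\<lambda>w. \<Sum>k\<in>K. f k w * g k w) z = 0" using insert.IH insert.prems by auto
  ultimately show ?case
    using higher_deriv_add[OF h1 h2 S, of n] insert.hyps by simp
qed

context presented_module
begin

lemma relations_restr:
  assumes V: "V \<in> opens M B" and W: "W \<in> opens M V" and a: "a \<in> relations V"
  shows "restr FK V W a \<in> relations W"
proof -
  have aK: "a \<in> carrier (sections FK V)" and "comb V a = \<zero>\<^bsub>sections E V\<^esub>"
    using a by (auto simp: relations_def)
  then have "comb W (restr FK V W a) = \<zero>\<^bsub>sections E W\<^esub>"
    using comb_restr[OF V W aK] restr_zero[OF V W] by simp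
  then show ?thesis
    using free_restr_closed[OF opens_open[OF V] W aK] by (simp add: relations_def)
qed

text \<open>
  A relation \<open>a\<close> on the generators makes \<open>\<Sum>\<^sub>l a\<^sub>l g\<^sub>l\<close> a section of the kernel of \<open>e\<close>, hence near \<open>p\<close> a
  combination of the relations \<open>\<phi>\<close>. Applying \<open>coeff\<close> to both expressions shows that \<open>a\<close> is near \<open>p\<close> a
  combination of the generating relations. Only the values at \<open>p\<close> matter, and they are compared
  directly.
\<close>

lemma relations_value_zero:
  assumes V: "V \<in> opens M B" and a: "a \<in> relations V" and p: "p \<in> V" and k: "k \<in> K"
    and van: "\<And>r k. r \<in> generator_relations \<Longrightarrow> k \<in> K \<Longrightarrow> r k p = 0"
  shows "a k p = 0"
proof -
  have oV: "openin (mtop M) V" by (rule opens_open[OF V])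
  have VB: "V \<subseteq> B" and pB: "p \<in> B" using V p by (auto simp: opens_def)
  have aK: "a \<in> carrier (sections FK V)" and a0: "comb V a = \<zero>\<^bsub>sections E V\<^esub>"
    using a by (auto simp: relations_def)
  note ac = free_carrierD(1)[OF oV aK]
  interpret G: module "hol_ring M V" "sections FJ V" by (rule free_module[OF oV])
  interpret E: module "hol_ring M V" "sections E V" by (rule module_sections[OF V])
  have eV: "e V \<in> module_hom (hol_ring M V) (sections FJ V) (sections E V)"
    using e_hom V by (simp add: sheaf_hom_def)
  let ?g = "\<lambda>l. restr FJ B V (g l)"
  have gV: "?g l \<in> carrier (sections FJ V)" if "l \<in> K" for l
    by (rule free_restr_closed[OF open_B V lift(1)[OF that]])
  have eg: "e V (?g l) = restr E B V (s l)" if l: "l \<in> K" for l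
  proof -
    have "restr E B V (e B (g l)) = e V (?g l)"
      using e_hom B_opens V lift(1)[OF l] by (simp add: sheaf_hom_def)
    then show ?thesis using lift(2)[OF l] by simp
  qed
  define \<gamma> where "\<gamma> = lincomb (sections FJ V) K a ?g"
  have \<gamma>: "\<gamma> \<in> carrier (sections FJ V)"
    unfolding \<gamma>_def by (rule free_lincomb(1)[OF oV finite_K ac gV])
  have "e V \<gamma> = comb V a"
  proof -
    have "e V \<gamma> = finsum (sections E V) (\<lambda>l. e V (a l \<odot>\<^bsub>sections FJ V\<^esub> ?g l)) K"
      unfolding \<gamma>_def lincomb_def
      by (rule module_hom_finsum[OF G.module_axioms E.module_axioms eV finite_K])
        (use ac gV in \<open>auto intro!: G.smult_closed\<close>)
    also have "\<dots> = comb V a"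
      unfolding comb_def lincomb_def
    proof (rule E.M.finsum_cong'[OF refl])
      show "e V (a l \<odot>\<^bsub>sections FJ V\<^esub> ?g l) = a l \<odot>\<^bsub>sections E V\<^esub> restr E B V (s l)" if "l \<in> K" for l
        using eV ac[OF that] gV[OF that] eg[OF that] by (simp add: module_hom_def)
    qed (use ac gens_restr[OF V] in \<open>auto intro!: E.smult_closed\<close>)
    finally show ?thesis .
  qed
  then have "e V \<gamma> = \<zero>\<^bsub>sections E V\<^esub>" using a0 by simp
  then obtain W where W: "W \<in> opens M V" "p \<in> W" "restr FJ V W \<gamma> \<in> presheaf_image FI \<phi> W"
    using epi V \<gamma> p unfolding epi_with_kernel_def by blast
  then obtain b where b: "b \<in> carrier (sections FI W)" "\<phi> W b = restr FJ V W \<gamma>"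
    by (auto simp: presheaf_image_def)
  have oW: "openin (mtop M) W" and WB: "W \<in> opens M B"
    using W(1) opens_subset[OF V W(1)] by (auto simp: opens_def)
  obtain W' where W': "W' \<in> opens M W" "p \<in> W'" "finite {i\<in>I. \<exists>x\<in>W'. b i x \<noteq> 0}" (is "finite ?F")
    using free_carrierD(3)[OF oW b(1) W(2)] by blast
  have oW': "openin (mtop M) W'" and WB': "W' \<in> opens M B"
    using W'(1) opens_subset[OF WB W'(1)] by (auto simp: opens_def)
  interpret G': module "hol_ring M W'" "sections FJ W'" by (rule free_module[OF oW'])
  let ?b = "restr FI W W' b"
  have b': "?b \<in> carrier (sections FI W')" by (rule free_restr_closed[OF oW W'(1) b(1)])
  let ?r = "\<lambda>i. \<phi> B (basis_section I B i)"
  have \<phi>b: "\<phi> W' (basis_section I W' i) = restr FJ B W' (?r i)" for i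
    using \<phi>_hom B_opens WB' basis_section_closed[OF open_B, of I i]
    by (simp add: sheaf_hom_def basis_section_restr opens_def)
  have rW: "restr FJ B W' (?r i) \<in> carrier (sections FJ W')" for i
    by (rule free_restr_closed[OF open_B WB' \<phi>_basis_closed])
  have A: "\<gamma> j p = (\<Sum>i\<in>?F. b i p * ?r i j p)" if j: "j \<in> J" for j
  proof -
    have "restr FJ W W' (\<phi> W b) = \<phi> W' ?b"
      using \<phi>_hom WB W'(1) b(1) by (simp add: sheaf_hom_def)
    also have "\<dots> = finsum (sections FJ W') (\<lambda>i. ?b i \<odot>\<^bsub>sections FJ W'\<^esub> \<phi> W' (basis_section I W' i)) ?F"
      by (rule sheaf_hom_free_apply[OF \<phi>_hom free_O_presheaf WB' b']) (use W'(3) in auto)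
    also have "\<dots> = lincomb (sections FJ W') ?F ?b (\<lambda>i. restr FJ B W' (?r i))"
      by (simp add: lincomb_def \<phi>b)
    finally have eq: "restr FJ W W' (\<phi> W b) = lincomb (sections FJ W') ?F ?b (\<lambda>i. restr FJ B W' (?r i))" .
    have "\<gamma> j p = restr FJ W W' (\<phi> W b) j p" using j W'(2) W(2) b(2) by simp
    also have "\<dots> = lincomb (sections FJ W') ?F ?b (\<lambda>i. restr FJ B W' (?r i)) j p"
      unfolding eq ..
    also have "\<dots> = (\<Sum>i\<in>?F. ?b i p * restr FJ B W' (?r i) j p)"
      by (rule free_lincomb(2)[OF oW' W'(3) _ rW j W'(2)]) (use free_carrierD(1)[OF oW' b'] in auto)
    also have "\<dots> = (\<Sum>i\<in>?F. b i p * ?r i j p)"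
      using j W'(2) by (intro sum.cong) auto
    finally show ?thesis .
  qed
  have C: "\<gamma> j p = (\<Sum>l\<in>K. a l p * g l j p)" if j: "j \<in> J" for j
    using free_lincomb(2)[OF oV finite_K ac gV j p] j p by (simp add: \<gamma>_def)
  \<comment> \<open>A finite set of basis indices outside which everything in sight vanishes at \<open>p\<close>. The sum
      \<open>\<Sum>j\<in>D. \<gamma> j p * f j k p\<close> is the value at \<open>p\<close> of \<open>coeff\<close> of \<open>\<gamma>\<close>; it is computed from \<open>C\<close> and
      from \<open>A\<close>.\<close>
  define D where "D = (\<Union>l\<in>K. {j\<in>J. g l j p \<noteq> 0}) \<union> (\<Union>i\<in>?F. {j\<in>J. ?r i j p \<noteq> 0})"
  have D: "finite D" "D \<subseteq> J"
    unfolding D_def using finite_K W'(3) free_carrierD(4)[OF open_B lift(1) pB] free_carrierD(4)[OF open_B \<phi>_basis_closed pB]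
    by auto
  have cg: "coeff B (g l) k p = (\<Sum>j\<in>D. g l j p * f j k p)" if "l \<in> K" for l
    by (rule coeff_apply[OF pB k D]) (use that in \<open>auto simp: D_def\<close>)
  have cr: "coeff B (?r i) k p = (\<Sum>j\<in>D. ?r i j p * f j k p)" if "i \<in> ?F" for i
    by (rule coeff_apply[OF pB k D]) (use that in \<open>auto simp: D_def\<close>)
  have "(\<Sum>j\<in>D. \<gamma> j p * f j k p) = (\<Sum>j\<in>D. \<Sum>l\<in>K. a l p * (g l j p * f j k p))"
    using D(2) by (intro sum.cong) (auto simp: C sum_distrib_right mult.assoc)
  also have "\<dots> = (\<Sum>l\<in>K. a l p * (\<Sum>j\<in>D. g l j p * f j k p))"
    by (subst sum.swap) (simp add: sum_distrib_left)
  also have "\<dots> = (\<Sum>l\<in>K. a l p * (if k = l then 1 else 0))"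
  proof (rule sum.cong[OF refl])
    fix l assume l: "l \<in> K"
    have "(\<lambda>k\<in>K. \<lambda>x\<in>B. basis_section K B l k x - coeff B (g l) k x) \<in> generator_relations"
      using l by (auto simp: generator_relations_def)
    from van[OF this k] have "coeff B (g l) k p = (if k = l then 1 else 0)" using k pB by simp
    then show "a l p * (\<Sum>j\<in>D. g l j p * f j k p) = a l p * (if k = l then 1 else 0)"
      using cg[OF l] by simp
  qed
  also have "\<dots> = a k p" using k finite_K by (simp add: if_distrib cong: if_cong)
  finally have 1: "(\<Sum>j\<in>D. \<gamma> j p * f j k p) = a k p" .
  have "(\<Sum>j\<in>D. \<gamma> j p * f j k p) = (\<Sum>j\<in>D. \<Sum>i\<in>?F. b i p * (?r i j p * f j k p))"
    using D(2) by (intro sum.cong) (auto simp: A sum_distrib_right mult.assoc)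
  also have "\<dots> = (\<Sum>i\<in>?F. b i p * (\<Sum>j\<in>D. ?r i j p * f j k p))"
    by (subst sum.swap) (simp add: sum_distrib_left)
  also have "\<dots> = 0"
  proof (rule sum.neutral, rule ballI)
    fix i assume i: "i \<in> ?F"
    then have "coeff B (?r i) \<in> generator_relations" by (auto simp: generator_relations_def)
    from van[OF this k] show "b i p * (\<Sum>j\<in>D. ?r i j p * f j k p) = 0" using cr[OF i] by simp
  qed
  finally show ?thesis using 1 by simp
qed

text \<open>
  Applying the connection to a relation \<open>\<Sum>\<^sub>k a\<^sub>k s\<^sub>k = 0\<close> gives \<open>\<Sum>\<^sub>k v(a\<^sub>k) s\<^sub>k + a\<^sub>k \<nabla>\<^sub>v s\<^sub>k = 0\<close>. Near \<open>p\<close> the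
  sections \<open>\<nabla>\<^sub>v s\<^sub>k\<close> are combinations of the generators, with coefficients \<open>\<gamma> k\<close> (the connection matrix), so this
  is again a relation on the generators. The generators exist on \<open>B\<close>, but the connection matrix only
  on a smaller neighbourhood of \<open>p\<close>.
\<close>

lemma relation_derivative:
  assumes conn: "connection M E nabla" and v: "v \<in> carrier (sections (Theta M) B)"
    and V: "V \<in> opens M B" and a: "a \<in> relations V" and p: "p \<in> V"
  obtains V' \<gamma> b where "V' \<in> opens M V" "p \<in> V'" "\<And>k. k \<in> K \<Longrightarrow> \<gamma> k \<in> carrier (sections FK V')"
    "b \<in> relations V'"
    "\<And>l x. l \<in> K \<Longrightarrow> x \<in> V' \<Longrightarrow> b l x = v x (restrict (a l) V') + (\<Sum>k\<in>K. a k x * \<gamma> k l x)"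
proof -
  interpret connection M E nabla by (rule conn)
  have pB: "p \<in> B" using V p by (auto simp: opens_def)
  have "\<exists>W c. W \<in> opens M B \<and> p \<in> W \<and> c \<in> carrier (sections FK W) \<and> restr E B W (nabla B v (s k)) = comb W c"
    if "k \<in> K" for k
    using comb_locally_surj[OF B_opens nabla_closed[OF open_B v gens[OF that]] pB] by metis
  then obtain W c where Wc: "\<And>k. k \<in> K \<Longrightarrow> W k \<in> opens M B \<and> p \<in> W k \<and> c k \<in> carrier (sections FK (W k)) \<and>
      restr E B (W k) (nabla B v (s k)) = comb (W k) (c k)"
    by metis
  define V' where "V' = \<Inter>(insert V (W ` K))"
  have oV': "openin (mtop M) V'"
    unfolding V'_def using finite_K Wc opens_open V by (intro openin_Inter) auto
  have V'V: "V' \<in> opens M V" and V'W: "\<And>k. k \<in> K \<Longrightarrow> V' \<in> opens M (W k)"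
    using oV' by (auto simp: opens_def V'_def)
  have V'B: "V' \<in> opens M B" by (rule opens_subset[OF V V'V])
  have pV': "p \<in> V'" using p Wc by (auto simp: V'_def)
  define \<gamma> where "\<gamma> k = restr FK (W k) V' (c k)" for k
  have \<gamma>: "\<gamma> k \<in> carrier (sections FK V')" if "k \<in> K" for k
    unfolding \<gamma>_def using Wc[OF that] V'W[OF that] opens_open by (intro free_restr_closed) auto
  let ?s = "\<lambda>k. restr E B V' (s k)"
  define v' where "v' = restrict v V'"
  have v': "v' \<in> carrier (sections (Theta M) V')"
  proof -
    have "(\<lambda>p\<in>N. v' p h) \<in> carrier (hol_ring M N)" if "N \<in> opens M V'" "h \<in> carrier (hol_ring M N)" for N h
    proof -
      have N: "N \<in> opens M B" by (rule opens_subset[OF V'B that(1)])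
      have "(\<lambda>p\<in>N. v' p h) = (\<lambda>p\<in>N. v p h)"
        unfolding v'_def by (rule restrict_ext) (use that(1) in \<open>auto simp: opens_def\<close>)
      moreover have "(\<lambda>p\<in>N. v p h) \<in> carrier (hol_ring M N)"
        using v N that(2) by (simp add: Theta_def)
      ultimately show ?thesis by simp
    qed
    moreover have "v' \<in> (\<Pi>\<^sub>E p\<in>V'. tangent_space M p)"
      using v V'B by (auto simp: Theta_def v'_def opens_def PiE_iff)
    ultimately show ?thesis by (simp add: Theta_def)
  qed
  interpret E: module "hol_ring M V'" "sections E V'" by (rule module_sections[OF V'B])
  interpret G: module "hol_ring M V'" "sections FK V'" by (rule free_module[OF oV'])
  note sV = gens_restr[OF V'B]
  have ns: "nabla V' v' (?s k) = comb V' (\<gamma> k)" if k: "k \<in> K" for k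
  proof -
    have "nabla V' v' (?s k) = restr E B V' (nabla B v (s k))"
      using nabla_restr[OF open_B V'B v gens[OF k]] by (simp add: Theta_def v'_def)
    also have "\<dots> = restr E (W k) V' (restr E B (W k) (nabla B v (s k)))"
      using restr_restr[OF B_opens _ V'W[OF k] nabla_closed[OF open_B v gens[OF k]]] Wc[OF k] by simp
    also have "\<dots> = comb V' (\<gamma> k)"
      using comb_restr[OF _ V'W[OF k]] Wc[OF k] by (simp add: \<gamma>_def)
    finally show ?thesis .
  qed
  define a' where "a' = restr FK V V' a"
  have "a' \<in> relations V'" unfolding a'_def by (rule relations_restr[OF V V'V a])
  then have a': "a' \<in> carrier (sections FK V')" "comb V' a' = \<zero>\<^bsub>sections E V'\<^esub>"
    by (auto simp: relations_def)
  note ac = free_carrierD(1)[OF oV' a'(1)]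
  define va where "va = (\<lambda>k\<in>K. \<lambda>x\<in>V'. v' x (a' k))"
  have vac: "(\<lambda>x\<in>V'. v' x (a' k)) \<in> carrier (hol_ring M V')" if "k \<in> K" for k
    using v' ac[OF that] opens_self[OF V'B] by (simp add: Theta_def)
  have va: "va \<in> carrier (sections FK V')"
    unfolding free_carrier_finite[OF oV' finite_K] using vac by (auto simp: va_def)
  have \<gamma>a: "lincomb (sections FK V') K a' \<gamma> \<in> carrier (sections FK V')"
    by (rule free_lincomb(1)[OF oV' finite_K ac \<gamma>])
  define b where "b = va \<oplus>\<^bsub>sections FK V'\<^esub> lincomb (sections FK V') K a' \<gamma>"
  have nadd: "nabla V' v' (t \<oplus>\<^bsub>sections E V'\<^esub> u) = nabla V' v' t \<oplus>\<^bsub>sections E V'\<^esub> nabla V' v' u"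
    if "t \<in> carrier (sections E V')" "u \<in> carrier (sections E V')" for t u
    by (rule nabla_add_right[OF oV' v' that])
  have tc: "(\<lambda>k. a' k \<odot>\<^bsub>sections E V'\<^esub> ?s k) \<in> K \<rightarrow> carrier (sections E V')"
    using ac sV by (auto intro!: E.smult_closed)
  have vtc: "(\<lambda>k. va k \<odot>\<^bsub>sections E V'\<^esub> ?s k) \<in> K \<rightarrow> carrier (sections E V')"
    using vac sV by (auto simp: va_def intro!: E.smult_closed)
  have ctc: "(\<lambda>k. a' k \<odot>\<^bsub>sections E V'\<^esub> comb V' (\<gamma> k)) \<in> K \<rightarrow> carrier (sections E V')"
    using ac comb_closed[OF V'B \<gamma>] by (auto intro!: E.smult_closed)
  have "comb V' b = comb V' va \<oplus>\<^bsub>sections E V'\<^esub> lincomb (sections E V') K a' (\<lambda>k. comb V' (\<gamma> k))"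
    using comb_add[OF V'B va \<gamma>a] comb_lincomb[where c = a' and b = \<gamma>, OF V'B finite_K ac \<gamma>] by (simp add: b_def)
  also have "\<dots> = finsum (sections E V') (\<lambda>k. va k \<odot>\<^bsub>sections E V'\<^esub> ?s k \<oplus>\<^bsub>sections E V'\<^esub>
      a' k \<odot>\<^bsub>sections E V'\<^esub> comb V' (\<gamma> k)) K"
    unfolding comb_def[of V' va] lincomb_def by (rule E.finsum_addf[OF vtc ctc, symmetric])
  also have "\<dots> = finsum (sections E V') (\<lambda>k. nabla V' v' (a' k \<odot>\<^bsub>sections E V'\<^esub> ?s k)) K"
  proof (rule E.M.finsum_cong'[OF refl])
    show "(\<lambda>k. nabla V' v' (a' k \<odot>\<^bsub>sections E V'\<^esub> ?s k)) \<in> K \<rightarrow> carrier (sections E V')"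
      using tc by (auto intro!: nabla_closed[OF oV' v'])
    show "va k \<odot>\<^bsub>sections E V'\<^esub> ?s k \<oplus>\<^bsub>sections E V'\<^esub> a' k \<odot>\<^bsub>sections E V'\<^esub> comb V' (\<gamma> k) =
        nabla V' v' (a' k \<odot>\<^bsub>sections E V'\<^esub> ?s k)" if k: "k \<in> K" for k
      using nabla_Leibniz[OF oV' ac[OF k] v' sV[OF k]] ns[OF k] k by (simp add: va_def)
  qed
  also have "\<dots> = nabla V' v' (comb V' a')"
    unfolding comb_def lincomb_def
    by (rule additive_map_finsum[OF E.abelian_group_axioms E.abelian_group_axioms
        nabla_closed[OF oV' v'] nadd finite_K tc, symmetric])
  also have "\<dots> = \<zero>\<^bsub>sections E V'\<^esub>"
    \<comment> \<open>An additive map sends the empty sum to the empty sum.\<close>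
    using additive_map_finsum[OF E.abelian_group_axioms E.abelian_group_axioms
        nabla_closed[OF oV' v'] nadd, of "{}" "\<lambda>_. undefined"] a'(2) by simp
  finally have "b \<in> relations V'"
    using va \<gamma>a by (simp add: relations_def b_def)
  moreover have "b l x = v x (restrict (a l) V') + (\<Sum>k\<in>K. a k x * \<gamma> k l x)" if l: "l \<in> K" and x: "x \<in> V'" for l x
  proof -
    have "a' k x = a k x" if "k \<in> K" for k using that x by (simp add: a'_def)
    moreover have "a' l = restrict (a l) V'" using l by (simp add: a'_def free_sheaf_sel)
    ultimately show ?thesis
      using l x free_lincomb(2)[OF oV' finite_K ac \<gamma> l x] by (simp add: b_def va_def v'_def)
  qed
  ultimately show thesis using that V'V pV' \<gamma> by blast
qed

text \<open>
  Every relation near \<open>p\<close> vanishes at \<open>p\<close>. By the preceding lemma the derivative of a relation \<open>a\<close> along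
  a coordinate line differs from a relation by a combination of the components of \<open>a\<close>, so one more
  derivative vanishes at each step. The induction is over all smaller orders because of the product
  rule, and over all relations on all neighbourhoods because both change in a step.
\<close>

lemma relation_line_derivatives:
  assumes conn: "connection M E nabla" and c: "(n, X, \<xi>) \<in> charts M" and BX: "B \<subseteq> X" and i: "i < n"
    and van: "\<And>r k. r \<in> generator_relations \<Longrightarrow> k \<in> K \<Longrightarrow> r k p = 0"
  shows "V \<in> opens M B \<Longrightarrow> a \<in> relations V \<Longrightarrow> p \<in> V \<Longrightarrow> k \<in> K \<Longrightarrow>
    (deriv ^^ N) (\<lambda>w. a k (coord_line X \<xi> i p w)) (\<xi> p i) = 0"
proof (induction N arbitrary: V a k rule: less_induct)
  case (less N)
  note V = less.prems(1) and a = less.prems(2) and p = less.prems(3) and k = less.prems(4)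
  have pX: "p \<in> X" using V p BX by (auto simp: opens_def)
  show ?case
  proof (cases N)
    case 0
    have "a k p = 0" by (rule relations_value_zero[OF V a p k]) (rule van)
    then show ?thesis using 0 coord_line_self[OF c pX] by simp
  next
    case (Suc m)
    let ?v = "coord_field i X \<xi> B"
    have v: "?v \<in> carrier (sections (Theta M) B)" by (rule coord_field_Theta[OF c i open_B BX])
    obtain V' \<gamma> b where V': "V' \<in> opens M V" "p \<in> V'" "\<And>k. k \<in> K \<Longrightarrow> \<gamma> k \<in> carrier (sections FK V')"
      "b \<in> relations V'"
      "\<And>l x. l \<in> K \<Longrightarrow> x \<in> V' \<Longrightarrow> b l x = ?v x (restrict (a l) V') + (\<Sum>k\<in>K. a k x * \<gamma> k l x)"
      using relation_derivative[OF conn v V a p] by blast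
    have V'B: "V' \<in> opens M B" by (rule opens_subset[OF V V'(1)])
    have oV': "openin (mtop M) V'" and V'X: "V' \<subseteq> X" and V'B': "V' \<subseteq> B"
      using V'B BX by (auto simp: opens_def)
    define S where "S = {w. (\<xi> p)(i := w) \<in> \<xi> ` V'}"
    have S: "open S" "\<xi> p i \<in> S"
      unfolding S_def using coord_line_open[OF c i oV' V'X pX] V'(2) by auto
    define L where "L h = (\<lambda>w. h (coord_line X \<xi> i p w))" for h :: "'a \<Rightarrow> complex"
    have hol: "L h holomorphic_on S" if "h \<in> carrier (hol_ring M V')" for h
      unfolding L_def S_def by (rule coord_line_holomorphic[OF c i V'X that])
    define a' where "a' = restr FK V V' a"
    have a'r: "a' \<in> relations V'" unfolding a'_def by (rule relations_restr[OF V V'(1) a])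
    then have "a' \<in> carrier (sections FK V')" by (simp add: relations_def)
    note a'c = free_carrierD(1)[OF oV' this]
    have "b \<in> carrier (sections FK V')" using V'(4) by (simp add: relations_def)
    note bc = free_carrierD(1)[OF oV' this]
    note \<gamma>c = free_carrierD(1)[OF oV' V'(3) k]
    have a'_eq: "a' l = restrict (a l) V'" if "l \<in> K" for l
      using that by (simp add: a'_def free_sheaf_sel)
    have mem: "coord_line X \<xi> i p w \<in> V'" if "w \<in> S" for w
      using coord_line_mem(1)[OF c V'X] that by (simp add: S_def)
    have La: "L (a k) w = L (a' k) w" if "w \<in> S" for w
      using mem[OF that] a'_eq[OF k] by (simp add: L_def)
    \<comment> \<open>Along the coordinate line the components of \<open>a\<close> satisfy a linear differential equation whose
      inhomogeneous term is a relation.\<close>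
    have ode: "deriv (L (a' k)) w = L (b k) w - (\<Sum>l\<in>K. L (a' l) w * L (\<gamma> l k) w)" if w: "w \<in> S" for w
    proof -
      let ?q = "coord_line X \<xi> i p w"
      have "?v ?q (a' k) = deriv (L (a' k)) w"
        unfolding L_def by (rule coord_field_line[OF c i oV' V'X V'B' a'c[OF k]]) (use w in \<open>simp add: S_def\<close>)
      moreover have "b k ?q = ?v ?q (a' k) + (\<Sum>l\<in>K. a l ?q * \<gamma> l k ?q)"
        using V'(5)[OF k mem[OF w]] a'_eq[OF k] by simp
      moreover have "(\<Sum>l\<in>K. a l ?q * \<gamma> l k ?q) = (\<Sum>l\<in>K. a' l ?q * \<gamma> l k ?q)"
        using mem[OF w] a'_eq by (intro sum.cong) auto
      ultimately show ?thesis by (simp add: L_def)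
    qed
    have h1: "L (b k) holomorphic_on S" by (rule hol[OF bc[OF k]])
    have h2: "(\<lambda>w. \<Sum>l\<in>K. L (a' l) w * L (\<gamma> l k) w) holomorphic_on S"
      by (intro holomorphic_intros hol a'c \<gamma>c)
    have La_hol: "L (a k) holomorphic_on S"
      using hol[OF a'c[OF k]] by (rule holomorphic_transform) (simp add: La)
    have "(deriv ^^ N) (L (a k)) (\<xi> p i) = (deriv ^^ N) (L (a' k)) (\<xi> p i)"
      by (rule higher_deriv_transform_within_open[OF La_hol hol[OF a'c[OF k]] S La])
    also have "\<dots> = (deriv ^^ m) (deriv (L (a' k))) (\<xi> p i)"
      unfolding Suc by (simp add: funpow_swap1 del: funpow.simps add: funpow_Suc_right)
    also have "\<dots> = (deriv ^^ m) (\<lambda>w. L (b k) w - (\<Sum>l\<in>K. L (a' l) w * L (\<gamma> l k) w)) (\<xi> p i)"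
      by (rule higher_deriv_transform_within_open[OF holomorphic_deriv[OF hol[OF a'c[OF k]] S(1)]
            holomorphic_on_diff[OF h1 h2] S ode])
    also have "\<dots> = (deriv ^^ m) (L (b k)) (\<xi> p i) - (deriv ^^ m) (\<lambda>w. \<Sum>l\<in>K. L (a' l) w * L (\<gamma> l k) w) (\<xi> p i)"
      by (rule higher_deriv_diff[OF h1 h2 S])
    also have "(deriv ^^ m) (L (b k)) (\<xi> p i) = 0"
      unfolding L_def by (rule less.IH[OF _ V'B V'(4,2) k]) (simp add: Suc)
    also have "(deriv ^^ m) (\<lambda>w. \<Sum>l\<in>K. L (a' l) w * L (\<gamma> l k) w) (\<xi> p i) = 0"
    proof (rule higher_deriv_sum_mult_eq_0[OF S finite_K])
      show "(deriv ^^ m') (L (a' l)) (\<xi> p i) = 0" if "l \<in> K" "m' \<le> m" for l m'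
        unfolding L_def by (rule less.IH[OF _ V'B a'r V'(2) that(1)]) (use Suc that(2) in simp)
    qed (auto intro: hol a'c \<gamma>c)
    finally show ?thesis by (simp add: L_def)
  qed
qed

text \<open>
  Call a point good if the generating relations vanish there. Along a coordinate line through a good
  point the generating relations have vanishing derivatives of all orders at this point, hence vanish
  on the whole line within the box, so that all points of the line are good. Changing one coordinate after
  the other leads from \<open>x\<close> to every point of the box. Only derivatives in a single variable occur.
\<close>

lemma generator_relations_vanish_on_box:
  assumes conn: "connection M E nabla" and box: "chart_box n X \<xi> x \<epsilon> B"
    and van: "\<And>r k. r \<in> generator_relations \<Longrightarrow> k \<in> K \<Longrightarrow> r k x = 0"
    and r: "r \<in> generator_relations" and k: "k \<in> K" and y: "y \<in> B"
  shows "r k y = 0"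
proof -
  have c: "(n, X, \<xi>) \<in> charts M" and BX: "B \<subseteq> X" and xB: "x \<in> B"
    and im: "\<xi> ` B = {z. (\<forall>i<n. z i \<in> ball (\<xi> x i) \<epsilon>) \<and> (\<forall>i\<ge>n. z i = 0)}"
    using box by (auto simp: chart_box_def)
  define Z where "Z = {p \<in> B. \<forall>r\<in>generator_relations. \<forall>k\<in>K. r k p = 0}"
  have in_im: "\<xi> q \<in> {z. (\<forall>i<n. z i \<in> ball (\<xi> x i) \<epsilon>) \<and> (\<forall>i\<ge>n. z i = 0)}" if "q \<in> B" for q
    using that im by blast
  have step: "coord_line X \<xi> i p w \<in> Z" if p: "p \<in> Z" and i: "i < n" and w: "(\<xi> p)(i := w) \<in> \<xi> ` B" for p i w
  proof -
    have pB: "p \<in> B" and pvan: "\<And>r k. r \<in> generator_relations \<Longrightarrow> k \<in> K \<Longrightarrow> r k p = 0"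
      using p by (auto simp: Z_def)
    define S where "S = {w. (\<xi> p)(i := w) \<in> \<xi> ` B}"
    have Sball: "S = ball (\<xi> x i) \<epsilon>"
      unfolding S_def im using in_im[OF pB] i by (auto split: if_splits)
    have S: "open S" "connected S" by (simp_all add: Sball)
    have pS: "\<xi> p i \<in> S" using pB by (simp add: S_def)
    have wS: "w \<in> S" using w by (simp add: S_def)
    have "r k (coord_line X \<xi> i p w) = 0" if r: "r \<in> generator_relations" and k: "k \<in> K" for r k
    proof -
      have rB: "r \<in> relations B" using generator_relations_subset r by blast
      then have rc: "r k \<in> carrier (hol_ring M B)"
        using free_carrierD(1)[OF open_B _ k] by (simp add: relations_def)
      have "(\<lambda>w. r k (coord_line X \<xi> i p w)) holomorphic_on S"
        unfolding S_def by (rule coord_line_holomorphic[OF c i BX rc])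
      then show ?thesis
      proof (rule holomorphic_fun_eq_0_on_connected[OF _ S _ pS wS])
        show "(deriv ^^ N) (\<lambda>w. r k (coord_line X \<xi> i p w)) (\<xi> p i) = 0" for N
          by (rule relation_line_derivatives[OF conn c BX i _ B_opens rB pB k]) (rule pvan)
      qed
    qed
    moreover have "coord_line X \<xi> i p w \<in> B" by (rule coord_line_mem(1)[OF c BX w])
    ultimately show ?thesis by (simp add: Z_def)
  qed
  have "\<exists>q\<in>Z. \<xi> q = (\<lambda>j. if j < m then \<xi> y j else \<xi> x j)" if "m \<le> n" for m
    using that
  proof (induction m)
    case 0
    have "x \<in> Z" using xB van by (simp add: Z_def)
    then show ?case by auto
  next
    case (Suc m)
    then obtain q where q: "q \<in> Z" "\<xi> q = (\<lambda>j. if j < m then \<xi> y j else \<xi> x j)" by auto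
    have m: "m < n" using Suc by simp
    have upd: "(\<xi> q)(m := \<xi> y m) = (\<lambda>j. if j < Suc m then \<xi> y j else \<xi> x j)"
      by (auto simp: q(2) less_Suc_eq)
    have "(\<lambda>j. if j < Suc m then \<xi> y j else \<xi> x j) \<in> \<xi> ` B"
      unfolding im using in_im[OF y] in_im[OF xB] m by auto
    then have w: "(\<xi> q)(m := \<xi> y m) \<in> \<xi> ` B" using upd by simp
    show ?case
      using step[OF q(1) m w] coord_line_mem(2)[OF c BX w] upd by (intro bexI[of _ "coord_line X \<xi> m q (\<xi> y m)"]) simp
  qed
  from this[of n] obtain q where q: "q \<in> Z" "\<xi> q = (\<lambda>j. if j < n then \<xi> y j else \<xi> x j)" by auto
  have "\<xi> q j = \<xi> y j" for j unfolding q(2) using in_im[OF y] in_im[OF xB] by (cases "j < n") auto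
  then have "\<xi> q = \<xi> y" by (rule ext)
  then have "q = y" using q(1) y BX inj_onD[OF chart_inj[OF c], of q y] by (auto simp: Z_def)
  then show ?thesis using q(1) r k by (simp add: Z_def)
qed

text \<open>
  There are no relations, so coefficients with respect to the generators are unique. Locally they exist;
  by uniqueness they agree on overlaps, hence glue.
\<close>

lemma isomorphic_free:
  assumes van: "\<And>r k p. r \<in> generator_relations \<Longrightarrow> k \<in> K \<Longrightarrow> p \<in> B \<Longrightarrow> r k p = 0"
  shows "sheaf_isomorphic M B E FK"
proof -
  have comb_inj: "a = b" if V: "V \<in> opens M B" and a: "a \<in> carrier (sections FK V)"
    and b: "b \<in> carrier (sections FK V)" and eq: "comb V a = comb V b" for V a b
  proof -
    have oV: "openin (mtop M) V" by (rule opens_open[OF V])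
    interpret E: module "hol_ring M V" "sections E V" by (rule module_sections[OF V])
    interpret G: module "hol_ring M V" "sections FK V" by (rule free_module[OF oV])
    define m where "m = (\<lambda>x\<in>V. - 1 :: complex)"
    have m: "m \<in> carrier (hol_ring M V)" unfolding m_def by (rule hol_ring_const[OF oV])
    have mb: "m \<odot>\<^bsub>sections FK V\<^esub> b \<in> carrier (sections FK V)" by (rule G.smult_closed[OF m b])
    let ?d = "a \<oplus>\<^bsub>sections FK V\<^esub> m \<odot>\<^bsub>sections FK V\<^esub> b"
    have cb: "comb V b \<in> carrier (sections E V)" by (rule comb_closed[OF V b])
    have "comb V ?d = \<one>\<^bsub>hol_ring M V\<^esub> \<odot>\<^bsub>sections E V\<^esub> comb V b \<oplus>\<^bsub>sections E V\<^esub> m \<odot>\<^bsub>sections E V\<^esub> comb V b"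
      using comb_add[OF V a mb] comb_smult[OF V b m] eq E.smult_one[OF cb] by simp
    also have "\<dots> = (\<one>\<^bsub>hol_ring M V\<^esub> \<oplus>\<^bsub>hol_ring M V\<^esub> m) \<odot>\<^bsub>sections E V\<^esub> comb V b"
      by (rule E.smult_l_distr[OF E.R.one_closed m cb, symmetric])
    also have "\<one>\<^bsub>hol_ring M V\<^esub> \<oplus>\<^bsub>hol_ring M V\<^esub> m = \<zero>\<^bsub>hol_ring M V\<^esub>"
      by (auto simp: m_def intro: restrict_ext)
    also have "\<zero>\<^bsub>hol_ring M V\<^esub> \<odot>\<^bsub>sections E V\<^esub> comb V b = \<zero>\<^bsub>sections E V\<^esub>"
      by (rule E.smult_l_null[OF cb])
    finally have d: "?d \<in> relations V" using a mb by (simp add: relations_def)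
    show ?thesis
    proof (rule free_ext[OF oV a b])
      fix k x assume k: "k \<in> K" and x: "x \<in> V"
      have "x \<in> B" using V x by (auto simp: opens_def)
      then have "?d k x = 0" by (intro relations_value_zero[OF V d x k] van)
      then show "a k x = b k x" using k x by (simp add: m_def)
    qed
  qed
  have comb_surj: "\<exists>a\<in>carrier (sections FK V). comb V a = t"
    if V: "V \<in> opens M B" and t: "t \<in> carrier (sections E V)" for V t
  proof -
    have oV: "openin (mtop M) V" by (rule opens_open[OF V])
    have "\<exists>W c. W \<in> opens M V \<and> p \<in> W \<and> c \<in> carrier (sections FK W) \<and> restr E V W t = comb W c" if "p \<in> V" for p
      using comb_locally_surj[OF V t that] by metis
    then obtain W c where Wc: "\<And>p. p \<in> V \<Longrightarrow> W p \<in> opens M V \<and> p \<in> W p \<and> c p \<in> carrier (sections FK (W p)) \<and>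
        restr E V (W p) t = comb (W p) (c p)"
      by metis
    \<comment> \<open>The value at \<open>x\<close> is taken from the coefficients chosen near \<open>x\<close>; near \<open>p\<close> these have the
      same values as the coefficients chosen near \<open>p\<close>.\<close>
    define a where "a = (\<lambda>k\<in>K. \<lambda>x\<in>V. c x k x)"
    have agree: "c x k x = c p k x" if p: "p \<in> V" and x: "x \<in> W p" and k: "k \<in> K" for p x k
    proof -
      have xV: "x \<in> V" using Wc[OF p] x by (auto simp: opens_def)
      note Wp = Wc[OF p] and Wx = Wc[OF xV]
      let ?N = "W p \<inter> W x"
      have N: "?N \<in> opens M (W p)" "?N \<in> opens M (W x)" "?N \<in> opens M B"
        and WpB: "W p \<in> opens M B" and WxB: "W x \<in> opens M B"
        using Wp Wx V by (auto simp: opens_def)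
      have "comb ?N (restr FK (W p) ?N (c p)) = restr E V ?N t"
        using comb_restr[OF WpB N(1)] Wp restr_restr[OF V _ N(1) t] by metis
      moreover have "comb ?N (restr FK (W x) ?N (c x)) = restr E V ?N t"
        using comb_restr[OF WxB N(2)] Wx restr_restr[OF V _ N(2) t] by metis
      ultimately have "restr FK (W p) ?N (c p) = restr FK (W x) ?N (c x)"
        using Wp Wx opens_open[OF WpB] opens_open[OF WxB] N
        by (intro comb_inj[OF N(3)] free_restr_closed) auto
      then have "restr FK (W p) ?N (c p) k x = restr FK (W x) ?N (c x) k x" by simp
      then show ?thesis using k x Wx by simp
    qed
    have aW: "restr FK V (W p) a = c p" if p: "p \<in> V" for p
    proof (rule extensionalityI[of _ K])
      note Wp = Wc[OF p]
      have oW: "openin (mtop M) (W p)" and WV: "W p \<subseteq> V" using Wp by (auto simp: opens_def)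
      show "c p \<in> extensional K" using free_carrierD(2)[OF oW] Wp by blast
      fix k assume k: "k \<in> K"
      have "restrict (a k) (W p) = restrict (c p k) (W p)"
        by (rule restrict_ext) (use agree[OF p _ k] k WV in \<open>auto simp: a_def\<close>)
      also have "\<dots> = c p k" using hol_ring_restrict_id free_carrierD(1)[OF oW _ k] Wp by blast
      finally show "restr FK V (W p) a k = c p k" using k by (simp add: free_sheaf_sel)
    qed (simp add: free_sheaf_sel)
    have a: "a \<in> carrier (sections FK V)"
      unfolding free_carrier_finite[OF oV finite_K]
    proof (rule PiE_I)
      fix k assume k: "k \<in> K"
      show "a k \<in> carrier (hol_ring M V)"
      proof (rule hol_ring_local[OF oV])
        fix p assume p: "p \<in> V"
        have "restrict (a k) (W p) = c p k" using fun_cong[OF aW[OF p], of k] k by (simp add: free_sheaf_sel)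
        then show "\<exists>N\<in>opens M V. p \<in> N \<and> restrict (a k) N \<in> carrier (hol_ring M N)"
          using Wc[OF p] free_carrierD(1)[OF _ _ k] by (intro bexI[of _ "W p"]) (auto simp: opens_def)
      qed (simp add: a_def k)
    qed (simp add: a_def)
    have "comb V a = t"
    proof (rule separated[OF V, of "W ` V"])
      show "W ` V \<subseteq> opens M V" using Wc by blast
      show "\<Union>(W ` V) = V"
      proof
        show "V \<subseteq> \<Union>(W ` V)" using Wc by blast
        show "\<Union>(W ` V) \<subseteq> V"
        proof
          fix x assume "x \<in> \<Union>(W ` V)"
          then obtain p where "p \<in> V" "x \<in> W p" by blast
          then show "x \<in> V" using Wc[of p] by (auto simp: opens_def)
        qed
      qed
      fix N assume "N \<in> W ` V"
      then obtain p where p: "p \<in> V" "N = W p" by blast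
      show "restr E V N (comb V a) = restr E V N t"
        using comb_restr[OF V _ a, of N] Wc[OF p(1)] aW[OF p(1)] p(2) by simp
    qed (use comb_closed[OF V a] t in auto)
    with a show ?thesis by blast
  qed
  have bij: "bij_betw (comb V) (carrier (sections FK V)) (carrier (sections E V))" if V: "V \<in> opens M B" for V
    unfolding bij_betw_def inj_on_def using comb_inj[OF V] comb_surj[OF V] comb_closed[OF V] by blast
  define h where "h V = inv_into (carrier (sections FK V)) (comb V)" for V
  have bij_h: "bij_betw (h V) (carrier (sections E V)) (carrier (sections FK V))" if V: "V \<in> opens M B" for V
    unfolding h_def by (rule bij_betw_inv_into[OF bij[OF V]])
  have h: "h V t \<in> carrier (sections FK V)" "comb V (h V t) = t"
    if V: "V \<in> opens M B" and t: "t \<in> carrier (sections E V)" for V t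
    using bij_h[OF V] t bij_betw_inv_into_right[OF bij[OF V] t] by (auto simp: h_def bij_betw_def)
  have "sheaf_hom M B E FK h"
    unfolding sheaf_hom_def module_hom_def
  proof (intro ballI conjI CollectI funcsetI)
    fix V assume V: "V \<in> opens M B"
    have oV: "openin (mtop M) V" by (rule opens_open[OF V])
    interpret E: module "hol_ring M V" "sections E V" by (rule module_sections[OF V])
    interpret G: module "hol_ring M V" "sections FK V" by (rule free_module[OF oV])
    fix t assume t: "t \<in> carrier (sections E V)"
    show "h V t \<in> carrier (sections FK V)" by (rule h(1)[OF V t])
    show "h V (t \<oplus>\<^bsub>sections E V\<^esub> u) = h V t \<oplus>\<^bsub>sections FK V\<^esub> h V u" if u: "u \<in> carrier (sections E V)" for u
      by (rule comb_inj[OF V]) (use h[OF V] t u comb_add[OF V h(1)[OF V t] h(1)[OF V u]] in auto)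
    show "h V (r \<odot>\<^bsub>sections E V\<^esub> t) = r \<odot>\<^bsub>sections FK V\<^esub> h V t" if r: "r \<in> carrier (hol_ring M V)" for r
      by (rule comb_inj[OF V]) (use h[OF V] t r comb_smult[OF V h(1)[OF V t] r] in auto)
    fix W assume W: "W \<in> opens M V"
    have WB: "W \<in> opens M B" by (rule opens_subset[OF V W])
    note tW = restr_closed[OF V W t]
    show "restr FK V W (h V t) = h W (restr E V W t)"
    proof (rule comb_inj[OF WB free_restr_closed[OF oV W h(1)[OF V t]] h(1)[OF WB tW]])
      show "comb W (restr FK V W (h V t)) = comb W (h W (restr E V W t))"
        using comb_restr[OF V W h(1)[OF V t]] h(2)[OF V t] h(2)[OF WB tW] by simp
    qed
  qed
  then show ?thesis using bij_h unfolding sheaf_isomorphic_def by blast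
qed

end

section \<open>Minimal generators and local freeness\<close>

lemma lincomb_add_smult:
  assumes A: "module R A" and K: "finite K" "s \<in> K \<rightarrow> carrier A"
    and b: "b \<in> K \<rightarrow> carrier R" and a: "a \<in> K \<rightarrow> carrier R" and r: "r \<in> carrier R"
  shows "lincomb A K (\<lambda>k. b k \<oplus>\<^bsub>R\<^esub> r \<otimes>\<^bsub>R\<^esub> a k) s = lincomb A K b s \<oplus>\<^bsub>A\<^esub> r \<odot>\<^bsub>A\<^esub> lincomb A K a s"
proof -
  interpret module R A by (rule A)
  have tb: "(\<lambda>k. b k \<odot>\<^bsub>A\<^esub> s k) \<in> K \<rightarrow> carrier A" and ta: "(\<lambda>k. a k \<odot>\<^bsub>A\<^esub> s k) \<in> K \<rightarrow> carrier A"
    using a b K by (auto simp: Pi_iff)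
  have tr: "(\<lambda>k. r \<odot>\<^bsub>A\<^esub> (a k \<odot>\<^bsub>A\<^esub> s k)) \<in> K \<rightarrow> carrier A"
    using ta r by (auto simp: Pi_iff)
  have "lincomb A K b s \<oplus>\<^bsub>A\<^esub> r \<odot>\<^bsub>A\<^esub> lincomb A K a s =
      finsum A (\<lambda>k. b k \<odot>\<^bsub>A\<^esub> s k \<oplus>\<^bsub>A\<^esub> r \<odot>\<^bsub>A\<^esub> (a k \<odot>\<^bsub>A\<^esub> s k)) K"
    unfolding lincomb_def finsum_smult_ldistr[OF K(1) r ta] by (rule M.finsum_addf[OF tb tr, symmetric])
  also have "\<dots> = lincomb A K (\<lambda>k. b k \<oplus>\<^bsub>R\<^esub> r \<otimes>\<^bsub>R\<^esub> a k) s"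
    unfolding lincomb_def
  proof (rule M.finsum_cong'[OF refl])
    fix k assume "k \<in> K"
    then have c: "a k \<in> carrier R" "b k \<in> carrier R" "s k \<in> carrier A" using a b K by auto
    show "b k \<odot>\<^bsub>A\<^esub> s k \<oplus>\<^bsub>A\<^esub> r \<odot>\<^bsub>A\<^esub> (a k \<odot>\<^bsub>A\<^esub> s k) = (b k \<oplus>\<^bsub>R\<^esub> r \<otimes>\<^bsub>R\<^esub> a k) \<odot>\<^bsub>A\<^esub> s k"
      using c r by (simp add: smult_l_distr smult_assoc1)
  qed (use a b r K in \<open>auto simp: Pi_iff\<close>)
  finally show ?thesis ..
qed

text \<open>
  The relation can be solved for \<open>s k0\<close>.
\<close>

lemma spans_eliminate:
  assumes A: "module R A" and sp: "spans R A K s T" and k0: "k0 \<in> K"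
    and a: "a \<in> K \<rightarrow> carrier R" "lincomb A K a s = \<zero>\<^bsub>A\<^esub>"
    and u: "u \<in> carrier R" "u \<otimes>\<^bsub>R\<^esub> a k0 = \<one>\<^bsub>R\<^esub>"
  shows "spans R A (K - {k0}) s T"
proof -
  interpret module R A by (rule A)
  have K: "finite K" "s \<in> K \<rightarrow> carrier A" using sp by (auto simp: spans_def)
  have ak: "a k0 \<in> carrier R" using a k0 by auto
  have "\<exists>c\<in>K - {k0} \<rightarrow> carrier R. t = lincomb A (K - {k0}) c s" if t: "t \<in> T" for t
  proof -
    obtain b where b: "b \<in> K \<rightarrow> carrier R" "t = lincomb A K b s" using sp t by (auto simp: spans_def)
    have bk: "b k0 \<in> carrier R" using b k0 by auto
    define r where "r = \<ominus>\<^bsub>R\<^esub> (b k0 \<otimes>\<^bsub>R\<^esub> u)"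
    have r: "r \<in> carrier R" using bk u by (simp add: r_def)
    define c where "c = (\<lambda>k. b k \<oplus>\<^bsub>R\<^esub> r \<otimes>\<^bsub>R\<^esub> a k)"
    have c: "c \<in> K \<rightarrow> carrier R" using a b r by (auto simp: c_def Pi_iff)
    have "r \<otimes>\<^bsub>R\<^esub> a k0 = \<ominus>\<^bsub>R\<^esub> (b k0)"
      using bk u ak by (simp add: r_def R.l_minus R.m_assoc)
    then have c0: "c k0 = \<zero>\<^bsub>R\<^esub>" using bk by (simp add: c_def R.r_neg)
    have tc: "lincomb A K b s \<in> carrier A"
      unfolding lincomb_def using b K by (auto intro!: M.finsum_closed simp: Pi_iff)
    have "lincomb A K c s = t"
      unfolding c_def lincomb_add_smult[OF A K b(1) a(1) r] using a(2) b(2) r tc by simp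
    also have "lincomb A K c s = lincomb A (insert k0 (K - {k0})) c s" using k0 by (simp add: insert_absorb)
    also have "\<dots> = c k0 \<odot>\<^bsub>A\<^esub> s k0 \<oplus>\<^bsub>A\<^esub> lincomb A (K - {k0}) c s"
      unfolding lincomb_def by (rule M.finsum_insert) (use K c k0 in \<open>auto simp: Pi_iff\<close>)
    also have "\<dots> = lincomb A (K - {k0}) c s"
    proof -
      have "s k0 \<in> carrier A" using K k0 by auto
      moreover have "lincomb A (K - {k0}) c s \<in> carrier A"
        unfolding lincomb_def using c K by (auto intro!: M.finsum_closed simp: Pi_iff)
      ultimately show ?thesis using c0 by simp
    qed
    finally show ?thesis using c by (intro bexI[of _ c]) auto
  qed
  then show ?thesis using K by (auto simp: spans_def)
qed

lemma (in complex_manifold) spans_restr: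
  assumes E: "O_presheaf M U E" and V: "V \<in> opens M U" and W: "W \<in> opens M V"
    and sp: "spans (hol_ring M V) (sections E V) K s T"
  shows "spans (hol_ring M W) (sections E W) K (\<lambda>k. restr E V W (s k)) (restr E V W ` T)"
proof -
  interpret O_presheaf M U E by (rule E)
  have WU: "W \<in> opens M U" by (rule opens_subset[OF V W])
  interpret V: module "hol_ring M V" "sections E V" by (rule module_sections[OF V])
  interpret W: module "hol_ring M W" "sections E W" by (rule module_sections[OF WU])
  have K: "finite K" "s \<in> K \<rightarrow> carrier (sections E V)" using sp by (auto simp: spans_def)
  have sW: "restr E V W (s k) \<in> carrier (sections E W)" if "k \<in> K" for k
    using restr_closed[OF V W] K that by auto
  have "\<exists>b\<in>K \<rightarrow> carrier (hol_ring M W). restr E V W t = lincomb (sections E W) K b (\<lambda>k. restr E V W (s k))"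
    if t: "t \<in> T" for t
  proof -
    obtain a where a: "a \<in> K \<rightarrow> carrier (hol_ring M V)" "t = lincomb (sections E V) K a s"
      using sp t by (auto simp: spans_def)
    have aW: "restrict (a k) W \<in> carrier (hol_ring M W)" if "k \<in> K" for k
      using hol_ring_restrict[OF _ W] a that by auto
    have "restr E V W t = finsum (sections E W) (\<lambda>k. restr E V W (a k \<odot>\<^bsub>sections E V\<^esub> s k)) K"
      unfolding a(2) lincomb_def
      by (rule restr_finsum[OF V W K(1)]) (use a K in \<open>auto simp: Pi_iff\<close>)
    also have "\<dots> = lincomb (sections E W) K (\<lambda>k. restrict (a k) W) (\<lambda>k. restr E V W (s k))"
      unfolding lincomb_def
    proof (rule W.M.finsum_cong'[OF refl])
      fix k assume "k \<in> K"
      then show "restr E V W (a k \<odot>\<^bsub>sections E V\<^esub> s k) = restrict (a k) W \<odot>\<^bsub>sections E W\<^esub> restr E V W (s k)"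
        using restr_smult[OF V W] a K by auto
    qed (use aW sW in auto)
    finally show ?thesis using aW by (intro bexI[of _ "\<lambda>k. restrict (a k) W"]) auto
  qed
  then show ?thesis using K sW by (auto simp: spans_def)
qed

lemma module_hom_kernel_submodule:
  assumes "module R A" "module R B" and h: "h \<in> module_hom R A B"
  shows "submodule {x \<in> carrier A. h x = \<zero>\<^bsub>B\<^esub>} R A"
proof -
  interpret A: module R A by fact
  interpret B: module R B by fact
  have hc: "h x \<in> carrier B" if "x \<in> carrier A" for x using h that by (auto simp: module_hom_def)
  have sm: "h (r \<odot>\<^bsub>A\<^esub> x) = r \<odot>\<^bsub>B\<^esub> h x" if "r \<in> carrier R" "x \<in> carrier A" for r x
    using h that by (simp add: module_hom_def)
  have neg: "\<ominus>\<^bsub>A\<^esub> x = (\<ominus>\<^bsub>R\<^esub> \<one>\<^bsub>R\<^esub>) \<odot>\<^bsub>A\<^esub> x" if "x \<in> carrier A" for x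
    using that by (subst A.smult_l_minus) auto
  have "h (\<zero>\<^bsub>R\<^esub> \<odot>\<^bsub>A\<^esub> \<zero>\<^bsub>A\<^esub>) = \<zero>\<^bsub>R\<^esub> \<odot>\<^bsub>B\<^esub> h \<zero>\<^bsub>A\<^esub>" by (rule sm) auto
  then have h0: "h \<zero>\<^bsub>A\<^esub> = \<zero>\<^bsub>B\<^esub>" using hc by simp
  show ?thesis
  proof (rule A.submoduleI)
    show "\<ominus>\<^bsub>A\<^esub> x \<in> {x \<in> carrier A. h x = \<zero>\<^bsub>B\<^esub>}" if "x \<in> {x \<in> carrier A. h x = \<zero>\<^bsub>B\<^esub>}" for x
      using that sm[of "\<ominus>\<^bsub>R\<^esub> \<one>\<^bsub>R\<^esub>" x] neg[of x] by simp
    show "x \<oplus>\<^bsub>A\<^esub> y \<in> {x \<in> carrier A. h x = \<zero>\<^bsub>B\<^esub>}"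
      if "x \<in> {x \<in> carrier A. h x = \<zero>\<^bsub>B\<^esub>}" "y \<in> {x \<in> carrier A. h x = \<zero>\<^bsub>B\<^esub>}" for x y
      using that h by (simp add: module_hom_def)
  qed (use h0 sm in auto)
qed

lemma O_module_restrict:
  assumes "O_module M U E" "U' \<subseteq> U"
  shows "O_module M U' E"
proof -
  have sub: "V \<in> opens M U" if "V \<in> opens M U'" for V using that assms(2) by (auto simp: opens_def)
  have pre: "O_presheaf M U E" using assms(1) by (simp add: O_module_def)
  have "O_presheaf M U' E" by (rule O_presheaf_restrict[OF pre assms(2)])
  moreover have "O_module_axioms M U' E"
  proof (rule O_module_axioms.intro)
    fix V \<V> s t
    assume "V \<in> opens M U'" "\<V> \<subseteq> opens M V" "\<Union>\<V> = V" "s \<in> carrier (sections E V)"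
      "t \<in> carrier (sections E V)" "\<And>W. W \<in> \<V> \<Longrightarrow> restr E V W s = restr E V W t"
    then show "s = t" by (rule O_module.separated[OF assms(1) sub])
  next
    fix V \<V> \<sigma>
    assume "V \<in> opens M U'" "\<V> \<subseteq> opens M V" "\<Union>\<V> = V"
      "\<And>W. W \<in> \<V> \<Longrightarrow> \<sigma> W \<in> carrier (sections E W)"
      "\<And>W W'. W \<in> \<V> \<Longrightarrow> W' \<in> \<V> \<Longrightarrow> restr E W (W \<inter> W') (\<sigma> W) = restr E W' (W \<inter> W') (\<sigma> W')"
    then show "\<exists>s\<in>carrier (sections E V). \<forall>W\<in>\<V>. restr E V W s = \<sigma> W"
      by (rule O_module.gluing[OF assms(1) sub])
  qed
  ultimately show ?thesis by (simp add: O_module_def)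
qed

lemma epi_with_kernel_restrict:
  assumes e: "epi_with_kernel M U G E P e" and B: "B \<in> opens M U"
  shows "epi_with_kernel M B G E P e"
proof -
  have ball: "\<forall>V\<in>opens M B. Q V" if "\<forall>V\<in>opens M U. Q V" for Q
    using that opens_subset[OF B] by blast
  show ?thesis
    using e unfolding epi_with_kernel_def sheaf_hom_def
    by (elim conjE, intro conjI) (erule ball)+
qed

text \<open>
  Finite generation over \<open>U\<close> says that the images of the basis sections, which may be infinitely many,
  all are combinations of the same finite family over the same open set. A family of least size among
  all neighbourhoods of \<open>x\<close> admits near \<open>x\<close> only relations that vanish at \<open>x\<close>, since any other relation would
  eliminate a generator. Elimination keeps one open set for all
  the basis sections, as \<open>presented_module\<close> requires.
\<close>

lemma (in complex_manifold) locally_free_near: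
  fixes E :: "('a, 'e) mod_data" and I :: "'i set" and J :: "'j set"
  assumes E: "O_module M (mpoints M) E" and conn: "connection M E nabla"
    and U: "openin (mtop M) U" and x: "x \<in> U"
    and \<phi>: "sheaf_hom M U (free_sheaf M I) (free_sheaf M J) \<phi>"
    and iso: "sheaf_isomorphic M U E (coker_sheaf M U (free_sheaf M I) (free_sheaf M J) \<phi>)"
    and fg: "finitely_generated (hol_ring M U)
          (quotient_module (sections (free_sheaf M J) U)
            (carrier (sections (image_sheaf M (free_sheaf M I) (free_sheaf M J) \<phi>) U)))"
  shows "\<exists>B n. openin (mtop M) B \<and> x \<in> B \<and> sheaf_isomorphic M B E (free_sheaf M {..<n::nat})"
proof -
  let ?F = "free_sheaf M I" and ?G = "free_sheaf M J"
  let ?P = "presheaf_image ?F \<phi>"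
  have Usub: "U \<subseteq> mpoints M" using U openin_subset by blast
  have EU: "O_module M U E" by (rule O_module_restrict[OF E Usub])
  interpret E: O_module M U E by (rule EU)
  have UU: "U \<in> opens M U" using U by (simp add: opens_def)
  interpret P: subpresheaf M U ?G ?P
    by (rule presheaf_image_subpresheaf[OF complex_manifold_axioms free_O_presheaf free_O_presheaf \<phi>])
  obtain e where e: "epi_with_kernel M U ?G E ?P e"
    using P.cokernel_epi[OF E.O_presheaf_axioms] iso unfolding coker_sheaf_def by blast
  have e_hom: "sheaf_hom M U ?G E e" using e by (simp add: epi_with_kernel_def)
  have eV: "e V \<in> module_hom (hol_ring M V) (sections ?G V) (sections E V)" if "V \<in> opens M U" for V
    using e_hom that by (simp add: sheaf_hom_def)
  let ?T = "\<lambda>V. (\<lambda>j. e V (basis_section J V j)) ` J"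
  \<comment> \<open>Only the images of the basis are required to be spanned; all other sections are spanned
      locally then.\<close>
  define good where "good n \<longleftrightarrow> (\<exists>W\<in>opens M U. x \<in> W \<and>
      (\<exists>s. spans (hol_ring M W) (sections E W) {..<n::nat} s (?T W)))" for n
  have T_restr: "restr E V W ` ?T V = ?T W" if V: "V \<in> opens M U" and W: "W \<in> opens M V" for V W
  proof -
    have oV: "openin (mtop M) V" and WV: "W \<subseteq> V" using V W by (auto simp: opens_def)
    have "restr E V W (e V (basis_section J V j)) = e W (basis_section J W j)" for j
      using e_hom V W basis_section_closed[OF oV, of J j] WV by (simp add: sheaf_hom_def basis_section_restr)
    then show ?thesis by (simp add: image_image)
  qed
  have "\<exists>n. good n"
  proof -
    let ?N = "{g \<in> carrier (sections ?G U). e U g = \<zero>\<^bsub>sections E U\<^esub>}"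
    have N_eq: "carrier (sections (image_sheaf M ?F ?G \<phi>) U) = ?N"
      unfolding image_sheaf_def generated_subsheaf_def
      using e UU by (auto simp: epi_with_kernel_def)
    have "submodule ?N (hol_ring M U) (sections ?G U)"
      by (rule module_hom_kernel_submodule[OF free_module[OF U] E.module_sections[OF UU] eV[OF UU]])
    then obtain n s where "spans (hol_ring M U) (sections E U) {..<n::nat} s (e U ` carrier (sections ?G U))"
      using spans_of_finitely_generated[OF free_module[OF U] E.module_sections[OF UU] eV[OF UU] _ _ fg[unfolded N_eq]]
      by blast
    moreover have "?T U \<subseteq> e U ` carrier (sections ?G U)"
      using basis_section_closed[OF U, of J] by blast
    ultimately have "spans (hol_ring M U) (sections E U) {..<n} s (?T U)"
      unfolding spans_def by blast
    then show ?thesis unfolding good_def using UU x by blast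
  qed
  define n where "n = (LEAST n. good n)"
  have "good n" unfolding n_def using \<open>\<exists>n. good n\<close> by (rule LeastI_ex)
  then obtain W s where W: "W \<in> opens M U" "x \<in> W"
    and s: "spans (hol_ring M W) (sections E W) {..<n} s (?T W)"
    unfolding good_def by blast
  have sc: "s k \<in> carrier (sections E W)" if "k < n" for k using s that by (auto simp: spans_def)
  have "\<exists>N g. N \<in> opens M W \<and> x \<in> N \<and> g \<in> carrier (sections ?G N) \<and> e N g = restr E W N (s k)" if "k < n" for k
    using e W sc[OF that] unfolding epi_with_kernel_def by blast
  then obtain N g0 where Ng: "\<And>k. k < n \<Longrightarrow> N k \<in> opens M W \<and> x \<in> N k \<and> g0 k \<in> carrier (sections ?G (N k)) \<and>
      e (N k) (g0 k) = restr E W (N k) (s k)"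
    by metis
  \<comment> \<open>Finitely many generators lift to the free sheaf on a common neighbourhood of \<open>x\<close>.\<close>
  define W0 where "W0 = \<Inter>(insert W (N ` {..<n}))"
  have "openin (mtop M) W0"
    unfolding W0_def by (rule openin_Inter) (use Ng W in \<open>auto simp: opens_def\<close>)
  moreover have "x \<in> W0" unfolding W0_def using Ng W by auto
  ultimately have oW0: "openin (mtop M) W0" "x \<in> W0" by auto
  obtain m X \<xi> \<epsilon> B where box: "chart_box m X \<xi> x \<epsilon> B" and BW0: "B \<subseteq> W0"
    using chart_box_exists[OF oW0(2,1)] by blast
  have oB: "openin (mtop M) B" and xB: "x \<in> B" using box by (auto simp: chart_box_def)
  have BN: "B \<in> opens M (N k)" if "k < n" for k
    using oB BW0 that by (auto simp: opens_def W0_def)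
  have BW: "B \<in> opens M W" using oB BW0 by (auto simp: opens_def W0_def)
  have BU: "B \<in> opens M U" by (rule opens_subset[OF W(1) BW])
  have subB: "V \<in> opens M U" if "V \<in> opens M B" for V by (rule opens_subset[OF BU that])
  have BB: "B \<in> opens M B" using oB by (simp add: opens_def)
  let ?s = "\<lambda>k. restr E W B (s k)"
  have sB: "spans (hol_ring M B) (sections E B) {..<n} ?s (?T B)"
    using spans_restr[OF E.O_presheaf_axioms W(1) BW s] T_restr[OF W(1) BW] by simp
  have EB: "O_module M B E" by (rule O_module_restrict[OF EU]) (use BU in \<open>simp add: opens_def\<close>)
  interpret gm: generated_module M B E "{..<n}" ?s
    by (intro generated_module.intro generated_module_axioms.intro complex_manifold_axioms EB oB)
      (use E.restr_closed[OF W(1) BW] sc in auto)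
  have "\<exists>f. f \<in> carrier (sections (free_sheaf M {..<n}) B) \<and> e B (basis_section J B j) = gm.comb B f"
    if j: "j \<in> J" for j
  proof -
    obtain a where a: "a \<in> {..<n} \<rightarrow> carrier (hol_ring M B)"
        "e B (basis_section J B j) = lincomb (sections E B) {..<n} a ?s"
      using sB j unfolding spans_def by blast
    have "restrict a {..<n} \<in> carrier (sections (free_sheaf M {..<n}) B)"
      unfolding free_carrier_finite[OF oB finite_lessThan] using a(1) by auto
    moreover have "lincomb (sections E B) {..<n} a ?s = gm.comb B (restrict a {..<n})"
    proof -
      interpret EB: module "hol_ring M B" "sections E B" by (rule E.module_sections[OF BU])
      have sc': "?s k \<in> carrier (sections E B)" if "k < n" for k
        using E.restr_closed[OF W(1) BW sc[OF that]] .
      show ?thesis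
        unfolding gm.comb_def lincomb_def
      proof (rule EB.M.finsum_cong'[OF refl])
        fix k assume k: "k \<in> {..<n}"
        then show "a k \<odot>\<^bsub>sections E B\<^esub> ?s k = restrict a {..<n} k \<odot>\<^bsub>sections E B\<^esub> restr E B B (?s k)"
          using E.restr_id[OF BU sc'] by simp
      next
        show "(\<lambda>k. restrict a {..<n} k \<odot>\<^bsub>sections E B\<^esub> restr E B B (?s k)) \<in> {..<n} \<rightarrow> carrier (sections E B)"
          using a(1) sc' E.restr_id[OF BU sc'] by (auto simp: Pi_iff)
      qed
    qed
    ultimately show ?thesis using a(2) by auto
  qed
  then obtain f where f: "\<And>j. j \<in> J \<Longrightarrow> f j \<in> carrier (sections (free_sheaf M {..<n}) B)"
    "\<And>j. j \<in> J \<Longrightarrow> e B (basis_section J B j) = gm.comb B (f j)" by metis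
  define g where "g k = restr ?G (N k) B (g0 k)" for k
  have g: "g k \<in> carrier (sections ?G B)" "e B (g k) = ?s k" if k: "k < n" for k
  proof -
    have NU: "N k \<in> opens M U" using opens_subset[OF W(1)] Ng[OF k] by blast
    show "g k \<in> carrier (sections ?G B)"
      unfolding g_def using Ng[OF k] BN[OF k] NU by (intro free_restr_closed) (auto simp: opens_def)
    have "g0 k \<in> carrier (sections ?G (N k))" using Ng[OF k] by blast
    then have "e B (g k) = restr E (N k) B (e (N k) (g0 k))"
      using e_hom NU BN[OF k] by (simp add: sheaf_hom_def g_def)
    then show "e B (g k) = ?s k"
      using E.restr_restr[OF W(1) _ BN[OF k] sc[OF k]] Ng[OF k] by simp
  qed
  interpret pm: presented_module M B E "{..<n}" ?s I J \<phi> e g f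
  proof (intro presented_module.intro presented_module_axioms.intro gm.generated_module_axioms)
    show "sheaf_hom M B ?F ?G \<phi>" using \<phi> subB by (simp add: sheaf_hom_def)
    show "epi_with_kernel M B ?G E ?P e"
      by (rule epi_with_kernel_restrict[OF e BU])
  qed (use g f in auto)
  \<comment> \<open>Where the coefficient \<open>r k\<close> is nonzero it is invertible, and the \<open>k\<close>-th generator can be
      dropped, contrary to the choice of \<open>n\<close>.\<close>
  have van_x: "r k x = 0" if r: "r \<in> pm.generator_relations" and k: "k \<in> {..<n}" for r k
  proof (rule ccontr)
    assume nz: "r k x \<noteq> 0"
    have rB: "r \<in> pm.relations B" using pm.generator_relations_subset r by blast
    then have rK: "r \<in> carrier (sections (free_sheaf M {..<n}) B)" by (simp add: pm.relations_def)
    note rc = free_carrierD(1)[OF oB rK]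
    define D where "D = {y \<in> B. r k y \<noteq> 0}"
    have oD: "openin (mtop M) D" unfolding D_def by (rule hol_ring_nonzero_open[OF oB rc[OF k]])
    have DB: "D \<in> opens M B" using oD by (auto simp: opens_def D_def)
    have DU: "D \<in> opens M U" by (rule subB[OF DB])
    have xD: "x \<in> D" using xB nz by (simp add: D_def)
    have sD: "spans (hol_ring M D) (sections E D) {..<n} (\<lambda>k. restr E B D (?s k)) (?T D)"
      using spans_restr[OF E.O_presheaf_axioms BU DB sB] T_restr[OF BU DB] by simp
    let ?r = "restr (free_sheaf M {..<n}) B D r"
    have r': "?r \<in> pm.relations D" by (rule pm.relations_restr[OF BB DB rB])
    then have rDK: "?r \<in> carrier (sections (free_sheaf M {..<n}) D)" by (simp add: pm.relations_def)
    note rDc = free_carrierD(1)[OF oD rDK]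
    have rD0: "lincomb (sections E D) {..<n} ?r (\<lambda>k. restr E B D (?s k)) = \<zero>\<^bsub>sections E D\<^esub>"
      using r' by (simp add: pm.relations_def gm.comb_def)
    let ?u = "\<lambda>y\<in>D. inverse (?r k y)"
    have u: "?u \<in> carrier (hol_ring M D)"
      by (rule hol_ring_inverse[OF oD rDc[OF k]]) (use k in \<open>auto simp: D_def\<close>)
    have u1: "?u \<otimes>\<^bsub>hol_ring M D\<^esub> ?r k = \<one>\<^bsub>hol_ring M D\<^esub>"
      unfolding hol_ring_sel by (rule restrict_ext) (use k in \<open>auto simp: D_def\<close>)
    have "spans (hol_ring M D) (sections E D) ({..<n} - {k}) (\<lambda>k. restr E B D (?s k)) (?T D)"
      by (rule spans_eliminate[OF E.module_sections[OF DU] sD k _ rD0 u u1]) (use rDc in auto)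
    then have "\<exists>s'. spans (hol_ring M D) (sections E D) {..<card ({..<n} - {k})} s' (?T D)"
      by (rule spans_reindex[OF E.module_sections[OF DU]])
    moreover have "card ({..<n} - {k}) = n - 1" using k by simp
    ultimately have "good (n - 1)" unfolding good_def using DU xD by auto
    moreover have "n - 1 < n" using k by auto
    ultimately show False using not_less_Least[of "n - 1" good] by (simp add: n_def)
  qed
  have "r k p = 0" if "r \<in> pm.generator_relations" "k \<in> {..<n}" "p \<in> B" for r k p
    by (rule pm.generator_relations_vanish_on_box[OF conn box _ that]) (rule van_x)
  then have "sheaf_isomorphic M B E (free_sheaf M {..<n})" by (rule pm.isomorphic_free)
  then show ?thesis using oB xB by blast
qed

theorem theorem1p8p5:
  fixes M :: "'a cmanifold"
    and E :: "('a, 'e) mod_data"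
    and nabla :: "'a set \<Rightarrow> ('a \<Rightarrow> ('a \<Rightarrow> complex) \<Rightarrow> complex) \<Rightarrow> 'e \<Rightarrow> 'e"
  assumes "complex_manifold M"
    and "O_module M (mpoints M) E"
    and "connection M E nabla"
    and "\<forall>x\<in>mpoints M. \<exists>U. openin (mtop M) U \<and> x \<in> U \<and>
      (\<exists>(I :: 'i set) (J :: 'j set) \<phi>.
        sheaf_hom M U (free_sheaf M I) (free_sheaf M J) \<phi> \<and>
        sheaf_isomorphic M U E (coker_sheaf M U (free_sheaf M I) (free_sheaf M J) \<phi>) \<and>
        finitely_generated (hol_ring M U)
          (quotient_module (sections (free_sheaf M J) U)
            (carrier (sections (image_sheaf M (free_sheaf M I) (free_sheaf M J) \<phi>) U))))"
  shows "locally_free M E"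
  unfolding locally_free_def
proof
  fix x assume "x \<in> mpoints M"
  then obtain U and I :: "'i set" and J :: "'j set" and \<phi> where U: "openin (mtop M) U" "x \<in> U"
    "sheaf_hom M U (free_sheaf M I) (free_sheaf M J) \<phi>"
    "sheaf_isomorphic M U E (coker_sheaf M U (free_sheaf M I) (free_sheaf M J) \<phi>)"
    "finitely_generated (hol_ring M U)
          (quotient_module (sections (free_sheaf M J) U)
            (carrier (sections (image_sheaf M (free_sheaf M I) (free_sheaf M J) \<phi>) U)))"
    using assms(4) by blast
  show "\<exists>U n. openin (mtop M) U \<and> x \<in> U \<and> sheaf_isomorphic M U E (free_sheaf M {..<n::nat})"
    by (rule complex_manifold.locally_free_near[OF assms(1-3) U])
qed

end
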